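(* Suppose $f$ is a quasiperiodically forced circle homeomorphism of $\mathbb{T}^2$ which has no invariant strip (i.e. no $(p,q)$-invariant strip for any $p,q\ge 1$). Then $f$ has a unique minimal set.
   Context: $\mathbb{T}^1=\mathbb{R}/\mathbb{Z}$, $\mathbb{T}^2=\mathbb{T}^1\times\mathbb{T}^1$, $p_1(\theta,x)=\theta$, and $A_\theta=\{x\in\mathbb{T}^1: (\theta,x)\in A\}$ for $A\subseteq\mathbb{T}^2$. A quasiperiodically forced circle homeomorphism is a homeomorphism $f$ of $\mathbb{T}^2$, isotopic to the identity, of the form $f(\theta,x)=(\theta+\omega,f_\theta(x))$ with $\omega\in\mathbb{R}\setminus\mathbb{Q}$. A minimal set is a non-empty compact invariant set which contains no strictly smaller non-empty compact invariant set. For integers $p,q\geq 1$, a $(p,q)$-invariant strip of $f$ is a compact set $A\subset\mathbb{T}^2$ with $f(A)=A$ such that: (1) for every $\theta\in\mathbb{T}^1$ the set $A_\theta$ is a disjoint union of exactly $pq$ non-empty compact intervals (possibly reduced to points, none of them being the whole circle); (2) $\mathbb{T}^2\setminus A$ has exactly $p$ connected components, which are cyclically permuted by $f$; (3) each component $U$ of $\mathbb{T}^2\setminus A$ intersects every fibre $\{\theta\}\times\mathbb{T}^1$ in exactly $q$ open intervals, and contains a simple closed curve $C$ such that $p_1|_C:C\to\mathbb{T}^1$ is a $q$-fold covering and $C$ meets each of the $q$ intervals of $U$ in each fibre exactly once. *)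

theory Defs
  imports "HOL-Analysis.Analysis"
begin

text \<open>The circle $\mathbb{R}/\mathbb{Z}$: quotient group, quotient topology. The torus is the type
  \<open>circle \<times> circle\<close> with its product topology.\<close>

quotient_type circle = real / "\<lambda>x y :: real. x - y \<in> \<int>"
  morphisms rep_circle to_circle
proof (rule equivpI)
  show "reflp (\<lambda>x y :: real. x - y \<in> \<int>)"
    by (simp add: reflp_def)
  show "symp (\<lambda>x y :: real. x - y \<in> \<int>)"
    by (metis (no_types, lifting) Ints_minus minus_diff_eq sympI)
  show "transp (\<lambda>x y :: real. x - y \<in> \<int>)"
    by (metis (no_types, lifting) Ints_add diff_add_cancel add_diff_eq transpI)
qed

lemma to_circle_eq_iff: "to_circle x = to_circle y \<longleftrightarrow> x - y \<in> \<int>"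
  by (rule circle.abs_eq_iff)

lemma surj_to_circle: "surj to_circle"
  by (metis Quotient_circle Quotient_abs_rep surjI)

instantiation circle :: ab_group_add
begin

lift_definition zero_circle :: circle is 0 .

lift_definition plus_circle :: "circle \<Rightarrow> circle \<Rightarrow> circle" is "(+)"
  by (metis (no_types, lifting) Ints_add add_diff_add)

lift_definition uminus_circle :: "circle \<Rightarrow> circle" is uminus
  by (metis Ints_minus minus_diff_minus)

lift_definition minus_circle :: "circle \<Rightarrow> circle \<Rightarrow> circle" is "(-)"
proof -
  fix a b c d :: real
  assume "a - b \<in> \<int>" "c - d \<in> \<int>"
  then have "(a - b) - (c - d) \<in> \<int>" by (rule Ints_diff)
  then show "(a - c) - (b - d) \<in> \<int>" by (simp add: algebra_simps)
qed

instance
  by standard (transfer; simp)+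

end

instantiation circle :: topological_space
begin

definition open_circle :: "circle set \<Rightarrow> bool"
  where "open_circle U \<longleftrightarrow> open (to_circle -` U)"

instance
  by standard (auto simp: open_circle_def vimage_Union)

end

text \<open>Intervals of the circle, none of them the whole circle. An open interval may be the
  complement of a single point.\<close>

definition compact_interval :: "circle set \<Rightarrow> bool"
  where "compact_interval I \<longleftrightarrow> (\<exists>a b. a \<le> b \<and> b < a + 1 \<and> I = to_circle ` {a..b})"

definition open_interval :: "circle set \<Rightarrow> bool"
  where "open_interval I \<longleftrightarrow> (\<exists>a b. a < b \<and> b \<le> a + 1 \<and> I = to_circle ` {a<..<b})"

definition fibre :: "(circle \<times> circle) set \<Rightarrow> circle \<Rightarrow> circle set"
  where "fibre A \<theta> = {x. (\<theta>, x) \<in> A}"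

definition isotopic_to_id :: "('a::topological_space \<Rightarrow> 'a) \<Rightarrow> bool"
  where "isotopic_to_id f \<longleftrightarrow>
    homotopic_with (homeomorphic_map euclidean euclidean) euclidean euclidean id f"

definition qpf_circle_homeo :: "(circle \<times> circle \<Rightarrow> circle \<times> circle) \<Rightarrow> bool"
  where "qpf_circle_homeo f \<longleftrightarrow>
    homeomorphic_map euclidean euclidean f \<and> isotopic_to_id f \<and>
    (\<exists>\<omega>::real. \<omega> \<notin> \<rat> \<and> (\<forall>\<theta> x. fst (f (\<theta>, x)) = \<theta> + to_circle \<omega>))"

definition compact_invariant :: "('a::topological_space \<Rightarrow> 'a) \<Rightarrow> 'a set \<Rightarrow> bool"
  where "compact_invariant f M \<longleftrightarrow> M \<noteq> {} \<and> compact M \<and> f ` M = M"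

definition minimal_set :: "('a::topological_space \<Rightarrow> 'a) \<Rightarrow> 'a set \<Rightarrow> bool"
  where "minimal_set f M \<longleftrightarrow>
    compact_invariant f M \<and> \<not> (\<exists>K. K \<subset> M \<and> compact_invariant f K)"

definition partition_into :: "nat \<Rightarrow> ('a set \<Rightarrow> bool) \<Rightarrow> 'a set \<Rightarrow> 'a set set \<Rightarrow> bool"
  where "partition_into n P S \<I> \<longleftrightarrow>
    partition_on S \<I> \<and> finite \<I> \<and> card \<I> = n \<and> (\<forall>I\<in>\<I>. P I)"

definition cyclically_permuted :: "('a \<Rightarrow> 'a) \<Rightarrow> nat \<Rightarrow> 'a set set \<Rightarrow> bool"
  where "cyclically_permuted f p \<U> \<longleftrightarrow>
    (\<exists>U. bij_betw U {..<p} \<U> \<and> (\<forall>i<p. f ` U i = U (Suc i mod p)))"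

definition simple_closed_curve :: "'a::topological_space set \<Rightarrow> bool"
  where "simple_closed_curve C \<longleftrightarrow>
    (\<exists>\<gamma>. simple_path \<gamma> \<and> pathfinish \<gamma> = pathstart \<gamma> \<and> path_image \<gamma> = C)"

definition fold_covering ::
    "nat \<Rightarrow> 'a::topological_space set \<Rightarrow> ('a \<Rightarrow> 'b) \<Rightarrow> 'b::topological_space set \<Rightarrow> bool"
  where "fold_covering q C \<pi> S \<longleftrightarrow>
    covering_space C \<pi> S \<and> (\<forall>y\<in>S. finite {c\<in>C. \<pi> c = y} \<and> card {c\<in>C. \<pi> c = y} = q)"

text \<open>In the last clause, \<open>J \<theta>\<close> is the (unique) family of the \<open>q\<close> intervals of \<open>U\<close>
  in the fibre over \<open>\<theta>\<close>.\<close>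

definition invariant_strip ::
    "(circle \<times> circle \<Rightarrow> circle \<times> circle) \<Rightarrow> nat \<Rightarrow> nat \<Rightarrow> (circle \<times> circle) set \<Rightarrow> bool"
  where "invariant_strip f p q A \<longleftrightarrow>
    compact A \<and> f ` A = A \<and>
    (\<forall>\<theta>. \<exists>\<I>. partition_into (p * q) compact_interval (fibre A \<theta>) \<I>) \<and>
    card (components (- A)) = p \<and> cyclically_permuted f p (components (- A)) \<and>
    (\<forall>U\<in>components (- A). \<exists>J.
       (\<forall>\<theta>. partition_into q open_interval (fibre U \<theta>) (J \<theta>)) \<and>
       (\<exists>C. simple_closed_curve C \<and> C \<subseteq> U \<and> fold_covering q C fst UNIV \<and>
            (\<forall>\<theta>. \<forall>I\<in>J \<theta>. \<exists>!x. x \<in> I \<and> (\<theta>, x) \<in> C)))"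

end

theory Submission
  imports Defs
begin

text \<open>A minimal set exists by Zorn's lemma. Suppose that there are two, \<open>M\<close> and \<open>M'\<close>. They are disjoint, and since
the rotation of the base is minimal, both meet every fibre. From this an invariant strip is constructed,
which gives uniqueness.

Follow a fibre once around and count how often it passes from \<open>M\<close> to \<open>M'\<close>. Two disjoint compact sets have
positive distance, so this number is finite; and it can only jump up in a limit, because a limit of
alternating chains of points is again an alternating chain. Hence the base points whose fibres have at least
\<open>m\<close> alternations form a closed set. This set is invariant under the rotation, so it is empty or everything,
and all fibres have the same number \<open>N\<close> of alternations (\<open>chain_everywhere\<close>, \<open>ex_maximal_pair\<close>).

In each fibre \<open>M\<close> is therefore contained in \<open>N\<close> blocks, the maximal intervals that begin and end in \<open>M\<close> and
avoid \<open>M'\<close>; they are separated by \<open>N\<close> gaps, each of which contains one block of \<open>M'\<close>. As \<open>N\<close> is constant, no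
block is born or dies when the fibre moves. Over the universal cover \<open>\<real>\<^sup>2\<close> the blocks can thus be numbered by
the integers in a locally constant way, in the order of the fibre, even numbers for \<open>M\<close> and odd ones for \<open>M'\<close>
(\<open>ex_indexed_set\<close>). One turn in the fibre raises the number by \<open>2 N\<close>, one turn in the base raises it by a
constant \<open>2 d\<close>, the monodromy. The rest of the picture is arithmetic: with \<open>p = gcd N d\<close> and \<open>q = N / p\<close>, the
complement of the union \<open>A\<close> of the blocks of \<open>M\<close> consists of \<open>p\<close> components, each having \<open>q\<close> gaps in every
fibre, and a continuous choice of one point in each gap draws the closed curves that wind \<open>q\<close> times around
the base (\<open>complement_is_strip\<close>).

It remains to bring in the dynamics. A point lies outside \<open>A\<close> if and only if it can be joined to \<open>M'\<close> inside
its fibre without touching \<open>M\<close> (\<open>Union_comp_eq\<close>). A fibred homeomorphism preserves this property, hence it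
preserves \<open>A\<close> and permutes the components of the complement. The components in one orbit cover a closed
invariant part of \<open>M'\<close>, which is all of \<open>M'\<close> by minimality; as every component meets \<open>M'\<close>, there is only one
orbit (\<open>comps_cyclically_permuted\<close>).\<close>

section \<open>The circle and the torus\<close>

lemma continuous_on_to_circle: "continuous_on S to_circle"
proof -
  have "continuous_on UNIV to_circle"
    by (subst continuous_on_open_vimage) (auto simp: open_circle_def)
  then show ?thesis
    using continuous_on_subset by blast
qed

lemma closed_circle_iff: "closed (S :: circle set) \<longleftrightarrow> closed (to_circle -` S)"
  by (simp add: closed_def open_circle_def vimage_Compl)

lemma to_circle_add_of_int [simp]: "to_circle (x + of_int k) = to_circle x"
  by (simp add: to_circle_eq_iff)

lemma to_circle_eqE:
  assumes "to_circle x = to_circle y"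
  obtains k :: int where "x = y + of_int k"
  using assms unfolding to_circle_eq_iff by (metis Ints_cases add_diff_cancel_left' diff_add_cancel add.commute)

lemma to_circle_add: "to_circle (x + y) = to_circle x + to_circle y"
  by (simp add: plus_circle.abs_eq)

text \<open>The full preimage of the image is the union of all integer translates.\<close>

lemma open_image_to_circle:
  assumes "open U"
  shows "open (to_circle ` U)"
proof -
  have "to_circle -` to_circle ` U = (\<Union>k::int. (\<lambda>x. x + of_int k) ` U)"
    by (auto elim!: to_circle_eqE)
  moreover have "open ((\<lambda>x. x + of_int k) ` U)" for k :: int
    using open_translation [OF assms, of "of_int k"] by (simp add: add.commute)
  ultimately show ?thesis
    by (auto simp: open_circle_def)
qed

lemma ex_to_circle: obtains x where "c = to_circle x"
  using surj_to_circle by (metis surjD)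

lemma ex_to_circle_in_period:
  obtains x where "a \<le> x" "x < a + 1" "c = to_circle x"
proof -
  obtain y where y: "c = to_circle y" by (rule ex_to_circle)
  have "c = to_circle (y + of_int (- \<lfloor>y - a\<rfloor>))"
    using y by (simp only: to_circle_add_of_int)
  moreover have "a \<le> y + of_int (- \<lfloor>y - a\<rfloor>)" "y + of_int (- \<lfloor>y - a\<rfloor>) < a + 1"
    by (simp_all, linarith+)
  ultimately show thesis using that by blast
qed

text \<open>The lifts of two distinct points differ by a real number at positive distance from the closed set \<open>\<int>\<close>.\<close>

instance circle :: t2_space
proof
  fix c d :: circle
  assume "c \<noteq> d"
  obtain x where x: "c = to_circle x" by (rule ex_to_circle)
  obtain y where y: "d = to_circle y" by (rule ex_to_circle)
  have "x - y \<notin> \<int>"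
    using \<open>c \<noteq> d\<close> x y by (simp add: to_circle_eq_iff)
  then obtain e where e: "e > 0" "ball (x - y) e \<subseteq> - \<int>"
    using closed_Ints by (metis ComplI open_Compl openE)
  have "to_circle ` ball x (e/2) \<inter> to_circle ` ball y (e/2) = {}"
  proof (rule ccontr)
    assume "\<not> ?thesis"
    then obtain u v where uv: "u \<in> ball x (e/2)" "v \<in> ball y (e/2)" "u - v \<in> \<int>"
      by (auto simp: to_circle_eq_iff)
    then have "u - v \<in> ball (x - y) e"
      unfolding dist_real_def mem_ball by linarith
    with uv e show False by blast
  qed
  moreover have "c \<in> to_circle ` ball x (e/2)" "d \<in> to_circle ` ball y (e/2)"
    using x y e by auto
  ultimately show "\<exists>U V. open U \<and> open V \<and> c \<in> U \<and> d \<in> V \<and> U \<inter> V = {}"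
    using open_image_to_circle [OF open_ball, of x "e/2"] open_image_to_circle [OF open_ball, of y "e/2"]
    by (intro exI [of _ "to_circle ` ball x (e/2)"] exI [of _ "to_circle ` ball y (e/2)"] conjI)
qed

lemma compact_UNIV_circle: "compact (UNIV :: circle set)"
proof -
  have "UNIV = to_circle ` {0..1}"
    using ex_to_circle_in_period [of 0] by (metis UNIV_eq_I add_0 atLeastAtMost_iff image_eqI less_imp_le)
  then show ?thesis
    using compact_continuous_image [OF continuous_on_to_circle compact_Icc] by metis
qed

lemma compact_UNIV_torus: "compact (UNIV :: (circle \<times> circle) set)"
  using compact_Times [OF compact_UNIV_circle compact_UNIV_circle] by simp

lemma compact_torus_iff_closed: "compact (A :: (circle \<times> circle) set) \<longleftrightarrow> closed A"
  using compact_UNIV_torus compact_Int_closed compact_imp_closed by (metis Int_UNIV_left)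

abbreviation to_torus :: "real \<times> real \<Rightarrow> circle \<times> circle"
  where "to_torus \<equiv> map_prod to_circle to_circle"

lemma continuous_on_to_torus: "continuous_on S to_torus"
  unfolding map_prod_def case_prod_unfold
  by (intro continuous_intros continuous_on_compose2 [OF continuous_on_to_circle]) auto

lemma open_image_to_torus:
  assumes "open U"
  shows "open (to_torus ` U)"
proof (subst open_subopen, rule ballI)
  fix z assume "z \<in> to_torus ` U"
  then obtain t y where ty: "(t, y) \<in> U" "z = to_torus (t, y)" by auto
  then obtain A B where AB: "open A" "open B" "(t, y) \<in> A \<times> B" "A \<times> B \<subseteq> U"
    using assms open_prod_elim by metis
  have "open (to_circle ` A \<times> to_circle ` B)"
    by (intro open_Times open_image_to_circle AB)
  moreover have "z \<in> to_circle ` A \<times> to_circle ` B" using AB ty by auto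
  moreover have "to_circle ` A \<times> to_circle ` B \<subseteq> to_torus ` U"
    using AB by (force simp: image_iff)
  ultimately show "\<exists>T. open T \<and> z \<in> T \<and> T \<subseteq> to_torus ` U" by blast
qed

lemma ex_to_circle_inverse:
  assumes "b \<le> a + 1"
  obtains g where "homeomorphism {a<..<b} (to_circle ` {a<..<b}) to_circle g"
proof (rule homeomorphism_injective_open_map [of "{a<..<b}" to_circle "to_circle ` {a<..<b}"])
  show "inj_on to_circle {a<..<b}"
  proof (rule inj_onI)
    fix x y assume xy: "x \<in> {a<..<b}" "y \<in> {a<..<b}" "to_circle x = to_circle y"
    then obtain k :: int where "x = y + of_int k" by (elim to_circle_eqE)
    with xy assms have "of_int k < (1::real)" "of_int k > (-1::real)" by auto
    then have "k = 0" by linarith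
    with \<open>x = y + of_int k\<close> show "x = y" by simp
  qed
  fix U assume "openin (top_of_set {a<..<b}) U"
  then have "open U \<and> U \<subseteq> {a<..<b}"
    by (simp add: openin_open_eq)
  then show "openin (top_of_set (to_circle ` {a<..<b})) (to_circle ` U)"
    by (simp add: image_mono open_image_to_circle openin_open_eq)
qed (auto simp: continuous_on_to_circle)

text \<open>A connected set that misses one point is contained in the circle cut open at that point, which is an open
interval of length one. This makes it unnecessary to lift connected sets to the real line.\<close>

lemma connected_contains_arc:
  assumes "connected I" "to_circle x0 \<notin> I"
    and "to_circle y \<in> I" "to_circle z \<in> I" "x0 < y" "y \<le> z" "z < x0 + 1"
  shows "to_circle ` {y..z} \<subseteq> I"
proof -
  obtain g where g: "homeomorphism {x0<..<x0+1} (to_circle ` {x0<..<x0+1}) to_circle g"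
    by (rule ex_to_circle_inverse [of "x0 + 1" x0]) auto
  have sub: "I \<subseteq> to_circle ` {x0<..<x0+1}"
  proof
    fix c assume "c \<in> I"
    obtain u where "x0 \<le> u" "u < x0 + 1" "c = to_circle u" by (rule ex_to_circle_in_period)
    with \<open>c \<in> I\<close> assms(2) show "c \<in> to_circle ` {x0<..<x0+1}" by (cases "u = x0") auto
  qed
  have "connected (g ` I)"
    using assms(1) g sub by (meson connected_continuous_image continuous_on_subset homeomorphism_cont2)
  moreover have "y \<in> g ` I" "z \<in> g ` I"
    using assms g by (force simp: image_iff homeomorphism_def)+
  ultimately have "{y..z} \<subseteq> g ` I"
    using connected_contains_Icc by blast
  then have "to_circle ` {y..z} \<subseteq> to_circle ` g ` I" by (rule image_mono)
  also have "\<dots> = I"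
    using sub g by (force simp: homeomorphism_def image_iff)
  finally show ?thesis .
qed

text \<open>By Kronecker's theorem the forward orbit of each point under an irrational rotation is dense.\<close>

lemma rotation_invariant_closed_eq_UNIV:
  assumes "\<omega> \<notin> \<rat>" "closed S" "S \<noteq> {}" and inv: "\<And>\<theta>. \<theta> \<in> S \<Longrightarrow> \<theta> + to_circle \<omega> \<in> S"
  shows "S = UNIV"
proof -
  obtain c where "c \<in> S" using \<open>S \<noteq> {}\<close> by blast
  moreover obtain s where "c = to_circle s" by (rule ex_to_circle)
  ultimately have s: "to_circle s \<in> S" by simp
  have iter: "to_circle (s + real k * \<omega>) \<in> S" for k
  proof (induction k)
    case (Suc k)
    then show ?case using inv [OF Suc] by (simp add: to_circle_add [symmetric] algebra_simps)
  qed (use s in simp)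
  have "to_circle y \<in> S" for y
  proof -
    have "closed (to_circle -` S)"
      using continuous_on_to_circle \<open>closed S\<close> by (metis closed_vimage)
    moreover have "\<exists>x \<in> to_circle -` S. dist x y < e" if "e > 0" for e
    proof -
      have "0 \<le> frac (y - s)" "frac (y - s) \<le> 1"
        using frac_lt_1 [of "y - s"] by simp_all
      from Kronecker_approx_1_explicit [OF assms(1) this that]
      obtain k :: nat where k: "\<bar>frac (real k * \<omega>) - frac (y - s)\<bar> < e"
        by blast
      define x where "x = s + real k * \<omega> + of_int (\<lfloor>y - s\<rfloor> - \<lfloor>real k * \<omega>\<rfloor>)"
      have "x \<in> to_circle -` S"
        unfolding x_def using iter by (simp only: vimage_eq to_circle_add_of_int)
      moreover have "dist x y < e"
        using k unfolding x_def dist_real_def frac_def by (simp add: algebra_simps)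
      ultimately show ?thesis by blast
    qed
    ultimately show ?thesis
      by (metis closed_approachable vimage_eq)
  qed
  then have "range to_circle \<subseteq> S" by blast
  then show ?thesis using surj_to_circle by blast
qed

section \<open>Topological preliminaries\<close>

text \<open>The strips are closed and locally finite. The lemma serves twice: for interpolation between integer points,
and for extending an index function from one period of the base to the whole line.\<close>

lemma continuous_on_integer_strips:
  fixes p :: "'a::topological_space \<Rightarrow> real" and g :: "'a \<Rightarrow> 'b::topological_space"
  assumes p: "continuous_on S p"
    and g: "\<And>n::int. continuous_on (S \<inter> p -` {of_int n..of_int n + 1}) g"
  shows "continuous_on S g"
  unfolding continuous_on_def
proof
  fix x assume "x \<in> S"
  define n where "n = \<lfloor>p x\<rfloor>"
  define A where "A = S \<inter> p -` {of_int (n - 1)..of_int (n - 1) + 1}"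
  define B where "B = S \<inter> p -` {of_int n..of_int n + 1}"
  have cl: "closedin (top_of_set S) A" "closedin (top_of_set S) B"
    unfolding A_def B_def using p by (simp_all add: continuous_closedin_preimage)
  have "continuous_on (A \<union> B) g"
  proof (rule continuous_on_Un_local)
    show "closedin (top_of_set (A \<union> B)) A" "closedin (top_of_set (A \<union> B)) B"
      using cl by (meson Un_upper1 Un_upper2 Un_least closedin_imp_subset closedin_subset_trans)+
    show "continuous_on A g" "continuous_on B g"
      unfolding A_def B_def by (rule g)+
  qed
  moreover have "x \<in> A \<union> B"
    unfolding A_def B_def n_def using \<open>x \<in> S\<close> by (auto; linarith)
  ultimately have "(g \<longlongrightarrow> g x) (at x within A \<union> B)"
    by (simp add: continuous_on_def)
  moreover have "at x within S = at x within A \<union> B"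
  proof -
    obtain W where W: "open W" "S \<inter> p -` {of_int n - 1<..<of_int n + 1} = S \<inter> W"
      using continuous_openin_preimage_gen [OF p open_greaterThanLessThan]
      by (metis openin_open)
    have "x \<in> S \<inter> p -` {of_int n - 1<..<of_int n + 1}"
      unfolding n_def using \<open>x \<in> S\<close> by (auto; linarith)
    with W have "x \<in> W" by blast
    moreover have "S \<inter> p -` {of_int n - 1<..<of_int n + 1} \<subseteq> A \<union> B" "A \<union> B \<subseteq> S"
      unfolding A_def B_def by auto
    then have "S \<inter> W - {x} = (A \<union> B) \<inter> W - {x}"
      using W(2) by blast
    ultimately show ?thesis using W(1) by (intro at_within_nhd) auto
  qed
  ultimately show "(g \<longlongrightarrow> g x) (at x within S)" by simp
qed

lemma components_Union_disjoint_open: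
  fixes \<V> :: "'a::topological_space set set"
  assumes "\<And>V. V \<in> \<V> \<Longrightarrow> open V \<and> connected V \<and> V \<noteq> {}" and "disjoint \<V>"
  shows "components (\<Union>\<V>) = \<V>"
proof -
  have comp: "V \<in> components (\<Union>\<V>)" if V: "V \<in> \<V>" for V
    unfolding in_components_maximal
  proof (intro conjI allI impI; (elim conjE)?)
    fix D assume D: "D \<noteq> {}" "V \<subseteq> D" "D \<subseteq> \<Union>\<V>" "connected D"
    define R where "R = \<Union>(\<V> - {V})"
    have "open R" unfolding R_def using assms(1) by auto
    moreover have "V \<inter> R = {}" unfolding R_def using assms(2) V by (auto simp: disjoint_def)
    moreover have "D \<subseteq> V \<union> R" unfolding R_def using D by auto
    ultimately have "D \<inter> V = {} \<or> D \<inter> R = {}"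
      using D assms(1) [OF V] connectedD [of D V R] by blast
    with D assms(1) [OF V] \<open>D \<subseteq> V \<union> R\<close> show "D = V" by blast
  qed (use V assms(1) in auto)
  show ?thesis
  proof
    show "components (\<Union>\<V>) \<subseteq> \<V>"
    proof
      fix C assume C: "C \<in> components (\<Union>\<V>)"
      obtain x where "x \<in> C" using in_components_nonempty [OF C] by blast
      with in_components_subset [OF C] obtain V where V: "V \<in> \<V>" "C \<inter> V \<noteq> {}"
        by blast
      with components_eq [OF C comp [OF V(1)]] show "C \<in> \<V>" by simp
    qed
  qed (use comp in blast)
qed

lemma open_convex_bounded_real_eq_interval:
  fixes S :: "real set"
  assumes "open S" "convex S" "S \<noteq> {}" "bdd_below S" "bdd_above S"
  shows "Inf S < Sup S \<and> S = {Inf S<..<Sup S}"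
proof -
  have "x \<in> {Inf S<..<Sup S}" if "x \<in> S" for x
  proof -
    obtain e where e: "e > 0" "cball x e \<subseteq> S"
      using open_contains_cball [THEN iffD1, OF assms(1)] \<open>x \<in> S\<close> by blast
    then have "x - e \<in> S" "x + e \<in> S" by (auto simp: dist_real_def)
    then have "Inf S \<le> x - e" "x + e \<le> Sup S" using assms by (auto intro: cInf_lower cSup_upper)
    with e show ?thesis by auto
  qed
  moreover have "x \<in> S" if "x \<in> {Inf S<..<Sup S}" for x
  proof -
    obtain u v where "u \<in> S" "u < x" "v \<in> S" "x < v"
      using \<open>x \<in> {Inf S<..<Sup S}\<close> assms by (auto simp: cInf_less_iff less_cSup_iff)
    then have "x \<in> {u..v}" by auto
    moreover have "{u..v} \<subseteq> S"
      using assms(2) \<open>u \<in> S\<close> \<open>v \<in> S\<close> by (meson connected_contains_Icc convex_connected)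
    ultimately show ?thesis by blast
  qed
  ultimately have "S = {Inf S<..<Sup S}" by blast
  moreover from this have "Inf S < Sup S" using assms(3) by (metis greaterThanLessThan_empty_iff not_le)
  ultimately show ?thesis by blast
qed

definition piecewise_linear :: "(int \<Rightarrow> real) \<Rightarrow> real \<Rightarrow> real"
  where "piecewise_linear h x = (1 - frac x) * h \<lfloor>x\<rfloor> + frac x * h (\<lfloor>x\<rfloor> + 1)"

lemma continuous_on_piecewise_linear: "continuous_on S (piecewise_linear h)"
proof -
  have "continuous_on UNIV (piecewise_linear h)"
  proof (rule continuous_on_integer_strips [where p = id])
    fix n :: int
    have "piecewise_linear h x = (1 - (x - of_int n)) * h n + (x - of_int n) * h (n + 1)"
      if "x \<in> {of_int n..of_int n + 1}" for x
    proof (cases "x = of_int n + 1")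
      case True
      then have "\<lfloor>x\<rfloor> = n + 1" by simp
      then show ?thesis using True by (simp add: piecewise_linear_def frac_def)
    next
      case False
      with that have "\<lfloor>x\<rfloor> = n" by (simp add: floor_eq_iff)
      then show ?thesis by (simp add: piecewise_linear_def frac_def)
    qed
    moreover have "continuous_on {of_int n..of_int n + 1}
        (\<lambda>x. (1 - (x - of_int n)) * h n + (x - of_int n) * h (n + 1))"
      by (intro continuous_intros)
    ultimately have "continuous_on {of_int n..of_int n + 1} (piecewise_linear h)"
      by (metis (no_types, lifting) continuous_on_eq)
    then show "continuous_on (UNIV \<inter> id -` {of_int n..of_int n + 1}) (piecewise_linear h)"
      by simp
  qed (simp add: continuous_on_id)
  then show ?thesis using continuous_on_subset by blast
qed

lemma piecewise_linear_shift: "piecewise_linear h (x + of_int l) = piecewise_linear (\<lambda>n. h (n + l)) x"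
  by (simp add: piecewise_linear_def frac_def algebra_simps)

lemma piecewise_linear_add: "piecewise_linear (\<lambda>n. h n + c) x = piecewise_linear h x + c"
  by (simp add: piecewise_linear_def algebra_simps)

lemma piecewise_linear_less:
  assumes "u < h \<lfloor>x\<rfloor>" "u < h (\<lfloor>x\<rfloor> + 1)"
  shows "u < piecewise_linear h x"
proof -
  have "0 < (1 - frac x) * (h \<lfloor>x\<rfloor> - u) + frac x * (h (\<lfloor>x\<rfloor> + 1) - u)"
    using assms frac_lt_1 [of x] by (intro add_pos_nonneg mult_pos_pos mult_nonneg_nonneg) auto
  then show ?thesis by (simp add: piecewise_linear_def algebra_simps)
qed

lemma piecewise_linear_greater:
  assumes "h \<lfloor>x\<rfloor> < u" "h (\<lfloor>x\<rfloor> + 1) < u"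
  shows "piecewise_linear h x < u"
proof -
  have "0 < (1 - frac x) * (u - h \<lfloor>x\<rfloor>) + frac x * (u - h (\<lfloor>x\<rfloor> + 1))"
    using assms frac_lt_1 [of x] by (intro add_pos_nonneg mult_pos_pos mult_nonneg_nonneg) auto
  then show ?thesis by (simp add: piecewise_linear_def algebra_simps)
qed

text \<open>A form of the tube lemma. Below, the compact factor is a product of intervals, finite or infinite; in the latter
case its elements are sequences of points of a fibre.\<close>

lemma closed_projection_along_compact:
  fixes S :: "('a::topological_space \<times> 'b::topological_space) set"
  assumes "compact K" "closed S"
  shows "closed {a. \<exists>b\<in>K. (a, b) \<in> S}"
proof -
  have "open (- {a. \<exists>b\<in>K. (a, b) \<in> S})"
  proof (subst open_subopen, rule ballI)
    fix a assume "a \<in> - {a. \<exists>b\<in>K. (a, b) \<in> S}"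
    then have "{a} \<times> K \<subseteq> - S" by auto
    then obtain A where A: "a \<in> A" "open A" "A \<times> K \<subseteq> - S"
      using Elementary_Topology.tube_lemma [OF \<open>compact K\<close> open_Compl [OF \<open>closed S\<close>]] by metis
    then have "A \<subseteq> - {a. \<exists>b\<in>K. (a, b) \<in> S}" by blast
    with A(1,2) show "\<exists>T. open T \<and> a \<in> T \<and> T \<subseteq> - {a. \<exists>b\<in>K. (a, b) \<in> S}" by blast
  qed
  then show ?thesis by (simp add: closed_def)
qed

text \<open>Zorn's lemma for the complements: an increasing union of proper invariant open sets is proper because the
space is compact.\<close>

lemma ex_minimal_set:
  fixes f :: "'a::t2_space \<Rightarrow> 'a"
  assumes "bij f" "compact (UNIV :: 'a set)"
  shows "\<exists>M. minimal_set f M"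
proof -
  define \<A> where "\<A> = {U. compact_invariant f (- U)}"
  have inv: "f ` (- U) = - U \<longleftrightarrow> f ` U = U" for U
    using bij_image_Compl_eq [OF \<open>bij f\<close>, of U] by auto
  have closed: "compact (- U) \<longleftrightarrow> open U" for U :: "'a set"
    using compact_imp_closed [of "- U"] compact_Int_closed [OF assms(2), of "- U"]
    by (auto simp: closed_def)
  have "{} \<in> \<A>"
    using assms by (simp add: \<A>_def compact_invariant_def bij_is_surj)
  then have "\<exists>U\<in>\<A>. \<forall>V\<in>\<A>. U \<subseteq> V \<longrightarrow> V = U"
  proof (rule subset_Zorn_nonempty [OF ex_in_conv [THEN iffD1, OF exI]])
    fix \<C> assume \<C>: "\<C> \<noteq> {}" "subset.chain \<A> \<C>"
    have mem: "open U" "f ` U = U" "U \<noteq> UNIV" if "U \<in> \<C>" for U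
    proof -
      have "compact_invariant f (- U)" using that \<C>(2) by (auto simp: \<A>_def subset_chain_def)
      then show "open U" "f ` U = U" "U \<noteq> UNIV" by (auto simp: compact_invariant_def inv closed)
    qed
    have "\<Union>\<C> \<noteq> UNIV"
    proof
      assume "\<Union>\<C> = UNIV"
      then obtain \<D> where \<D>: "\<D> \<subseteq> \<C>" "finite \<D>" "UNIV \<subseteq> \<Union>\<D>"
        using mem(1) by (metis compactE [OF assms(2)] order_refl)
      then have "\<D> \<noteq> {}" by auto
      then obtain U where U: "U \<in> \<D>" "\<And>V. V \<in> \<D> \<Longrightarrow> U \<le> V \<Longrightarrow> U = V"
        using finite_has_maximal [OF \<D>(2)] by blast
      have "V \<subseteq> U" if "V \<in> \<D>" for V
        using that U \<D>(1) \<C>(2) by (metis subset_chain_def subset_iff)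
      with \<D>(3) have "U = UNIV" by blast
      with U(1) \<D>(1) mem(3) show False by blast
    qed
    moreover have "open (\<Union>\<C>)" using mem(1) by blast
    moreover have "f ` \<Union>\<C> = \<Union>\<C>" using mem(2) by blast
    ultimately show "\<Union>\<C> \<in> \<A>" by (auto simp: \<A>_def compact_invariant_def inv closed)
  qed
  then obtain U where U: "compact_invariant f (- U)" "\<And>V. compact_invariant f (- V) \<Longrightarrow> U \<subseteq> V \<Longrightarrow> V = U"
    by (auto simp: \<A>_def)
  have "\<not> (\<exists>K. K \<subset> - U \<and> compact_invariant f K)"
  proof
    assume "\<exists>K. K \<subset> - U \<and> compact_invariant f K"
    then obtain K where "K \<subset> - U" "compact_invariant f K" by blast
    with U(2) [of "- K"] show False by auto
  qed
  with U(1) show ?thesis unfolding minimal_set_def by blast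
qed

lemma minimal_sets_disjoint:
  fixes f :: "'a::t2_space \<Rightarrow> 'a"
  assumes "inj f" "minimal_set f M" "minimal_set f M'" "M \<noteq> M'"
  shows "M \<inter> M' = {}"
proof (rule ccontr)
  assume "M \<inter> M' \<noteq> {}"
  moreover have "compact (M \<inter> M')"
    using assms(2,3) by (intro compact_Int) (auto simp: minimal_set_def compact_invariant_def)
  moreover have "f ` (M \<inter> M') = M \<inter> M'"
    using image_Int [OF \<open>inj f\<close>, of M M'] assms(2,3) by (simp add: minimal_set_def compact_invariant_def)
  ultimately have "compact_invariant f (M \<inter> M')" by (simp add: compact_invariant_def)
  then have "\<not> M \<inter> M' \<subset> M" "\<not> M \<inter> M' \<subset> M'"
    using assms(2,3) by (auto simp: minimal_set_def)
  with \<open>M \<noteq> M'\<close> show False by blast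
qed

text \<open>The forward orbit of one element is everything, by transitivity. Since \<open>f\<close> is injective, the first
repetition in this orbit is a return to its starting point, so the orbit runs through each element once.\<close>

lemma cyclically_permuted_if_transitive:
  fixes f :: "'a \<Rightarrow> 'a" and \<U> :: "'a set set"
  assumes "finite \<U>" "\<U> \<noteq> {}" "inj f" and maps: "\<And>U. U \<in> \<U> \<Longrightarrow> f ` U \<in> \<U>"
    and trans: "\<And>\<O>. \<O> \<subseteq> \<U> \<Longrightarrow> \<O> \<noteq> {} \<Longrightarrow> (\<And>U. U \<in> \<O> \<Longrightarrow> f ` U \<in> \<O>) \<Longrightarrow> \<O> = \<U>"
  shows "cyclically_permuted f (card \<U>) \<U>"
proof -
  obtain U0 where "U0 \<in> \<U>" using assms(2) by blast
  define U where "U = (\<lambda>n. ((`) f ^^ n) U0)"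
  have U_Suc: "U (Suc n) = f ` U n" for n by (simp add: U_def)
  have "U n \<in> \<U>" for n by (induction n) (use \<open>U0 \<in> \<U>\<close> maps in \<open>auto simp: U_def\<close>)
  have range: "range U = \<U>"
  proof (rule trans)
    show "range U \<subseteq> \<U>" using \<open>\<And>n. U n \<in> \<U>\<close> by blast
    show "f ` V \<in> range U" if "V \<in> range U" for V
    proof -
      obtain n where "V = U n" using \<open>V \<in> range U\<close> by blast
      then show ?thesis using U_Suc [of n] by (metis rangeI)
    qed
  qed simp
  have cancel: "U (n + m) = U m \<Longrightarrow> U n = U 0" for n m
  proof (induction m)
    case (Suc m)
    then have "f ` U (n + m) = f ` U m" using U_Suc by simp
    then have "U (n + m) = U m" using inj_image_eq_iff [OF \<open>inj f\<close>] by blast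
    then show ?case by (rule Suc.IH)
  qed simp
  have "\<exists>r>0. U r = U 0"
  proof -
    have "\<not> inj U" using range_inj_infinite [of U] range \<open>finite \<U>\<close> by metis
    then obtain i j where "i < j" "U i = U j" by (metis injI linorder_neqE_nat)
    then show ?thesis using cancel [of "j - i" i] by (intro exI [of _ "j - i"]) simp
  qed
  define r where "r = (LEAST r. r > 0 \<and> U r = U 0)"
  have r: "r > 0" "U r = U 0"
    using LeastI_ex [OF \<open>\<exists>r>0. U r = U 0\<close>] by (simp_all add: r_def)
  have least: "\<not> (0 < n \<and> U n = U 0)" if "n < r" for n
    using not_less_Least [OF that [unfolded r_def]] .
  have per: "U (r + n) = U n" for n by (induction n) (use r U_Suc in simp_all)
  have mod: "U n = U (n mod r)" for n
  proof (induction n rule: less_induct)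
    case (less n)
    show ?case
    proof (cases "n < r")
      case False
      then show ?thesis using less [of "n - r"] per [of "n - r"] r(1) by (simp add: le_mod_geq)
    qed simp
  qed
  have inj: "inj_on U {..<r}"
  proof -
    have "\<not> (i < j \<and> j < r \<and> U i = U j)" for i j
      using cancel [of "j - i" i] least [of "j - i"] by fastforce
    then show ?thesis unfolding inj_on_def by (metis lessThan_iff linorder_neqE_nat)
  qed
  have img: "U ` {..<r} = \<U>"
    unfolding range [symmetric] using mod r(1) by (auto intro!: image_eqI [of _ U "_ mod r"])
  have "card \<U> = r" using card_image [OF inj] img by simp
  then show ?thesis
    unfolding cyclically_permuted_def using inj img U_Suc mod by (metis bij_betw_def)
qed

lemma image_component:
  fixes f g :: "'a::topological_space \<Rightarrow> 'a"
  assumes "continuous_on UNIV f" "continuous_on UNIV g" and gf: "\<And>z. g (f z) = z" and fg: "\<And>z. f (g z) = z"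
    and W: "f ` W = W" and V: "V \<in> components W"
  shows "f ` V \<in> components W"
proof -
  have "g ` f ` W = W" by (simp add: image_image gf)
  then have gW: "g ` W = W" using W by simp
  have conn: "connected (f ` S)" "connected (g ` S)" if "connected S" for S
    using that connected_continuous_image [OF continuous_on_subset [OF assms(1) subset_UNIV]]
      connected_continuous_image [OF continuous_on_subset [OF assms(2) subset_UNIV]] by simp_all
  have "f ` V \<subseteq> W" "V \<subseteq> W" "V \<noteq> {}" "connected V"
    using image_mono [OF in_components_subset [OF V], of f] W in_components_subset [OF V]
      in_components_nonempty [OF V] in_components_connected [OF V] by simp_all
  then obtain V' where V': "V' \<in> components W" "f ` V \<subseteq> V'"
    using exists_component_superset [of "f ` V" W] conn(1) by auto
  have "g ` f ` V = V" by (simp add: image_image gf)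
  then have "V \<subseteq> g ` V'" using image_mono [OF V'(2), of g] by simp
  moreover have "g ` V' \<subseteq> V"
  proof (rule components_maximal [OF V])
    show "connected (g ` V')" by (rule conn(2) [OF in_components_connected [OF V'(1)]])
    show "g ` V' \<subseteq> W" using image_mono [OF in_components_subset [OF V'(1)], of g] gW by simp
    show "V \<inter> g ` V' \<noteq> {}" using \<open>V \<subseteq> g ` V'\<close> \<open>V \<noteq> {}\<close> by blast
  qed
  ultimately have "f ` V = f ` g ` V'" by blast
  also have "\<dots> = V'" using fg by (simp add: image_image)
  finally show ?thesis using V'(1) by simp
qed

section \<open>Gaps and blocks of an indexed set\<close>

text \<open>The set \<open>X\<close> is the preimage in \<open>\<real>\<^sup>2\<close> of a closed set in the torus, split by \<open>\<kappa>\<close> into blocks: \<open>\<kappa>\<close> is locally constant,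
increasing along the fibres, and takes all integer values on each of them. One turn in the fibre passes \<open>2 N\<close>
blocks, and \<open>2 d\<close> is the monodromy of one turn in the base. Both numbers are even because the blocks belong
alternately to two invariant sets.\<close>

locale indexed_set =
  fixes X :: "(real \<times> real) set" and \<kappa> :: "real \<times> real \<Rightarrow> int" and N :: nat and d :: int
  assumes N_pos: "N > 0"
    and closed_X: "closed X"
    and X_shift: "(t + of_int m, y + of_int k) \<in> X \<longleftrightarrow> (t, y) \<in> X"
    and \<kappa>_shift: "(t, y) \<in> X \<Longrightarrow> \<kappa> (t + of_int m, y + of_int k) = \<kappa> (t, y) + 2 * (d * m + int N * k)"
    and \<kappa>_mono: "(t, y) \<in> X \<Longrightarrow> (t, y') \<in> X \<Longrightarrow> y \<le> y' \<Longrightarrow> \<kappa> (t, y) \<le> \<kappa> (t, y')"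
    and \<kappa>_cont: "continuous_on X (\<lambda>z. real_of_int (\<kappa> z))"
    and \<kappa>_surj: "\<exists>y. (t, y) \<in> X \<and> \<kappa> (t, y) = j"
begin

lemma X_shift_y: "(t, y + of_int k) \<in> X \<longleftrightarrow> (t, y) \<in> X"
  using X_shift [of t 0 y k] by simp

lemma \<kappa>_shift_y: "(t, y) \<in> X \<Longrightarrow> \<kappa> (t, y + of_int k) = \<kappa> (t, y) + 2 * int N * k"
  using \<kappa>_shift [of t y 0 k] by simp

lemma \<kappa>_less: "(t, y) \<in> X \<Longrightarrow> (t, y') \<in> X \<Longrightarrow> \<kappa> (t, y) < \<kappa> (t, y') \<Longrightarrow> y < y'"
  using \<kappa>_mono [of t y' y] by linarith

lemma closed_\<kappa>_sublevel: "closed {z \<in> X. \<kappa> z \<le> j}" "closed {z \<in> X. j \<le> \<kappa> z}"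
proof -
  have "{z \<in> X. \<kappa> z \<le> j} = X \<inter> (\<lambda>z. real_of_int (\<kappa> z)) -` {..of_int j}"
       "{z \<in> X. j \<le> \<kappa> z} = X \<inter> (\<lambda>z. real_of_int (\<kappa> z)) -` {of_int j..}"
    by auto
  then show "closed {z \<in> X. \<kappa> z \<le> j}" "closed {z \<in> X. j \<le> \<kappa> z}"
    using continuous_closed_preimage [OF \<kappa>_cont closed_X] by auto
qed

text \<open>A scale below which the order of the indices determines the order of the points even in different fibres.\<close>

definition separation :: "real \<Rightarrow> bool"
  where "separation \<eta> \<longleftrightarrow> \<eta> > 0 \<and>
    (\<forall>t x t' x'. (t, x) \<in> X \<longrightarrow> (t', x') \<in> X \<longrightarrow> \<kappa> (t, x) < \<kappa> (t', x') \<longrightarrow> \<bar>t - t'\<bar> < \<eta> \<longrightarrow> x + \<eta> \<le> x')"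

lemma separationD:
  "separation \<eta> \<Longrightarrow> \<bar>t - t'\<bar> < \<eta> \<Longrightarrow> (t, x) \<in> X \<Longrightarrow> (t', x') \<in> X \<Longrightarrow> \<kappa> (t, x) < \<kappa> (t', x') \<Longrightarrow> x + \<eta> \<le> x'"
  by (auto simp: separation_def)

text \<open>The pairs of points of increasing index in a bounded box form a compact set. On it the maximum of the
distance of the fibres and of the rise from the first to the second point is positive: if the fibres agree,
the second point lies strictly above the first.\<close>

lemma uniform_separation_box:
  "\<exists>e>0. \<forall>t x t' x'. (t, x) \<in> X \<longrightarrow> (t', x') \<in> X \<longrightarrow> \<kappa> (t, x) < \<kappa> (t', x') \<longrightarrow>
     t \<in> {0..1} \<longrightarrow> x \<in> {0..1} \<longrightarrow> t' \<in> {-1..2} \<longrightarrow> x' \<in> {-1..2} \<longrightarrow> \<bar>t - t'\<bar> < e \<longrightarrow> x + e \<le> x'"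
proof -
  define box :: "((real \<times> real) \<times> (real \<times> real)) set"
    where "box = ({0..1} \<times> {0..1}) \<times> ({-1..2} \<times> {-1..2})"
  define \<delta> where "\<delta> = (\<lambda>z. real_of_int (\<kappa> (snd z)) - real_of_int (\<kappa> (fst z)))"
  define E where "E = box \<inter> ((X \<times> X) \<inter> \<delta> -` {1..})"
  define \<phi> where "\<phi> = (\<lambda>z::(real \<times> real) \<times> (real \<times> real).
    max \<bar>fst (fst z) - fst (snd z)\<bar> (snd (snd z) - snd (fst z)))"
  have "continuous_on (X \<times> X) \<delta>"
    unfolding \<delta>_def by (intro continuous_intros continuous_on_compose2 [OF \<kappa>_cont]) auto
  then have "closed ((X \<times> X) \<inter> \<delta> -` {1..})"
    by (intro continuous_closed_preimage closed_Times closed_X closed_atLeast)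
  moreover have "compact box" unfolding box_def by (intro compact_Times compact_Icc)
  ultimately have "compact E" unfolding E_def by (simp add: compact_Int_closed)
  have pos: "\<phi> z > 0" if z: "z \<in> E" for z
  proof -
    obtain t x t' x' where zz: "z = ((t, x), (t', x'))" by (metis surj_pair)
    then have X: "(t, x) \<in> X" "(t', x') \<in> X" "\<kappa> (t, x) < \<kappa> (t', x')"
      using z by (auto simp: E_def \<delta>_def)
    show ?thesis
    proof (cases "t = t'")
      case True
      then show ?thesis using \<kappa>_less [of t x x'] X by (simp add: \<phi>_def zz)
    qed (simp add: \<phi>_def zz less_max_iff_disj)
  qed
  have "\<exists>e>0. \<forall>z\<in>E. e \<le> \<phi> z"
  proof (cases "E = {}")
    case False
    have "continuous_on E \<phi>" unfolding \<phi>_def by (intro continuous_intros)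
    then obtain z0 where "z0 \<in> E" "\<forall>z\<in>E. \<phi> z0 \<le> \<phi> z"
      using continuous_attains_inf [OF \<open>compact E\<close> False] by blast
    then show ?thesis using pos by blast
  qed (auto intro: exI [of _ 1])
  then obtain e where e: "e > 0" "\<And>z. z \<in> E \<Longrightarrow> e \<le> \<phi> z" by blast
  show ?thesis
  proof (intro exI [of _ e] conjI allI impI)
    fix t x t' x'
    assume "(t, x) \<in> X" "(t', x') \<in> X" "\<kappa> (t, x) < \<kappa> (t', x')" "t \<in> {0..1}" "x \<in> {0..1}"
      "t' \<in> {-1..2}" "x' \<in> {-1..2}" and lt: "\<bar>t - t'\<bar> < e"
    then have "((t, x), (t', x')) \<in> E" by (auto simp: E_def box_def \<delta>_def)
    then have "e \<le> \<phi> ((t, x), (t', x'))" by (rule e)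
    with lt show "x + e \<le> x'" by (simp add: \<phi>_def)
  qed (rule e)
qed

text \<open>A pair violating the estimate is moved into the bounded box by an integer translation. If its second point
is far below the first one, it is raised as well; this raises its index, so the order of the indices is kept.\<close>

lemma ex_separation: "\<exists>\<eta>. separation \<eta>"
proof -
  obtain e where e: "e > 0" "\<And>t x t' x'. (t, x) \<in> X \<Longrightarrow> (t', x') \<in> X \<Longrightarrow> \<kappa> (t, x) < \<kappa> (t', x') \<Longrightarrow>
     t \<in> {0..1} \<Longrightarrow> x \<in> {0..1} \<Longrightarrow> t' \<in> {-1..2} \<Longrightarrow> x' \<in> {-1..2} \<Longrightarrow> \<bar>t - t'\<bar> < e \<Longrightarrow> x + e \<le> x'"
    using uniform_separation_box by blast
  define \<eta> where "\<eta> = min e 1"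
  have "x + \<eta> \<le> x'"
    if X: "(t, x) \<in> X" "(t', x') \<in> X" and less: "\<kappa> (t, x) < \<kappa> (t', x')" and close: "\<bar>t - t'\<bar> < \<eta>"
    for t x t' x'
  proof (rule ccontr)
    assume neg: "\<not> ?thesis"
    \<comment> \<open>The maximum with \<open>0\<close> makes sure that the second point is raised but never lowered relative to the first.\<close>
    define m k l where "m = - \<lfloor>t\<rfloor>" and "k = - \<lfloor>x\<rfloor>" and "l = max 0 \<lfloor>x - x'\<rfloor>"
    define u v u' v' where "u = t + of_int m" and "v = x + of_int k"
      and "u' = t' + of_int m" and "v' = x' + of_int (k + l)"
    have l: "l = 0 \<or> x' + of_int l \<le> x" "x' + of_int l < x + 1" "x - 1 < x' + of_int l"
      using neg unfolding l_def \<eta>_def by linarith+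
    have "0 \<le> u" "u \<le> 1" "0 \<le> v" "v \<le> 1"
      unfolding u_def v_def m_def k_def by (simp_all, linarith+)
    moreover have "u - 1 < u'" "u' < u + 1" "v - 1 < v'" "v' < v + 1"
      using close l(2,3) unfolding u_def v_def u'_def v'_def \<eta>_def by auto
    ultimately have box: "u \<in> {0..1}" "v \<in> {0..1}" "u' \<in> {-1..2}" "v' \<in> {-1..2}"
      by auto
    have "(u, v) \<in> X" "(u', v') \<in> X"
      unfolding u_def v_def u'_def v'_def using X X_shift by blast+
    moreover have "\<kappa> (u, v) < \<kappa> (u', v')"
    proof -
      have "0 \<le> int N * l" by (simp add: l_def)
      then show ?thesis
        unfolding u_def v_def u'_def v'_def using X less by (simp only: \<kappa>_shift) (simp add: algebra_simps)
    qed
    ultimately have "v + e \<le> v'"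
      using e(2) box close by (simp add: u_def u'_def \<eta>_def)
    then have "x + e \<le> x' + of_int l" by (simp add: v_def v'_def)
    with l(1) neg \<open>e > 0\<close> show False by (auto simp: \<eta>_def)
  qed
  moreover have "\<eta> > 0" using e(1) by (simp add: \<eta>_def)
  ultimately show ?thesis unfolding separation_def by blast
qed

text \<open>The gap of index \<open>j\<close> extends from the block of index \<open>j - 1\<close> to the block of index \<open>j + 1\<close> and contains the
block of index \<open>j\<close>. Only the gaps of odd index will be removed from the torus.\<close>

definition gap :: "int \<Rightarrow> (real \<times> real) set"
  where "gap j = {(t, y). \<forall>x. (t, x) \<in> X \<longrightarrow> (\<kappa> (t, x) < j \<longrightarrow> x < y) \<and> (j < \<kappa> (t, x) \<longrightarrow> y < x)}"

definition block :: "int \<Rightarrow> (real \<times> real) set"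
  where "block j = {(t, y). \<exists>u v. (t, u) \<in> X \<and> \<kappa> (t, u) = j \<and> (t, v) \<in> X \<and> \<kappa> (t, v) = j \<and> u \<le> y \<and> y \<le> v}"

lemma gap_shift:
  "(t + of_int m, y + of_int k) \<in> gap (j + 2 * (d * m + int N * k)) \<longleftrightarrow> (t, y) \<in> gap j"
proof -
  have *: "(t + of_int m, y + of_int k) \<in> gap (j + 2 * (d * m + int N * k))" if "(t, y) \<in> gap j"
    for t m y k j
  proof -
    have "(\<kappa> (t + of_int m, x) < j + 2 * (d * m + int N * k) \<longrightarrow> x < y + of_int k) \<and>
          (j + 2 * (d * m + int N * k) < \<kappa> (t + of_int m, x) \<longrightarrow> y + of_int k < x)"
      if x: "(t + of_int m, x) \<in> X" for x
    proof -
      define x' where "x' = x - of_int k"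
      have x': "x = x' + of_int k" by (simp add: x'_def)
      have "(t, x') \<in> X" using x unfolding x' X_shift .
      then show ?thesis
        using \<open>(t, y) \<in> gap j\<close> unfolding x' \<kappa>_shift [OF \<open>(t, x') \<in> X\<close>] by (auto simp: gap_def)
    qed
    then show ?thesis by (auto simp: gap_def)
  qed
  show ?thesis
    using * [of t y j m k] * [of "t + of_int m" "y + of_int k" "j + 2 * (d * m + int N * k)" "- m" "- k"]
    by (auto simp: algebra_simps)
qed

lemma gap_shift_y: "(t, y + of_int k) \<in> gap (j + 2 * int N * k) \<longleftrightarrow> (t, y) \<in> gap j"
  using gap_shift [of t 0 y k j] by (simp add: algebra_simps)

lemma block_shift_y: "(t, y + of_int k) \<in> block (j + 2 * int N * k) \<longleftrightarrow> (t, y) \<in> block j"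
proof -
  have *: "(t, y + of_int k) \<in> block (j + 2 * int N * k)" if yj: "(t, y) \<in> block j" for y k j
  proof -
    obtain u v where uv: "(t, u) \<in> X" "\<kappa> (t, u) = j" "(t, v) \<in> X" "\<kappa> (t, v) = j" "u \<le> y" "y \<le> v"
      using yj by (auto simp: block_def)
    then show ?thesis
      unfolding block_def mem_Collect_eq prod.case
      by (intro exI [of _ "u + of_int k"] exI [of _ "v + of_int k"]) (simp add: X_shift_y \<kappa>_shift_y)
  qed
  show ?thesis using * [of y j k] * [of "y + of_int k" "j + 2 * int N * k" "- k"] by auto
qed

lemma in_gap_if: "(t, y) \<in> X \<Longrightarrow> (t, y) \<in> gap (\<kappa> (t, y))"
  by (auto simp: gap_def dest: \<kappa>_less)

text \<open>A point of index \<open>j + 1\<close> lies above the whole gap of index \<open>j\<close>.\<close>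

lemma gap_disjoint:
  assumes "(t, y) \<in> gap i" "(t, y) \<in> gap j"
  shows "i < j + 2"
proof (rule ccontr)
  assume "\<not> ?thesis"
  obtain x where "(t, x) \<in> X" "\<kappa> (t, x) = j + 1" using \<kappa>_surj by blast
  with assms \<open>\<not> ?thesis\<close> show False by (force simp: gap_def)
qed

lemma odd_gap_unique: "(t, y) \<in> gap (2 * i + 1) \<Longrightarrow> (t, y) \<in> gap (2 * j + 1) \<Longrightarrow> i = j"
  using gap_disjoint [of t y "2 * i + 1" "2 * j + 1"] gap_disjoint [of t y "2 * j + 1" "2 * i + 1"] by simp

lemma block_unique:
  assumes "(t, y) \<in> block i" "(t, y) \<in> block j"
  shows "i = j"
proof -
  have "i \<le> j" if "(t, y) \<in> block i" "(t, y) \<in> block j" for i j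
    using that by (auto simp: block_def dest: \<kappa>_mono intro: order_trans)
  then show ?thesis using assms by (meson order_antisym)
qed

lemma block_gap_disjoint:
  assumes "(t, y) \<in> block i" "(t, y) \<in> gap j"
  shows "i = j"
proof -
  obtain u v where uv: "(t, u) \<in> X" "\<kappa> (t, u) = i" "(t, v) \<in> X" "\<kappa> (t, v) = i" "u \<le> y" "y \<le> v"
    using assms(1) by (auto simp: block_def)
  have "\<not> i < j" using assms(2) uv(3,4,6) by (auto simp: gap_def)
  moreover have "\<not> j < i" using assms(2) uv(1,2,5) by (auto simp: gap_def)
  ultimately show ?thesis by simp
qed

text \<open>Let \<open>j\<close> be the greatest index of a point of \<open>X\<close> at or below \<open>y\<close>. If \<open>j\<close> is odd, then \<open>y\<close> lies in the gap of index \<open>j\<close>.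
If \<open>j\<close> is even, then \<open>y\<close> lies in the block of index \<open>j\<close>, or above it and hence in the gap of index \<open>j + 1\<close>.\<close>

lemma block_or_gap:
  obtains i where "(t, y) \<in> block (2 * i) \<or> (t, y) \<in> gap (2 * i + 1)"
proof -
  define below where "below = {\<kappa> (t, x) | x. (t, x) \<in> X \<and> x \<le> y}"
  obtain x0 where x0: "(t, x0) \<in> X" "\<kappa> (t, x0) = 0" using \<kappa>_surj by blast
  define v u where "v = x0 + of_int \<lfloor>y - x0\<rfloor>" and "u = x0 + of_int \<lceil>y - x0\<rceil>"
  have "(t, v) \<in> X" "(t, u) \<in> X"
    unfolding u_def v_def using x0 by (simp_all add: X_shift_y)
  have "v \<le> y" "y \<le> u" unfolding u_def v_def by linarith+
  have "below \<noteq> {}" using \<open>(t, v) \<in> X\<close> \<open>v \<le> y\<close> by (auto simp: below_def)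
  have "bdd_above below"
    unfolding below_def by (rule bdd_aboveI [of _ "\<kappa> (t, u)"])
      (use \<kappa>_mono \<open>(t, u) \<in> X\<close> \<open>y \<le> u\<close> in \<open>auto intro: order_trans\<close>)
  define j where "j = Sup below"
  have "j \<in> below"
  proof -
    obtain w where w: "w \<in> below" "j - 1 < w"
      using less_cSupE [OF _ \<open>below \<noteq> {}\<close>, of "j - 1"] by (auto simp: j_def)
    moreover have "w \<le> j" unfolding j_def by (rule cSup_upper [OF w(1) \<open>bdd_above below\<close>])
    ultimately show ?thesis by (metis add_le_cancel_right diff_add_cancel order_antisym zless_imp_add1_zle)
  qed
  then obtain x1 where x1: "(t, x1) \<in> X" "x1 \<le> y" "\<kappa> (t, x1) = j" by (auto simp: below_def)
  have above: "y < x" if "(t, x) \<in> X" "j < \<kappa> (t, x)" for x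
  proof (rule ccontr)
    assume "\<not> y < x"
    with that have "\<kappa> (t, x) \<in> below" by (auto simp: below_def)
    then have "\<kappa> (t, x) \<le> j" unfolding j_def using \<open>bdd_above below\<close> by (rule cSup_upper)
    with that show False by simp
  qed
  show thesis
  proof (cases "even j")
    case False
    then obtain i where i: "j = 2 * i + 1" by (rule oddE)
    have "(t, y) \<in> gap j"
      unfolding gap_def using above x1 \<kappa>_less [of t _ x1] by force
    then show ?thesis using that i by blast
  next
    case True
    then obtain i where i: "j = 2 * i" by (rule evenE)
    show ?thesis
    proof (cases "\<exists>x. (t, x) \<in> X \<and> \<kappa> (t, x) = j \<and> y \<le> x")
      case True
      then have "(t, y) \<in> block j" using x1 by (auto simp: block_def)
      then show ?thesis using that i by blast
    next
      case False
      have "(t, y) \<in> gap (j + 1)"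
        unfolding gap_def using False above \<kappa>_mono x1
        by (smt (verit, best) case_prodI mem_Collect_eq zless_add1_eq)
      then show ?thesis using that i by blast
    qed
  qed
qed

text \<open>A point of \<open>X\<close> that keeps \<open>(t, y)\<close> out of the gap can be moved by an integer to a distance of at most one from
\<open>y\<close>, and its index then keeps violating the same condition. So the complement of the gap is a union of two
projections along the compact interval \<open>[0, 1]\<close>.\<close>

lemma open_gap: "open (gap j)"
proof -
  define L where "L = {z. \<exists>r. r \<in> {0..1::real} \<and> (r, z) \<in> (\<lambda>(r, (t, y)). (t, y + r)) -` {z \<in> X. \<kappa> z \<le> j - 1}}"
  define H where "H = {z. \<exists>r. r \<in> {0..1::real} \<and> (r, z) \<in> (\<lambda>(r, (t, y)). (t, y - r)) -` {z \<in> X. j + 1 \<le> \<kappa> z}}"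
  have "closed L" "closed H"
    unfolding L_def H_def case_prod_unfold
    by (intro closed_compact_projection closed_vimage closed_\<kappa>_sublevel compact_Icc continuous_intros)+
  moreover have "- gap j = L \<union> H"
  proof (intro subset_antisym subsetI)
    fix z assume z: "z \<in> - gap j"
    obtain t y where ty: "z = (t, y)" by (cases z)
    from z ty consider x where "(t, x) \<in> X" "\<kappa> (t, x) < j" "y \<le> x" | x where "(t, x) \<in> X" "j < \<kappa> (t, x)" "x \<le> y"
      by (force simp: gap_def)
    then show "z \<in> L \<union> H"
    proof cases
      case (1 x)
      define k where "k = \<lfloor>x - y\<rfloor>"
      have "0 \<le> k" using 1 by (simp add: k_def)
      have "(t, x + of_int (- k)) \<in> X" using 1 X_shift_y by blast
      moreover have "0 \<le> int N * k" using \<open>0 \<le> k\<close> by simp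
      then have "\<kappa> (t, x + of_int (- k)) \<le> j - 1"
        unfolding \<kappa>_shift_y [OF 1(1)] using 1(2) by simp
      moreover have "x - y - of_int k \<in> {0..1}" unfolding k_def by (auto; linarith)
      ultimately have "z \<in> L"
        unfolding L_def ty by (auto intro!: exI [of _ "x - y - of_int k"])
      then show ?thesis ..
    next
      case (2 x)
      define k where "k = \<lfloor>y - x\<rfloor>"
      have "0 \<le> k" using 2 by (simp add: k_def)
      have "(t, x + of_int k) \<in> X" using 2 X_shift_y by blast
      moreover have "0 \<le> int N * k" using \<open>0 \<le> k\<close> by simp
      then have "j + 1 \<le> \<kappa> (t, x + of_int k)"
        unfolding \<kappa>_shift_y [OF 2(1)] using 2(2) by simp
      moreover have "y - x - of_int k \<in> {0..1}" unfolding k_def by (auto; linarith)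
      ultimately have "z \<in> H"
        unfolding H_def ty by (auto intro!: exI [of _ "y - x - of_int k"])
      then show ?thesis ..
    qed
  next
    fix z assume "z \<in> L \<union> H"
    then show "z \<in> - gap j"
      by (cases z) (fastforce simp: gap_def L_def H_def)
  qed
  ultimately show ?thesis by (metis closed_Un open_closed)
qed

text \<open>A slice longer than one would meet its translate by one, which lies in the gap of index \<open>j + 2 N\<close>.\<close>

lemma gap_slice_interval: "\<exists>a b. a < b \<and> b \<le> a + 1 \<and> {y. (t, y) \<in> gap j} = {a<..<b}"
proof -
  define S where "S = {y. (t, y) \<in> gap j}"
  have "S = (\<lambda>y. (t, y)) -` gap j" by (auto simp: S_def)
  then have "open S" by (simp add: open_gap open_vimage continuous_intros)
  obtain x where x: "(t, x) \<in> X" "\<kappa> (t, x) = j" using \<kappa>_surj by blast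
  then have "x \<in> S" using in_gap_if by (force simp: S_def)
  obtain u where u: "(t, u) \<in> X" "\<kappa> (t, u) = j - 1" using \<kappa>_surj by blast
  obtain v where v: "(t, v) \<in> X" "\<kappa> (t, v) = j + 1" using \<kappa>_surj by blast
  have bdd: "bdd_below S" "bdd_above S"
    using u v unfolding S_def gap_def bdd_below_def bdd_above_def by (fastforce intro: less_imp_le)+
  have "is_interval S"
    unfolding is_interval_1
  proof (intro ballI allI impI)
    fix a b y assume ab: "a \<in> S" "b \<in> S" "a \<le> y \<and> y \<le> b"
    have "x < y" if "(t, x) \<in> X" "\<kappa> (t, x) < j" for x
      using ab(1,3) that by (fastforce simp: S_def gap_def)
    moreover have "y < x" if "(t, x) \<in> X" "j < \<kappa> (t, x)" for x
      using ab(2,3) that by (fastforce simp: S_def gap_def)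
    ultimately show "y \<in> S" by (auto simp: S_def gap_def)
  qed
  then have S: "Inf S < Sup S" "S = {Inf S<..<Sup S}"
    using open_convex_bounded_real_eq_interval [OF \<open>open S\<close> _ _ bdd] \<open>x \<in> S\<close>
    by (auto simp: is_interval_convex_1)
  have "Sup S \<le> Inf S + 1"
  proof (rule ccontr)
    assume less: "\<not> ?thesis"
    define y where "y = (Inf S + Sup S - 1) / 2"
    have "Inf S < y" "y + 1 < Sup S" using less by (simp_all add: y_def field_simps)
    then have "y \<in> {Inf S<..<Sup S}" "y + 1 \<in> {Inf S<..<Sup S}" by auto
    then have "y \<in> S" "y + 1 \<in> S" using S(2) by blast+
    then have "(t, y + 1) \<in> gap (j + 2 * int N)" "(t, y + 1) \<in> gap j"
      using gap_shift_y [of t y 1 j] by (auto simp: S_def)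
    then show False using gap_disjoint N_pos by fastforce
  qed
  with S show ?thesis unfolding S_def by blast
qed

text \<open>The points of index \<open>j\<close> in a fibre form a compact set, lying between points of index \<open>j - 1\<close> and \<open>j + 1\<close>. Its
translate by one consists of points of larger index, hence lies strictly above it.\<close>

lemma block_slice_interval: "\<exists>a b. a \<le> b \<and> b < a + 1 \<and> {y. (t, y) \<in> block j} = {a..b}"
proof -
  define S where "S = {x. (t, x) \<in> X \<and> \<kappa> (t, x) = j}"
  have "S = (\<lambda>y. (t, y)) -` ({z \<in> X. \<kappa> z \<le> j} \<inter> {z \<in> X. j \<le> \<kappa> z})" by (auto simp: S_def)
  then have "closed S"
    by (simp only:) (intro closed_vimage closed_Int closed_\<kappa>_sublevel continuous_intros)
  obtain x where "x \<in> S" using \<kappa>_surj by (auto simp: S_def)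
  obtain u where u: "(t, u) \<in> X" "\<kappa> (t, u) = j - 1" using \<kappa>_surj by blast
  obtain v where v: "(t, v) \<in> X" "\<kappa> (t, v) = j + 1" using \<kappa>_surj by blast
  have bdd: "bdd_below S" "bdd_above S"
    unfolding S_def bdd_below_def bdd_above_def
    using \<kappa>_less [OF u(1)] \<kappa>_less [OF _ v(1)] u v by (force intro: less_imp_le)+
  have mem: "Inf S \<in> S" "Sup S \<in> S"
    using \<open>x \<in> S\<close> \<open>closed S\<close> bdd closed_contains_Inf closed_contains_Sup by blast+
  have le: "Inf S \<le> Sup S" using mem bdd cInf_lower by blast
  have "Sup S < Inf S + 1"
  proof (rule ccontr)
    assume neg: "\<not> ?thesis"
    have "(t, Inf S + of_int 1) \<in> X" using mem X_shift_y unfolding S_def by blast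
    moreover have "\<kappa> (t, Inf S + of_int 1) = j + 2 * int N * 1"
      using mem \<kappa>_shift_y [of t "Inf S" 1] by (auto simp: S_def)
    ultimately show False
      using neg \<kappa>_mono [of t "Inf S + 1" "Sup S"] mem N_pos by (auto simp: S_def)
  qed
  moreover have "{y. (t, y) \<in> block j} = {Inf S..Sup S}"
  proof (intro subset_antisym subsetI)
    fix y assume "y \<in> {y. (t, y) \<in> block j}"
    then obtain u v where "u \<in> S" "v \<in> S" "u \<le> y" "y \<le> v" by (auto simp: block_def S_def)
    then show "y \<in> {Inf S..Sup S}" using bdd cInf_lower cSup_upper by (meson atLeastAtMost_iff order_trans)
  qed (use mem in \<open>auto simp: block_def S_def\<close>)
  ultimately show ?thesis using le by blast
qed

section \<open>Continuous sections of the gaps\<close>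

text \<open>The top of the block of index \<open>j\<close> over \<open>t\<close>, in general not continuous in \<open>t\<close>.\<close>

definition height :: "int \<Rightarrow> real \<Rightarrow> real"
  where "height j t = Sup {x. (t, x) \<in> X \<and> \<kappa> (t, x) = j}"

text \<open>Within the scale of separation, the top of a block stays in the gap around that block.\<close>

lemma height_bounds:
  assumes \<eta>: "separation \<eta>" and close: "\<bar>t - t'\<bar> < \<eta>" and x: "(t, x) \<in> X"
  shows "\<kappa> (t, x) < j \<Longrightarrow> x < height j t'" "j < \<kappa> (t, x) \<Longrightarrow> height j t' < x"
proof -
  define S where "S = {x. (t', x) \<in> X \<and> \<kappa> (t', x) = j}"
  obtain z where z: "z \<in> S" using \<kappa>_surj by (auto simp: S_def)
  obtain v where v: "(t', v) \<in> X" "\<kappa> (t', v) = j + 1" using \<kappa>_surj by blast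
  have "bdd_above S"
    by (rule bdd_aboveI [of _ v]) (use v \<kappa>_less [OF _ v(1)] in \<open>force simp: S_def\<close>)
  then have "z \<le> height j t'"
    unfolding height_def S_def [symmetric] by (rule cSup_upper [OF z])
  then show "x < height j t'" if "\<kappa> (t, x) < j"
    using separationD [OF \<eta> close x, of z] z that \<eta> by (auto simp: S_def separation_def)
  show "height j t' < x" if less: "j < \<kappa> (t, x)"
  proof -
    have "height j t' \<le> x - \<eta>"
      unfolding height_def S_def [symmetric]
    proof (rule cSup_least)
      fix w assume "w \<in> S"
      then show "w \<le> x - \<eta>"
        using separationD [OF \<eta>, of t' t w x] x less close by (auto simp: S_def abs_minus_commute)
    qed (use z in blast)
    then show ?thesis using \<eta> by (simp add: separation_def)
  qed
qed

lemma height_shift: "height (j + 2 * (d * m + int N * k)) (t + of_int m) = height j t + of_int k"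
proof -
  have *: "height (j + 2 * (d * m + int N * k)) (t + of_int m) \<le> height j t + of_int k" for j m k t
  proof -
    have "bdd_above {x. (t, x) \<in> X \<and> \<kappa> (t, x) = j}"
    proof -
      obtain v where v: "(t, v) \<in> X" "\<kappa> (t, v) = j + 1" using \<kappa>_surj by blast
      show ?thesis by (rule bdd_aboveI [of _ v]) (use v \<kappa>_less [OF _ v(1)] in force)
    qed
    note upper = cSup_upper [OF _ this]
    show ?thesis
      unfolding height_def [of "j + 2 * (d * m + int N * k)"]
    proof (rule cSup_least)
      show "{x. (t + of_int m, x) \<in> X \<and> \<kappa> (t + of_int m, x) = j + 2 * (d * m + int N * k)} \<noteq> {}"
        using \<kappa>_surj by blast
      fix x assume x: "x \<in> {x. (t + of_int m, x) \<in> X \<and> \<kappa> (t + of_int m, x) = j + 2 * (d * m + int N * k)}"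
      define x' where "x' = x - of_int k"
      have xx: "x = x' + of_int k" by (simp add: x'_def)
      have "(t, x') \<in> X" using x unfolding xx by (simp add: X_shift)
      moreover have "\<kappa> (t, x') = j" using x \<kappa>_shift [OF \<open>(t, x') \<in> X\<close>, of m k] unfolding xx by simp
      ultimately have "x' \<le> height j t" unfolding height_def by (intro upper) auto
      then show "x \<le> height j t + of_int k" by (simp add: xx)
    qed
  qed
  show ?thesis
    using * [of j m k t] * [of "j + 2 * (d * m + int N * k)" "- m" "- k" "t + of_int m"]
    by (simp add: algebra_simps)
qed

text \<open>Interpolate linearly between the tops of the blocks over the multiples of \<open>1 / n\<close>, where \<open>1 / n\<close> is below the
scale of separation. Both values used at \<open>t\<close> then lie in the gap over \<open>t\<close>, whose slices are convex. Integer
translations preserve the grid, so the sections inherit the equivariance of the tops.\<close>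

lemma ex_sections:
  obtains s where "\<And>j. continuous_on UNIV (s j)" "\<And>j t. (t, s j t) \<in> gap j"
    "\<And>j t m k. s (j + 2 * (d * m + int N * k)) (t + of_int m) = s j t + of_int k"
proof -
  obtain \<eta> where \<eta>: "separation \<eta>"
    using ex_separation by blast
  obtain n :: nat where n: "n > 0" "1 / n < \<eta>"
    using \<eta> unfolding separation_def by (metis inverse_eq_divide ex_inverse_of_nat_less)
  \<comment> \<open>The index \<open>l\<close> stands for the grid point \<open>l / n\<close>.\<close>
  define h where "h = (\<lambda>j l. height j (of_int l / n))"
  define s where "s = (\<lambda>j t. piecewise_linear (h j) (real n * t))"
  show thesis
  proof (rule that [of s])
    show "continuous_on UNIV (s j)" for j
      unfolding s_def by (intro continuous_on_compose2 [OF continuous_on_piecewise_linear [of UNIV]] continuous_intros) auto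
    show "(t, s j t) \<in> gap j" for j t
    proof -
      define l where "l = \<lfloor>n * t\<rfloor>"
      have "of_int l \<le> n * t" "n * t < of_int l + 1" unfolding l_def by linarith+
      then have "of_int l / n \<le> t" "t < of_int l / n + 1 / n"
        using n(1) by (simp_all add: field_simps)
      then have "\<bar>t - of_int l / n\<bar> < \<eta>" "\<bar>t - of_int (l + 1) / n\<bar> < \<eta>"
        using n(2) by (auto simp: add_divide_distrib)
      note b = height_bounds [OF \<eta> this(1)] height_bounds [OF \<eta> this(2)]
      have "x < s j t" if "(t, x) \<in> X" "\<kappa> (t, x) < j" for x
        using b(1,3) [OF that] unfolding s_def h_def l_def by (intro piecewise_linear_less)
      moreover have "s j t < x" if "(t, x) \<in> X" "j < \<kappa> (t, x)" for x
        using b(2,4) [OF that] unfolding s_def h_def l_def by (intro piecewise_linear_greater)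
      ultimately show ?thesis by (auto simp: gap_def)
    qed
    show "s (j + 2 * (d * m + int N * k)) (t + of_int m) = s j t + of_int k" for j t m k
    proof -
      have "h (j + 2 * (d * m + int N * k)) (l + int n * m) = h j l + of_int k" for l
        using height_shift [of j m k "of_int l / n"] n(1) by (simp add: h_def add_divide_distrib)
      moreover have "real n * (t + of_int m) = real n * t + of_int (int n * m)"
        by (simp add: algebra_simps)
      ultimately show ?thesis
        unfolding s_def by (simp only: piecewise_linear_shift piecewise_linear_add)
    qed
  qed
qed

end

section \<open>The strip carried by an indexed set\<close>

lemma div_gcd_dvd_if:
  fixes n d m :: int
  assumes "n \<noteq> 0" "n dvd d * m"
  shows "n div gcd n d dvd m"
proof -
  obtain n' d' where nd: "n = gcd n d * n'" "d = gcd n d * d'" "coprime n' d'"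
    using gcd_coprime_exists [of n d] assms(1) by (metis gcd_eq_0_iff mult.commute)
  have "gcd n d \<noteq> 0" using assms(1) by simp
  have "gcd n d * n' dvd gcd n d * (d' * m)"
    using assms(2) nd(1,2) by (metis mult.assoc)
  then have "n' dvd d' * m"
    using \<open>gcd n d \<noteq> 0\<close> dvd_mult_cancel_left [of "gcd n d" n' "d' * m"] by blast
  then have "n' dvd m" using nd(3) by (simp add: coprime_dvd_mult_right_iff)
  moreover have "n div gcd n d = n'"
    using nd(1) \<open>gcd n d \<noteq> 0\<close> by (metis nonzero_mult_div_cancel_left)
  ultimately show ?thesis by simp
qed

text \<open>On the circle the images of \<open>D i\<close> and \<open>D j\<close> coincide if \<open>N\<close> divides \<open>i - j\<close> and are disjoint otherwise. Of the \<open>N\<close>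
images, every \<open>p\<close>-th is taken.\<close>

lemma partition_into_periodic:
  fixes D :: "int \<Rightarrow> real set"
  assumes N: "N = p * q" "N > 0"
    and shift: "\<And>i k y. y + of_int k \<in> D (i + int N * k) \<longleftrightarrow> y \<in> D i"
    and disj: "\<And>i j y. y \<in> D i \<Longrightarrow> y \<in> D j \<Longrightarrow> i = j"
    and ne: "\<And>i. D i \<noteq> {}" and P: "\<And>i. P (to_circle ` D i)"
  shows "partition_into q P (\<Union>n. to_circle ` D (i + int p * n)) (range (\<lambda>n. to_circle ` D (i + int p * n)))"
proof -
  define E where "E = (\<lambda>n. to_circle ` D (i + int p * n))"
  have pq: "p > 0" "q > 0" using N by simp_all
  have per: "to_circle ` D (i + int N * k) \<subseteq> to_circle ` D i" for i k
  proof
    fix c assume "c \<in> to_circle ` D (i + int N * k)"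
    then obtain y where y: "y \<in> D (i + int N * k)" "c = to_circle y" by blast
    then have "y + of_int (- k) \<in> D i" using shift [of "y + of_int (- k)" k i] by simp
    moreover have "c = to_circle (y + of_int (- k))" using y(2) by (simp only: to_circle_add_of_int)
    ultimately show "c \<in> to_circle ` D i" by blast
  qed
  have per_eq: "to_circle ` D (i + int N * k) = to_circle ` D i" for i k
    using per [of i k] per [of "i + int N * k" "- k"] by simp
  have E_per: "E (n + int q * k) = E n" for n k
    unfolding E_def using per_eq [of "i + int p * n" k] by (simp add: N(1) algebra_simps)
  have meet: "\<exists>k. n = m + int q * k" if "c \<in> E n" "c \<in> E m" for c n m
  proof -
    obtain y z where yz: "y \<in> D (i + int p * n)" "z \<in> D (i + int p * m)" "to_circle y = to_circle z"
      using \<open>c \<in> E n\<close> \<open>c \<in> E m\<close> by (auto simp: E_def)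
    then obtain k where "y = z + of_int k" using to_circle_eqE by blast
    then have "y \<in> D (i + int p * m + int N * k)" using yz(2) shift by simp
    with yz(1) have "i + int p * n = i + int p * m + int N * k" by (rule disj)
    then have "int p * n = int p * (m + int q * k)" by (simp add: N(1) algebra_simps)
    then have "n = m + int q * k" using pq(1) by simp
    then show ?thesis ..
  qed
  have E_ne: "E n \<noteq> {}" for n by (simp add: E_def ne)
  have range: "range E = E ` {0..<int q}"
  proof -
    have "E n \<in> E ` {0..<int q}" for n
    proof
      show "E n = E (n mod int q)" using E_per [of "n mod int q" "n div int q"] by simp
    qed (use pq in simp)
    then show ?thesis by blast
  qed
  have "inj_on E {0..<int q}"
  proof (rule inj_onI)
    fix n m assume nm: "n \<in> {0..<int q}" "m \<in> {0..<int q}" "E n = E m"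
    then obtain c where "c \<in> E n" "c \<in> E m" using E_ne by blast
    then obtain k where "n = m + int q * k" using meet by blast
    then have "n mod int q = m mod int q" by simp
    with nm show "n = m" by simp
  qed
  then have card: "card (range E) = q" unfolding range by (simp add: card_image)
  have "disjoint (range E)"
    unfolding disjoint_def
  proof (intro ballI impI)
    fix A B assume AB: "A \<in> range E" "B \<in> range E" "A \<noteq> B"
    show "A \<inter> B = {}"
    proof (rule ccontr)
      assume "A \<inter> B \<noteq> {}"
      with AB obtain n m c where "A = E n" "B = E m" "c \<in> E n" "c \<in> E m" by blast
      with meet E_per AB(3) show False by metis
    qed
  qed
  then have "partition_on (\<Union>n. E n) (range E)"
    using E_ne by (auto simp: partition_on_def)
  then have "partition_into q P (\<Union>n. E n) (range E)"
    unfolding partition_into_def using card range P by (auto simp: E_def)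
  then show ?thesis unfolding E_def .
qed

text \<open>The hypothesis \<open>inj\<close> says that the graph closes up on the torus only after multiples of \<open>q\<close> turns, so running
over \<open>q\<close> turns once gives a simple path.\<close>

lemma simple_closed_curve_graph:
  fixes g :: "real \<Rightarrow> real" and e :: int and q :: nat
  assumes g: "continuous_on UNIV g" and q: "q > 0" and per: "\<And>t. g (t + real q) = g t + of_int e"
    and inj: "\<And>t m k. g (t + of_int m) = g t + of_int k \<Longrightarrow> int q dvd m"
  shows "simple_closed_curve (range (\<lambda>t. to_torus (t, g t)))"
proof -
  define \<gamma> where "\<gamma> = (\<lambda>u::real. to_torus (q * u, g (q * u)))"
  have per_int: "to_torus (t + real q * of_int n, g (t + real q * of_int n)) = to_torus (t, g t)" for t n
  proof -
    have pernat: "g (t + real q * real n) = g t + of_int (e * int n)" for t and n :: nat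
    proof (induction n)
      case (Suc n)
      have "g (t + real q * real (Suc n)) = g ((t + real q * real n) + real q)" by (simp add: algebra_simps)
      also have "\<dots> = g t + of_int (e * int (Suc n))" unfolding per Suc by (simp add: algebra_simps)
      finally show ?case .
    qed simp
    have "to_circle (g (t + real q * of_int n)) = to_circle (g t)"
    proof (cases "0 \<le> n")
      case True
      then have "g (t + real q * of_int n) = g t + of_int (e * n)"
        using pernat [of t "nat n"] by simp
      then show ?thesis by (simp only: to_circle_add_of_int)
    next
      case False
      then have "g t = g (t + real q * of_int n) + of_int (- e * n)"
        using pernat [of "t + real q * of_int n" "nat (- n)"] by simp
      then show ?thesis by (simp only: to_circle_add_of_int)
    qed
    moreover have "to_circle (t + real q * of_int n) = to_circle t"
      using to_circle_add_of_int [of t "int q * n"] by simp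
    ultimately show ?thesis by simp
  qed
  have "path \<gamma>"
    unfolding path_def \<gamma>_def
    by (intro continuous_on_compose2 [OF continuous_on_to_torus [of UNIV]] continuous_on_compose2 [OF g] continuous_intros) auto
  moreover have "loop_free \<gamma>"
  proof -
    have key: "x = y \<or> x = 0 \<and> y = 1" if xy: "0 \<le> x" "x \<le> y" "y \<le> 1" "\<gamma> x = \<gamma> y" for x y
    proof -
      have "to_circle (q * y) = to_circle (q * x)" "to_circle (g (q * y)) = to_circle (g (q * x))"
        using xy(4) by (simp_all add: \<gamma>_def)
      then obtain m k where m: "q * y = q * x + of_int m" "g (q * y) = g (q * x) + of_int k"
        by (metis to_circle_eqE)
      then have "int q dvd m" using inj by metis
      then obtain l where l: "m = int q * l" by (rule dvdE)
      have "real q * y = real q * (x + of_int l)" using m(1) l by (simp add: algebra_simps)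
      then have "y = x + of_int l" using q by simp
      then have "0 \<le> l" "l \<le> 1" "l = 1 \<Longrightarrow> x = 0 \<and> y = 1" using xy by auto
      then have "l = 0 \<or> l = 1" by linarith
      with \<open>y = x + of_int l\<close> \<open>l = 1 \<Longrightarrow> x = 0 \<and> y = 1\<close> show ?thesis by auto
    qed
    show ?thesis
      unfolding loop_free_def
    proof (intro ballI impI)
      fix x y :: real assume xy: "x \<in> {0..1}" "y \<in> {0..1}" "\<gamma> x = \<gamma> y"
      show "x = y \<or> x = 0 \<and> y = 1 \<or> x = 1 \<and> y = 0"
      proof (cases "x \<le> y")
        case True
        have "x = y \<or> x = 0 \<and> y = 1" by (rule key [OF _ True _ xy(3)]) (use xy in simp_all)
        then show ?thesis by blast
      next
        case False
        have "y = x \<or> y = 0 \<and> x = 1" by (rule key [OF _ _ _ xy(3) [symmetric]]) (use xy False in simp_all)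
        then show ?thesis by blast
      qed
    qed
  qed
  moreover have "pathfinish \<gamma> = pathstart \<gamma>"
    using per_int [of 0 1] by (simp add: \<gamma>_def pathfinish_def pathstart_def)
  moreover have "path_image \<gamma> = range (\<lambda>t. to_torus (t, g t))"
  proof -
    have "to_torus (t, g t) \<in> \<gamma> ` {0..1}" for t
    proof
      define u where "u = frac (t / q)"
      have "t = real q * u + real q * of_int \<lfloor>t / q\<rfloor>"
        using q by (simp add: u_def frac_def field_simps)
      then show "to_torus (t, g t) = \<gamma> u" unfolding \<gamma>_def using per_int by metis
      show "u \<in> {0..1}" unfolding u_def using frac_lt_1 [of "t / q"] by simp
    qed
    then show ?thesis by (auto simp: path_image_def \<gamma>_def)
  qed
  ultimately show ?thesis
    unfolding simple_closed_curve_def simple_path_def by blast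
qed

locale indexed_set_sections = indexed_set +
  fixes s :: "int \<Rightarrow> real \<Rightarrow> real"
  assumes s_cont: "continuous_on UNIV (s j)"
    and s_gap: "(t, s j t) \<in> gap j"
    and s_shift: "s (j + 2 * (d * m + int N * k)) (t + of_int m) = s j t + of_int k"
begin

lemma connected_gap_slice: "connected {y. (t, y) \<in> gap j}"
proof -
  obtain a b where "{y. (t, y) \<in> gap j} = {a<..<b}" using gap_slice_interval by blast
  then show ?thesis by simp
qed

text \<open>A gap is swept out by vertical intervals, each of which meets the graph of the section.\<close>

lemma connected_gap: "connected (gap j)"
proof -
  define \<Gamma> where "\<Gamma> = range (\<lambda>t. (t, s j t))"
  define R where "R = (\<lambda>t. \<Gamma> \<union> {t} \<times> {y. (t, y) \<in> gap j})"
  have "connected \<Gamma>"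
    unfolding \<Gamma>_def by (intro connected_continuous_image continuous_intros s_cont connected_UNIV)
  have "connected (R t)" for t
    unfolding R_def
  proof (rule connected_Un [OF \<open>connected \<Gamma>\<close>])
    show "connected ({t} \<times> {y. (t, y) \<in> gap j})"
      by (intro connected_Times connected_sing connected_gap_slice)
    have "(t, s j t) \<in> \<Gamma> \<inter> {t} \<times> {y. (t, y) \<in> gap j}" using s_gap by (simp add: \<Gamma>_def)
    then show "\<Gamma> \<inter> {t} \<times> {y. (t, y) \<in> gap j} \<noteq> {}" by blast
  qed
  then have "connected (\<Union> (range R))"
  proof (intro connected_Union)
    have "(0, s j 0) \<in> \<Inter> (range R)" by (simp add: R_def \<Gamma>_def)
    then show "\<Inter> (range R) \<noteq> {}" by blast
  qed blast
  moreover have "\<Union> (range R) = gap j"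
    using s_gap by (auto simp: R_def \<Gamma>_def)
  ultimately show ?thesis by simp
qed

text \<open>In the numbering \<open>2 i + 1\<close> of the odd gaps, integer translations shift \<open>i\<close> by the multiples of \<open>gcd N d\<close>.\<close>

definition p :: nat where "p = nat (gcd (int N) d)"

definition q :: nat where "q = N div p"

lemma p_pos: "p > 0"
  using N_pos by (simp add: p_def)

lemma p_times_q: "N = p * q"
proof -
  have "int p dvd int N" by (simp add: p_def)
  then have "p dvd N" by (simp only: int_dvd_int_iff)
  then show ?thesis unfolding q_def by (rule dvd_mult_div_cancel [symmetric])
qed

lemma q_pos: "q > 0"
proof (rule ccontr)
  assume "\<not> ?thesis"
  then have "p * q = 0" by simp
  with p_times_q N_pos show False by linarith
qed

lemma p_dvd_d: "int p dvd d"
  by (simp add: p_def)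

lemma p_bezout: obtains u v where "int p = int N * u + d * v"
proof -
  obtain u v where "u * int N + v * d = gcd (int N) d" using bezout_int by blast
  then show thesis by (intro that [of u v]) (simp add: p_def mult.commute)
qed

lemma q_dvd_if: "int N dvd d * m \<Longrightarrow> int q dvd m"
  using div_gcd_dvd_if [of "int N" d m] N_pos by (simp add: q_def p_def zdiv_int)

text \<open>Gaps that differ by an integer translation have the same image in the torus; these images turn out to be the
components of the complement of the strip.\<close>

definition comp :: "int \<Rightarrow> (circle \<times> circle) set"
  where "comp i = to_torus ` gap (2 * i + 1)"

definition curve :: "int \<Rightarrow> (circle \<times> circle) set"
  where "curve i = range (\<lambda>t. to_torus (t, s (2 * i + 1) t))"

lemma s_shift_odd: "s (2 * (i + d * m + int N * k) + 1) (t + of_int m) = s (2 * i + 1) t + of_int k"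
  using s_shift [of "2 * i + 1" m k t] by (simp add: algebra_simps)

lemma gap_shift_odd: "(t + of_int m, y + of_int k) \<in> gap (2 * (i + d * m + int N * k) + 1) \<longleftrightarrow> (t, y) \<in> gap (2 * i + 1)"
  using gap_shift [of t m y k "2 * i + 1"] by (simp add: algebra_simps)

text \<open>By Bezout's identity the indices reached from \<open>i\<close> by integer translations are exactly the integers congruent
to \<open>i\<close> modulo \<open>p\<close>; translations in the fibre direction and in the base direction are used together.\<close>

lemma comp_iff: "(to_circle t, c) \<in> comp i \<longleftrightarrow> (\<exists>n y. c = to_circle y \<and> (t, y) \<in> gap (2 * (i + int p * n) + 1))"
proof
  assume "(to_circle t, c) \<in> comp i"
  then obtain t' y where ty: "to_circle t = to_circle t'" "c = to_circle y" "(t', y) \<in> gap (2 * i + 1)"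
    by (auto simp: comp_def)
  obtain m where m: "t = t' + of_int m" using to_circle_eqE [OF ty(1)] .
  obtain d' where d': "d = int p * d'" using p_dvd_d by blast
  have dm: "d * m = int p * (d' * m)" by (subst d') (rule mult.assoc)
  have "(t, y) \<in> gap (2 * (i + int p * (d' * m)) + 1)"
    using gap_shift_odd [of t' m y 0 i] ty(3) by (simp add: m dm [symmetric])
  with ty(2) show "\<exists>n y. c = to_circle y \<and> (t, y) \<in> gap (2 * (i + int p * n) + 1)" by blast
next
  assume "\<exists>n y. c = to_circle y \<and> (t, y) \<in> gap (2 * (i + int p * n) + 1)"
  then obtain n y where ny: "c = to_circle y" "(t, y) \<in> gap (2 * (i + int p * n) + 1)" by blast
  obtain u v where uv: "int p = int N * u + d * v" by (rule p_bezout)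
  have pn: "i + int p * n = i + d * (v * n) + int N * (u * n)"
    by (subst uv) (simp add: algebra_simps)
  have "(t - of_int (v * n), y - of_int (u * n)) \<in> gap (2 * i + 1)"
    using gap_shift_odd [of "t - of_int (v * n)" "v * n" "y - of_int (u * n)" "u * n" i] ny(2)
    by (simp add: pn)
  moreover have "to_torus (t - of_int (v * n), y - of_int (u * n)) = (to_circle t, c)"
    using to_circle_add_of_int [of t "- (v * n)"] to_circle_add_of_int [of y "- (u * n)"] ny(1) by simp
  ultimately show "(to_circle t, c) \<in> comp i" unfolding comp_def by (metis imageI)
qed

lemma curve_iff: "(to_circle t, c) \<in> curve i \<longleftrightarrow> (\<exists>n. c = to_circle (s (2 * (i + int p * n) + 1) t))"
proof
  assume "(to_circle t, c) \<in> curve i"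
  then obtain t' where ty: "to_circle t = to_circle t'" "c = to_circle (s (2 * i + 1) t')"
    by (auto simp: curve_def)
  obtain m where m: "t = t' + of_int m" using to_circle_eqE [OF ty(1)] .
  obtain d' where d': "d = int p * d'" using p_dvd_d by blast
  have dm: "d * m = int p * (d' * m)" by (subst d') (rule mult.assoc)
  have "s (2 * (i + int p * (d' * m)) + 1) t = s (2 * i + 1) t'"
    using s_shift_odd [of i m 0 t'] by (simp add: m dm [symmetric])
  with ty(2) show "\<exists>n. c = to_circle (s (2 * (i + int p * n) + 1) t)" by metis
next
  assume "\<exists>n. c = to_circle (s (2 * (i + int p * n) + 1) t)"
  then obtain n where n: "c = to_circle (s (2 * (i + int p * n) + 1) t)" by blast
  obtain u v where uv: "int p = int N * u + d * v" by (rule p_bezout)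
  have pn: "i + int p * n = i + d * (v * n) + int N * (u * n)"
    by (subst uv) (simp add: algebra_simps)
  have "s (2 * (i + int p * n) + 1) t = s (2 * i + 1) (t - of_int (v * n)) + of_int (u * n)"
    using s_shift_odd [of i "v * n" "u * n" "t - of_int (v * n)"] by (simp add: pn)
  then have "c = to_circle (s (2 * i + 1) (t - of_int (v * n)))"
    using n by (simp only: to_circle_add_of_int)
  moreover have "to_circle (t - of_int (v * n)) = to_circle t"
    using to_circle_add_of_int [of t "- (v * n)"] by simp
  ultimately have "(to_circle t, c) = to_torus (t - of_int (v * n), s (2 * i + 1) (t - of_int (v * n)))"
    by simp
  then show "(to_circle t, c) \<in> curve i" unfolding curve_def by (rule range_eqI)
qed

lemma curve_subset_comp: "curve i \<subseteq> comp i"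
  using s_gap by (auto simp: curve_def comp_def)

lemma curve_in_gap:
  assumes "(to_circle t, to_circle y) \<in> curve i" "(t, y) \<in> gap (2 * i' + 1)"
  shows "y = s (2 * i' + 1) t"
proof -
  obtain n where n: "to_circle y = to_circle (s (2 * (i + int p * n) + 1) t)"
    using assms(1) curve_iff by blast
  then obtain k where "y = s (2 * (i + int p * n) + 1) t + of_int k" by (rule to_circle_eqE)
  then have y: "y = s (2 * (i + int p * n + int N * k) + 1) t"
    using s_shift_odd [of "i + int p * n" 0 k t] by simp
  then have "i + int p * n + int N * k = i'"
    using odd_gap_unique [OF _ assms(2)] s_gap by blast
  with y show ?thesis by simp
qed

lemma s_inj: "s (2 * i + 1) t = s (2 * j + 1) t \<Longrightarrow> i = j"
  using s_gap [of t "2 * i + 1"] s_gap [of t "2 * j + 1"] odd_gap_unique [of t _ i j] by simp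

text \<open>After \<open>q\<close> turns in the base the index has changed by \<open>q d\<close>, a multiple of \<open>N\<close>, so the section returns to itself
up to an integer translation in the fibre. It does so for no number of turns that is not a multiple of \<open>q\<close>.\<close>

lemma curve_simple_closed: "simple_closed_curve (curve i)"
proof -
  obtain d' where d': "d = int p * d'" using p_dvd_d by blast
  have Nq: "int N = int p * int q" using p_times_q by (metis of_nat_mult)
  have "d * int q + int N * (- d') = 0" by (subst d', subst Nq) (simp add: algebra_simps)
  then have per: "s (2 * i + 1) (t + real q) = s (2 * i + 1) t + of_int (- d')" for t
    using s_shift_odd [of i "int q" "- d'" t] by (simp add: add.assoc)
  have "int q dvd m" if eq: "s (2 * i + 1) (t + of_int m) = s (2 * i + 1) t + of_int k" for t m k
  proof -
    have "s (2 * i + 1) (t + of_int m) = s (2 * (i - d * m) + 1) t"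
      using s_shift_odd [of "i - d * m" m 0 t] by simp
    moreover have "s (2 * i + 1) t + of_int k = s (2 * (i + int N * k) + 1) t"
      using s_shift_odd [of i 0 k t] by simp
    ultimately have "i - d * m = i + int N * k"
      using eq by (intro s_inj [where t = t]) (simp only:)
    then have "d * m = int N * (- k)" by simp
    then have "int N dvd d * m" by (metis dvd_triv_left)
    then show ?thesis by (rule q_dvd_if)
  qed
  then show ?thesis
    unfolding curve_def using simple_closed_curve_graph [OF s_cont q_pos per] by blast
qed

lemma partition_gap:
  "partition_into q open_interval (fibre (comp i) (to_circle t))
    (range (\<lambda>n. to_circle ` {y. (t, y) \<in> gap (2 * (i + int p * n) + 1)}))"
proof -
  have "partition_into q open_interval (\<Union>n. to_circle ` {y. (t, y) \<in> gap (2 * (i + int p * n) + 1)})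
     (range (\<lambda>n. to_circle ` {y. (t, y) \<in> gap (2 * (i + int p * n) + 1)}))"
  proof (rule partition_into_periodic [OF p_times_q N_pos])
    show "y + of_int k \<in> {y. (t, y) \<in> gap (2 * (i + int N * k) + 1)} \<longleftrightarrow> y \<in> {y. (t, y) \<in> gap (2 * i + 1)}" for i k y
      using gap_shift_odd [of t 0 y k i] by simp
    show "i = j" if "y \<in> {y. (t, y) \<in> gap (2 * i + 1)}" "y \<in> {y. (t, y) \<in> gap (2 * j + 1)}" for i j y
      using that odd_gap_unique by simp
    show "{y. (t, y) \<in> gap (2 * i + 1)} \<noteq> {}" for i
      using s_gap by blast
    show "open_interval (to_circle ` {y. (t, y) \<in> gap (2 * i + 1)})" for i
      using gap_slice_interval [of t "2 * i + 1"] unfolding open_interval_def by metis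
  qed
  moreover have "fibre (comp i) (to_circle t) = (\<Union>n. to_circle ` {y. (t, y) \<in> gap (2 * (i + int p * n) + 1)})"
    unfolding fibre_def by (auto simp: comp_iff)
  ultimately show ?thesis by simp
qed

lemma card_curve_fibre:
  "finite {c \<in> curve i. fst c = \<theta>} \<and> card {c \<in> curve i. fst c = \<theta>} = q"
proof -
  obtain t where t: "\<theta> = to_circle t" by (rule ex_to_circle)
  define x where "x = (\<lambda>n. to_circle (s (2 * (i + int p * n) + 1) t))"
  have "partition_into q (\<lambda>_. True) (\<Union>n. to_circle ` {s (2 * (i + int p * n) + 1) t})
     (range (\<lambda>n. to_circle ` {s (2 * (i + int p * n) + 1) t}))"
  proof (rule partition_into_periodic [OF p_times_q N_pos])
    show "y + of_int k \<in> {s (2 * (i + int N * k) + 1) t} \<longleftrightarrow> y \<in> {s (2 * i + 1) t}" for i k y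
      using s_shift_odd [of i 0 k t] by simp
    show "i = j" if "y \<in> {s (2 * i + 1) t}" "y \<in> {s (2 * j + 1) t}" for i j y
      using that s_gap [of t "2 * i + 1"] s_gap [of t "2 * j + 1"] odd_gap_unique [of t y i j] by simp
  qed auto
  then have fin: "finite (range (\<lambda>n. {x n}))" "card (range (\<lambda>n. {x n})) = q"
    by (simp_all add: partition_into_def x_def)
  have "{c \<in> curve i. fst c = \<theta>} = range (\<lambda>n. (\<theta>, x n))"
  proof (intro subset_antisym subsetI)
    fix c assume "c \<in> {c \<in> curve i. fst c = \<theta>}"
    then have "(to_circle t, snd c) \<in> curve i" "c = (\<theta>, snd c)" using t by (cases c; auto)+
    then obtain n where "snd c = x n" unfolding curve_iff x_def by blast
    with \<open>c = (\<theta>, snd c)\<close> have "c = (\<theta>, x n)" by simp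
    then show "c \<in> range (\<lambda>n. (\<theta>, x n))" by (rule range_eqI)
  next
    fix c assume "c \<in> range (\<lambda>n. (\<theta>, x n))"
    then obtain n where "c = (to_circle t, x n)" using t by blast
    moreover have "(to_circle t, x n) \<in> curve i" unfolding curve_iff x_def by (rule exI) (rule refl)
    ultimately show "c \<in> {c \<in> curve i. fst c = \<theta>}" using t by simp
  qed
  then have eq: "(\<lambda>c. {snd c}) ` {c \<in> curve i. fst c = \<theta>} = range (\<lambda>n. {x n})"
    by (simp add: image_image)
  have inj: "inj_on (\<lambda>c. {snd c}) {c \<in> curve i. fst c = \<theta>}"
    by (auto simp: inj_on_def)
  show ?thesis
    using card_image [OF inj] finite_image_iff [OF inj] fin unfolding eq by simp
qed

text \<open>Over an arc of length \<open>1/2\<close> the sheets are the graphs of the sections whose indices are congruent to \<open>i\<close>. Each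
sheet is open in the curve because it is cut out by an open gap.\<close>

lemma curve_covering: "covering_space (curve i) fst UNIV"
proof -
  have ex: "\<exists>T. \<theta> \<in> T \<and> openin (top_of_set UNIV) T \<and>
      (\<exists>v. \<Union>v = curve i \<inter> fst -` T \<and> (\<forall>u\<in>v. openin (top_of_set (curve i)) u) \<and> pairwise disjnt v \<and>
        (\<forall>u\<in>v. \<exists>g. homeomorphism u T fst g))" for \<theta>
  proof -
    obtain t0 where t0: "\<theta> = to_circle t0" by (rule ex_to_circle)
    define I where "I = {t0 - 1/4<..<t0 + 1/4}"
    define T where "T = to_circle ` I"
    define \<sigma> where "\<sigma> = (\<lambda>n. (\<lambda>t. to_torus (t, s (2 * (i + int p * n) + 1) t)) ` I)"
    have inj: "t = t'" if "t \<in> I" "t' \<in> I" "to_circle t = to_circle t'" for t t'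
    proof -
      obtain k where k: "t = t' + of_int k" using \<open>to_circle t = to_circle t'\<close> by (rule to_circle_eqE)
      then have "of_int k < (1::real)" "of_int k > (- 1::real)" using \<open>t \<in> I\<close> \<open>t' \<in> I\<close> by (auto simp: I_def)
      then have "k = 0" by linarith
      with k show ?thesis by simp
    qed
    obtain r where r: "homeomorphism I T to_circle r"
      using ex_to_circle_inverse [of "t0 + 1/4" "t0 - 1/4"] unfolding I_def T_def by auto
    have \<sigma>_eq: "\<sigma> n = curve i \<inter> to_torus ` (gap (2 * (i + int p * n) + 1) \<inter> I \<times> UNIV)" for n
    proof (intro subset_antisym subsetI)
      fix c assume "c \<in> \<sigma> n"
      then obtain t where t: "t \<in> I" "c = to_torus (t, s (2 * (i + int p * n) + 1) t)" by (auto simp: \<sigma>_def)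
      then have "c \<in> curve i" using curve_iff by auto
      moreover have "(t, s (2 * (i + int p * n) + 1) t) \<in> gap (2 * (i + int p * n) + 1) \<inter> I \<times> UNIV"
        using t(1) s_gap by simp
      ultimately show "c \<in> curve i \<inter> to_torus ` (gap (2 * (i + int p * n) + 1) \<inter> I \<times> UNIV)"
        using t(2) by blast
    next
      fix c assume "c \<in> curve i \<inter> to_torus ` (gap (2 * (i + int p * n) + 1) \<inter> I \<times> UNIV)"
      then obtain t y where c: "c \<in> curve i" "c = to_torus (t, y)" "t \<in> I" "(t, y) \<in> gap (2 * (i + int p * n) + 1)"
        by auto
      then have "y = s (2 * (i + int p * n) + 1) t"
        using curve_in_gap [of t y i "i + int p * n"] by simp
      with c show "c \<in> \<sigma> n" by (auto simp: \<sigma>_def)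
    qed
    have "\<Union> (range \<sigma>) = curve i \<inter> fst -` T"
    proof (intro subset_antisym subsetI)
      fix c assume "c \<in> \<Union> (range \<sigma>)"
      then show "c \<in> curve i \<inter> fst -` T" using \<sigma>_eq by (auto simp: T_def)
    next
      fix c assume c: "c \<in> curve i \<inter> fst -` T"
      then obtain t where t: "t \<in> I" "c = (to_circle t, snd c)" by (cases c) (auto simp: T_def)
      then have "(to_circle t, snd c) \<in> curve i" using c by (metis IntD1)
      then obtain n where "snd c = to_circle (s (2 * (i + int p * n) + 1) t)"
        unfolding curve_iff by blast
      then have "c = to_torus (t, s (2 * (i + int p * n) + 1) t)" using t(2) by simp
      then have "c \<in> \<sigma> n" unfolding \<sigma>_def using t(1) by blast
      then show "c \<in> \<Union> (range \<sigma>)" by blast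
    qed
    moreover have "openin (top_of_set (curve i)) u" if u: "u \<in> range \<sigma>" for u
    proof -
      obtain n where "u = \<sigma> n" using u by blast
      moreover have "open (to_torus ` (gap (2 * (i + int p * n) + 1) \<inter> I \<times> UNIV))"
        unfolding I_def by (intro open_image_to_torus open_Int open_gap open_Times open_greaterThanLessThan open_UNIV)
      ultimately show ?thesis unfolding \<sigma>_eq by (auto simp: openin_open)
    qed
    moreover have "pairwise disjnt (range \<sigma>)"
    proof (rule pairwiseI)
      fix A B assume AB: "A \<in> range \<sigma>" "B \<in> range \<sigma>" "A \<noteq> B"
      then obtain n m where nm: "A = \<sigma> n" "B = \<sigma> m" by blast
      show "disjnt A B"
      proof (rule ccontr)
        assume "\<not> disjnt A B"
        then obtain c where c: "c \<in> \<sigma> n" "c \<in> \<sigma> m" using nm by (auto simp: disjnt_def)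
        obtain t where t: "t \<in> I" "c = to_torus (t, s (2 * (i + int p * n) + 1) t)"
          using c(1) by (auto simp: \<sigma>_def)
        obtain t' where t': "t' \<in> I" "c = to_torus (t', s (2 * (i + int p * m) + 1) t')"
          using c(2) by (auto simp: \<sigma>_def)
        have "t = t'" using t t' inj by simp
        with t t' have "to_circle (s (2 * (i + int p * n) + 1) t) = to_circle (s (2 * (i + int p * m) + 1) t)" by simp
        then obtain k where "s (2 * (i + int p * n) + 1) t = s (2 * (i + int p * m) + 1) t + of_int k"
          by (rule to_circle_eqE)
        also have "\<dots> = s (2 * (i + int p * m + int N * k) + 1) t"
          using s_shift_odd [of "i + int p * m" 0 k t] by simp
        finally have idx: "i + int p * n = i + int p * m + int N * k"
          by (rule s_inj)
        have "\<sigma> n = \<sigma> m"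
          unfolding \<sigma>_def idx
        proof (rule image_cong [OF refl])
          fix t
          have "s (2 * (i + int p * m + int N * k) + 1) t = s (2 * (i + int p * m) + 1) t + of_int k"
            using s_shift_odd [of "i + int p * m" 0 k t] by simp
          then show "to_torus (t, s (2 * (i + int p * m + int N * k) + 1) t) = to_torus (t, s (2 * (i + int p * m) + 1) t)"
            by (simp only: map_prod_simp to_circle_add_of_int)
        qed
        with AB(3) nm show False by simp
      qed
    qed
    moreover have "\<exists>g. homeomorphism u T fst g" if u: "u \<in> range \<sigma>" for u
    proof -
      obtain n where n: "u = \<sigma> n" using u by blast
      define g where "g = (\<lambda>\<theta>. to_torus (r \<theta>, s (2 * (i + int p * n) + 1) (r \<theta>)))"
      have rT: "r \<theta> \<in> I" "to_circle (r \<theta>) = \<theta>" if "\<theta> \<in> T" for \<theta>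
        using r \<open>\<theta> \<in> T\<close> by (auto simp: homeomorphism_def)
      have rI: "r (to_circle t) = t" if "t \<in> I" for t
        using r \<open>t \<in> I\<close> by (auto simp: homeomorphism_def)
      have "homeomorphism u T fst g"
        unfolding homeomorphism_def n
      proof (intro conjI ballI)
        show "continuous_on T g"
          unfolding g_def
          by (intro continuous_on_compose2 [OF continuous_on_to_torus [of UNIV]] continuous_on_Pair
              continuous_on_compose2 [OF s_cont] homeomorphism_cont2 [OF r]) auto
        show "continuous_on (\<sigma> n) fst" by (intro continuous_intros)
        show "fst ` \<sigma> n = T" by (auto simp: \<sigma>_def T_def image_iff)
        show "g ` T = \<sigma> n"
          unfolding \<sigma>_def g_def using r by (auto simp: homeomorphism_def image_iff)
        show "g (fst c) = c" if "c \<in> \<sigma> n" for c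
          using that rI by (auto simp: \<sigma>_def g_def)
        show "fst (g \<theta>) = \<theta>" if "\<theta> \<in> T" for \<theta>
          using rT [OF that] by (simp add: g_def)
      qed
      then show ?thesis by blast
    qed
    moreover have "\<theta> \<in> T" using t0 by (auto simp: T_def I_def)
    moreover have "openin (top_of_set UNIV) T"
      by (simp add: T_def I_def open_image_to_circle)
    ultimately show ?thesis by metis
  qed
  have "fst ` curve i = UNIV"
  proof (rule UNIV_eq_I [symmetric])
    fix \<theta> :: circle
    obtain t where "\<theta> = to_circle t" by (rule ex_to_circle)
    then show "\<theta> \<in> fst ` curve i" by (auto simp: curve_def image_iff)
  qed
  then show ?thesis
    unfolding covering_space_def using ex by (auto intro: continuous_intros)
qed

lemma open_comp: "open (comp i)"
  unfolding comp_def by (intro open_image_to_torus open_gap)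

lemma connected_comp: "connected (comp i)"
  unfolding comp_def by (intro connected_continuous_image continuous_on_to_torus connected_gap)

lemma comp_meet:
  assumes "z \<in> comp i" "z \<in> comp j"
  shows "\<exists>n. j = i + int p * n"
proof -
  obtain t c where z: "z = (to_circle t, c)" using ex_to_circle by (metis prod.collapse)
  obtain n y where ny: "c = to_circle y" "(t, y) \<in> gap (2 * (i + int p * n) + 1)"
    using assms(1) comp_iff z by blast
  obtain m y' where my: "c = to_circle y'" "(t, y') \<in> gap (2 * (j + int p * m) + 1)"
    using assms(2) comp_iff z by blast
  obtain k where "y = y' + of_int k" using ny(1) my(1) to_circle_eqE by metis
  then have "(t, y) \<in> gap (2 * (j + int p * m + int N * k) + 1)"
    using my(2) gap_shift_odd [of t 0 y' k "j + int p * m"] by simp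
  then have eq: "i + int p * n = j + int p * m + int N * k" using ny(2) odd_gap_unique by blast
  have "int N = int p * int q" using p_times_q by (metis of_nat_mult)
  then have "int N * k = int p * (int q * k)" by (metis mult.assoc)
  with eq have "j = i + int p * (n - m - int q * k)"
    unfolding right_diff_distrib by linarith
  then show ?thesis ..
qed

lemma comp_periodic: "comp (i + int p * n) = comp i"
proof -
  have "comp (i + int p * n) \<subseteq> comp i" for i n
  proof
    fix z assume z: "z \<in> comp (i + int p * n)"
    obtain t c where tc: "z = (to_circle t, c)" using ex_to_circle by (metis prod.collapse)
    obtain m y where "c = to_circle y" "(t, y) \<in> gap (2 * (i + int p * n + int p * m) + 1)"
      using z comp_iff tc by blast
    moreover have "i + int p * n + int p * m = i + int p * (n + m)" by (simp add: algebra_simps)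
    ultimately show "z \<in> comp i" using comp_iff tc by metis
  qed
  from this [of i n] this [of "i + int p * n" "- n"] show ?thesis by simp
qed

lemma range_comp: "range comp = comp ` {0..<int p}"
proof -
  have "comp n \<in> comp ` {0..<int p}" for n
  proof
    show "comp n = comp (n mod int p)" using comp_periodic [of "n mod int p" "n div int p"] by simp
  qed (use p_pos in simp)
  then show ?thesis by blast
qed

lemma comp_nonempty: "comp i \<noteq> {}"
  using s_gap by (auto simp: comp_def)

text \<open>The gaps are open and connected, and their images in the torus are pairwise disjoint or equal.\<close>

lemma components_comp: "components (\<Union>i. comp i) = range comp"
proof (rule components_Union_disjoint_open)
  show "disjoint (range comp)"
    unfolding disjoint_def
  proof (intro ballI impI)
    fix A B assume AB: "A \<in> range comp" "B \<in> range comp" "A \<noteq> B"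
    then obtain i j where ij: "A = comp i" "B = comp j" by blast
    show "A \<inter> B = {}"
    proof (rule ccontr)
      assume "A \<inter> B \<noteq> {}"
      then obtain z where "z \<in> comp i" "z \<in> comp j" using ij by blast
      then obtain n where "j = i + int p * n" using comp_meet by blast
      then show False using ij AB(3) comp_periodic by simp
    qed
  qed
  fix V assume "V \<in> range comp"
  then show "open V \<and> connected V \<and> V \<noteq> {}"
    using open_comp connected_comp comp_nonempty by blast
qed

lemma card_components_comp: "card (components (\<Union>i. comp i)) = p"
proof -
  have "inj_on comp {0..<int p}"
  proof (rule inj_onI)
    fix n m assume nm: "n \<in> {0..<int p}" "m \<in> {0..<int p}" "comp n = comp m"
    then obtain k where "m = n + int p * k" using comp_meet comp_nonempty by blast
    then have "m mod int p = n mod int p" by simp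
    with nm show "n = m" by simp
  qed
  then show ?thesis unfolding components_comp unfolding range_comp by (simp add: card_image)
qed

text \<open>By \<open>block_or_gap\<close>, what remains of a fibre without the odd gaps are the blocks of even index.\<close>

lemma partition_block:
  "partition_into N compact_interval (fibre (- (\<Union>i. comp i)) (to_circle t))
    (range (\<lambda>n. to_circle ` {y. (t, y) \<in> block (2 * n)}))"
proof -
  have "partition_into N compact_interval (\<Union>n. to_circle ` {y. (t, y) \<in> block (2 * (0 + int 1 * n))})
     (range (\<lambda>n. to_circle ` {y. (t, y) \<in> block (2 * (0 + int 1 * n))}))"
  proof (rule partition_into_periodic [where D = "\<lambda>n. {y. (t, y) \<in> block (2 * n)}" and N = N])
    show "N = 1 * N" "N > 0" using N_pos by auto
    show "y + of_int k \<in> {y. (t, y) \<in> block (2 * (i + int N * k))} \<longleftrightarrow> y \<in> {y. (t, y) \<in> block (2 * i)}" for i k y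
      using block_shift_y [of t y k "2 * i"] by (simp add: algebra_simps)
    show "i = j" if "y \<in> {y. (t, y) \<in> block (2 * i)}" "y \<in> {y. (t, y) \<in> block (2 * j)}" for i j y
      using that block_unique by fastforce
    show "{y. (t, y) \<in> block (2 * i)} \<noteq> {}" for i
      using block_slice_interval [of t "2 * i"] by auto
    show "compact_interval (to_circle ` {y. (t, y) \<in> block (2 * i)})" for i
      using block_slice_interval [of t "2 * i"] unfolding compact_interval_def by metis
  qed
  moreover have "fibre (- (\<Union>i. comp i)) (to_circle t) = (\<Union>n. to_circle ` {y. (t, y) \<in> block (2 * n)})"
  proof (intro subset_antisym subsetI)
    fix c assume c: "c \<in> fibre (- (\<Union>i. comp i)) (to_circle t)"
    obtain y where y: "c = to_circle y" by (rule ex_to_circle)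
    obtain i where "(t, y) \<in> block (2 * i) \<or> (t, y) \<in> gap (2 * i + 1)" by (rule block_or_gap)
    moreover have "(t, y) \<notin> gap (2 * i + 1)"
      using c y by (force simp: fibre_def comp_def)
    ultimately show "c \<in> (\<Union>n. to_circle ` {y. (t, y) \<in> block (2 * n)})" using y by blast
  next
    fix c assume "c \<in> (\<Union>n. to_circle ` {y. (t, y) \<in> block (2 * n)})"
    then obtain n y where ny: "c = to_circle y" "(t, y) \<in> block (2 * n)" by blast
    have "(to_circle t, c) \<notin> comp i" for i
    proof
      assume "(to_circle t, c) \<in> comp i"
      then obtain m y' where my: "c = to_circle y'" "(t, y') \<in> gap (2 * (i + int p * m) + 1)"
        using comp_iff by blast
      obtain k where "y = y' + of_int k" using ny(1) my(1) to_circle_eqE by metis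
      then have "(t, y) \<in> gap (2 * (i + int p * m + int N * k) + 1)"
        using my(2) gap_shift_odd [of t 0 y' k "i + int p * m"] by simp
      then have "2 * n = 2 * (i + int p * m + int N * k) + 1" using ny(2) block_gap_disjoint by blast
      then show False by presburger
    qed
    then show "c \<in> fibre (- (\<Union>i. comp i)) (to_circle t)" by (simp add: fibre_def)
  qed
  ultimately show ?thesis by simp
qed

text \<open>The geometric part of the definition of a strip holds by construction; only the dynamics has to be supplied.\<close>

theorem complement_is_strip:
  assumes "f ` (- (\<Union>i. comp i)) = - (\<Union>i. comp i)" "cyclically_permuted f p (range comp)"
  shows "invariant_strip f p q (- (\<Union>i. comp i))"
  unfolding invariant_strip_def double_complement
proof (intro conjI allI ballI)
  show "compact (- (\<Union>i. comp i))"
    unfolding compact_torus_iff_closed by (intro closed_Compl open_UN ballI open_comp)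
  show "\<exists>\<I>. partition_into (p * q) compact_interval (fibre (- (\<Union>i. comp i)) \<theta>) \<I>" for \<theta>
  proof -
    obtain t where "\<theta> = to_circle t" by (rule ex_to_circle)
    then show ?thesis using partition_block p_times_q by metis
  qed
  fix U assume "U \<in> components (\<Union>i. comp i)"
  then obtain i where i: "U = comp i" by (auto simp: components_comp)
  \<comment> \<open>The family of intervals does not depend on the lift \<open>t\<close> of \<open>\<theta>\<close>; some lift is chosen.\<close>
  define J where "J = (\<lambda>\<theta>. let t = SOME t. \<theta> = to_circle t in
      range (\<lambda>n. to_circle ` {y. (t, y) \<in> gap (2 * (i + int p * n) + 1)}))"
  have J: "\<exists>t. \<theta> = to_circle t \<and> J \<theta> = range (\<lambda>n. to_circle ` {y. (t, y) \<in> gap (2 * (i + int p * n) + 1)})" for \<theta>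
  proof -
    have "\<exists>t. \<theta> = to_circle t" using ex_to_circle by blast
    then have "\<theta> = to_circle (SOME t. \<theta> = to_circle t)" by (rule someI_ex)
    then show ?thesis unfolding J_def Let_def by blast
  qed
  show "\<exists>J. (\<forall>\<theta>. partition_into q open_interval (fibre U \<theta>) (J \<theta>)) \<and>
       (\<exists>C. simple_closed_curve C \<and> C \<subseteq> U \<and> fold_covering q C fst UNIV \<and>
            (\<forall>\<theta>. \<forall>I\<in>J \<theta>. \<exists>!x. x \<in> I \<and> (\<theta>, x) \<in> C))"
  proof (intro exI [of _ J] exI [of _ "curve i"] conjI allI ballI)
    show "partition_into q open_interval (fibre U \<theta>) (J \<theta>)" for \<theta>
      using J [of \<theta>] partition_gap i by metis
    show "simple_closed_curve (curve i)" by (rule curve_simple_closed)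
    show "curve i \<subseteq> U" unfolding i by (rule curve_subset_comp)
    show "fold_covering q (curve i) fst UNIV"
      unfolding fold_covering_def using curve_covering card_curve_fibre by blast
    fix \<theta> I assume "I \<in> J \<theta>"
    then obtain t n where t: "\<theta> = to_circle t" and I: "I = to_circle ` {y. (t, y) \<in> gap (2 * (i + int p * n) + 1)}"
      using J [of \<theta>] by blast
    show "\<exists>!x. x \<in> I \<and> (\<theta>, x) \<in> curve i"
    proof (rule ex1I [of _ "to_circle (s (2 * (i + int p * n) + 1) t)"])
      show "to_circle (s (2 * (i + int p * n) + 1) t) \<in> I \<and> (\<theta>, to_circle (s (2 * (i + int p * n) + 1) t)) \<in> curve i"
        unfolding I t curve_iff using s_gap by blast
      fix x assume "x \<in> I \<and> (\<theta>, x) \<in> curve i"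
      then show "x = to_circle (s (2 * (i + int p * n) + 1) t)"
        unfolding I t using curve_in_gap by blast
    qed
  qed
qed (use assms card_components_comp in \<open>simp_all only: components_comp\<close>)

end

section \<open>Alternating chains\<close>

text \<open>The preimages in \<open>\<real>\<^sup>2\<close> of two disjoint closed subsets of the torus.\<close>

locale periodic_pair =
  fixes P Q :: "(real \<times> real) set"
  assumes closed_P: "closed P" and closed_Q: "closed Q" and disjoint: "P \<inter> Q = {}"
    and P_shift: "(t + of_int m, y + of_int k) \<in> P \<longleftrightarrow> (t, y) \<in> P"
    and Q_shift: "(t + of_int m, y + of_int k) \<in> Q \<longleftrightarrow> (t, y) \<in> Q"
begin

lemma P_shift_y: "(t, y + of_int k) \<in> P \<longleftrightarrow> (t, y) \<in> P"
  using P_shift [of t 0 y k] by simp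

lemma Q_shift_y: "(t, y + of_int k) \<in> Q \<longleftrightarrow> (t, y) \<in> Q"
  using Q_shift [of t 0 y k] by simp

text \<open>The points \<open>x 0, y 0, x 1, ..., x m\<close> alternate between \<open>P\<close> and \<open>Q\<close> in the fibre over \<open>t\<close> and go around it once. The
weak inequalities make the condition closed; since \<open>P\<close> and \<open>Q\<close> are disjoint, they are in fact strict.\<close>

definition alternates :: "nat \<Rightarrow> real \<Rightarrow> (nat \<Rightarrow> real) \<Rightarrow> (nat \<Rightarrow> real) \<Rightarrow> bool"
  where "alternates m t x y \<longleftrightarrow> (\<forall>i\<le>m. (t, x i) \<in> P) \<and>
     (\<forall>i<m. (t, y i) \<in> Q \<and> x i \<le> y i \<and> y i \<le> x (Suc i)) \<and> x m = x 0 + 1"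

definition chain :: "nat \<Rightarrow> real \<Rightarrow> bool"
  where "chain m t \<longleftrightarrow> (\<exists>x y. alternates m t x y)"

lemma alternates_less:
  assumes "alternates m t x y" "i < m"
  shows "x i < y i" "y i < x (Suc i)"
proof -
  have "(t, x i) \<in> P" "(t, x (Suc i)) \<in> P" "(t, y i) \<in> Q" "x i \<le> y i" "y i \<le> x (Suc i)"
    using assms by (auto simp: alternates_def)
  then show "x i < y i" "y i < x (Suc i)"
    using disjoint by (metis IntI empty_iff order_le_less)+
qed

lemma alternates_shift:
  assumes "alternates m t x y"
  shows "alternates m t (\<lambda>i. x i + of_int k) (\<lambda>i. y i + of_int k)"
  using assms by (simp add: alternates_def P_shift_y Q_shift_y)

lemma alternates_bounds:
  assumes "alternates m t x y"
  shows "i \<le> m \<Longrightarrow> x 0 \<le> x i \<and> x i \<le> x 0 + 1" "i < m \<Longrightarrow> x 0 \<le> y i \<and> y i \<le> x 0 + 1"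
proof -
  have step: "x i \<le> y i" "y i \<le> x (Suc i)" if "i < m" for i
    using assms that by (auto simp: alternates_def)
  have mono: "i \<le> j \<Longrightarrow> j \<le> m \<Longrightarrow> x i \<le> x j" for i j
  proof (induction j rule: dec_induct)
    case (step j)
    then show ?case using \<open>\<And>i. i < m \<Longrightarrow> x i \<le> y i\<close> \<open>\<And>i. i < m \<Longrightarrow> y i \<le> x (Suc i)\<close>
      by (meson Suc_le_lessD Suc_leD order_trans)
  qed simp
  have "x m = x 0 + 1" using assms by (simp add: alternates_def)
  then show x: "i \<le> m \<Longrightarrow> x 0 \<le> x i \<and> x i \<le> x 0 + 1" for i
    using mono [of 0 i] mono [of i m] by simp
  show "i < m \<Longrightarrow> x 0 \<le> y i \<and> y i \<le> x 0 + 1"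
    using x [of i] x [of "Suc i"] step [of i] by (meson Suc_leI less_imp_le order_trans)
qed

text \<open>A translate by an integer starts in \<open>[0, 1]\<close>. Entries with irrelevant positions are set to \<open>0\<close>, so that the
sequences range over a compact product.\<close>

lemma chain_normalised:
  assumes "chain m t"
  obtains x y where "alternates m t x y" "\<forall>i. x i \<in> {0..2}" "\<forall>i. y i \<in> {0..2}"
proof -
  obtain x y where xy: "alternates m t x y" using assms by (auto simp: chain_def)
  define k where "k = - \<lfloor>x 0\<rfloor>"
  define x' y' where "x' = (\<lambda>i. if i \<le> m then x i + of_int k else 0)"
    and "y' = (\<lambda>i. if i < m then y i + of_int k else 0)"
  have k: "0 \<le> x 0 + of_int k" "x 0 + of_int k \<le> 1" unfolding k_def by (simp_all, linarith)
  have "alternates m t x' y'"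
    using alternates_shift [OF xy, of k] by (simp add: alternates_def x'_def y'_def)
  moreover have "x' i \<in> {0..2}" for i
    using alternates_bounds(1) [OF xy, of i] k by (auto simp: x'_def)
  moreover have "y' i \<in> {0..2}" for i
    using alternates_bounds(2) [OF xy, of i] k by (auto simp: y'_def)
  ultimately show thesis using that by blast
qed

text \<open>Alternation is a closed condition on points that may be taken from a compact set.\<close>

lemma closed_chain: "closed {t. chain m t}"
proof -
  define K where "K = {f :: nat \<Rightarrow> real. \<forall>i. f i \<in> {0..2}}"
  define S where "S = {(t, (x, y)). alternates m t x y}"
  have "K = PiE UNIV (\<lambda>_. {0..2})" by (auto simp: K_def PiE_def Pi_def)
  then have "compact K"
    using compactin_PiE [of "\<lambda>_. euclidean" UNIV "\<lambda>_::nat. {0..2::real}"]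
    by (simp add: euclidean_product_topology)
  have coord: "continuous_on UNIV (\<lambda>z :: real \<times> (nat \<Rightarrow> real) \<times> (nat \<Rightarrow> real). fst (snd z) i)"
    "continuous_on UNIV (\<lambda>z :: real \<times> (nat \<Rightarrow> real) \<times> (nat \<Rightarrow> real). snd (snd z) i)" for i
    by (rule continuous_on_compose2 [OF continuous_on_product_coordinates [of i]]; intro continuous_intros subset_UNIV)+
  have mem: "closed {z :: real \<times> (nat \<Rightarrow> real) \<times> (nat \<Rightarrow> real). (fst z, fst (snd z) i) \<in> P}"
    "closed {z :: real \<times> (nat \<Rightarrow> real) \<times> (nat \<Rightarrow> real). (fst z, snd (snd z) i) \<in> Q}" for i
    by (rule closed_vimage [unfolded vimage_def, OF closed_P]
         closed_vimage [unfolded vimage_def, OF closed_Q];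
        intro continuous_on_Pair continuous_on_fst continuous_on_id coord)+
  have "closed S"
    unfolding S_def case_prod_unfold alternates_def
    by (intro closed_Collect_conj closed_Collect_all closed_Collect_imp open_Collect_const mem
        closed_Collect_le closed_Collect_eq continuous_on_add continuous_on_const coord)
  have "{t. chain m t} = {t. \<exists>z\<in>K \<times> K. (t, z) \<in> S}"
  proof (intro subset_antisym subsetI)
    fix t assume "t \<in> {t. chain m t}"
    then have "chain m t" by simp
    then obtain x y where "alternates m t x y" "\<forall>i. x i \<in> {0..2}" "\<forall>i. y i \<in> {0..2}"
      by (rule chain_normalised)
    then have "(x, y) \<in> K \<times> K" "(t, (x, y)) \<in> S" by (simp_all add: K_def S_def)
    then show "t \<in> {t. \<exists>z\<in>K \<times> K. (t, z) \<in> S}" by blast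
  qed (auto simp: S_def chain_def)
  then show ?thesis
    using closed_projection_along_compact [OF compact_Times [OF \<open>compact K\<close> \<open>compact K\<close>] \<open>closed S\<close>] by simp
qed

text \<open>If \<open>\<delta>\<close> is the distance of \<open>P\<close> and \<open>Q\<close> in the fibre over \<open>t\<close>, each of the \<open>m\<close> steps from \<open>x i\<close> to \<open>x (i + 1)\<close> has
length at least \<open>\<delta>\<close>, while their sum is one.\<close>

lemma chain_bounded: "\<exists>M. \<forall>m. chain m t \<longrightarrow> m \<le> M"
proof -
  define P' Q' where "P' = {0..2} \<inter> Pair t -` P" and "Q' = Pair t -` Q"
  have cont: "continuous_on UNIV (Pair t)" by (intro continuous_intros)
  have "compact P'" "closed Q'"
    unfolding P'_def Q'_def using closed_vimage [OF closed_P cont] closed_vimage [OF closed_Q cont]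
    by (auto intro: compact_Int_closed)
  moreover have "P' \<inter> Q' = {}" using disjoint by (auto simp: P'_def Q'_def)
  ultimately obtain \<delta> where \<delta>: "\<delta> > 0" "\<And>u v. u \<in> P' \<Longrightarrow> v \<in> Q' \<Longrightarrow> \<delta> \<le> dist u v"
    using separate_compact_closed by metis
  have "m \<le> nat \<lceil>1 / \<delta>\<rceil>" if ch: "chain m t" for m
  proof -
    obtain x y where xy: "alternates m t x y" "\<forall>i. x i \<in> {0..2}"
      by (rule chain_normalised [OF ch]) blast
    have step: "x i + \<delta> \<le> x (Suc i)" if "i < m" for i
    proof -
      have "x i \<in> P'" "y i \<in> Q'" using xy that by (auto simp: alternates_def P'_def Q'_def)
      then have "\<delta> \<le> dist (x i) (y i)" by (rule \<delta>(2))
      then show ?thesis using alternates_less [OF xy(1) that] by (simp add: dist_real_def)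
    qed
    have "x 0 + real i * \<delta> \<le> x i" if "i \<le> m" for i
      using that
    proof (induction i)
      case (Suc i)
      then show ?case using step [of i] by (simp add: algebra_simps)
    qed simp
    then have "real m * \<delta> \<le> 1" using xy(1) by (force simp: alternates_def)
    then have "real m \<le> 1 / \<delta>" using \<delta>(1) by (simp add: field_simps)
    then show ?thesis by linarith
  qed
  then show ?thesis by blast
qed

lemma chain_1:
  assumes "(t, u) \<in> P" "(t, v) \<in> Q"
  shows "chain 1 t"
proof -
  define v' where "v' = v + of_int (- \<lfloor>v - u\<rfloor>)"
  have "(t, v') \<in> Q" unfolding v'_def Q_shift_y by (rule assms)
  moreover have "u \<le> v'" "v' \<le> u + 1" unfolding v'_def by (simp_all, linarith+)
  moreover have "(t, u + 1) \<in> P" using assms(1) P_shift_y [of t u 1] by simp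
  ultimately have "alternates 1 t (\<lambda>i. u + real i) (\<lambda>_. v')"
    using assms(1) by (auto simp: alternates_def le_Suc_eq)
  then show ?thesis by (auto simp: chain_def)
qed

end

section \<open>Indexing a maximal alternation\<close>

locale periodic_sequence =
  fixes w :: "int \<Rightarrow> real" and N :: nat
  assumes N_pos: "N > 0" and w_less: "w i < w (i + 1)" and w_shift: "w (i + int N * k) = w i + of_int k"
begin

lemma w_mono: "i \<le> j \<Longrightarrow> w i \<le> w j"
proof (induction j rule: int_ge_induct)
  case (step j)
  then show ?case using w_less [of j] by linarith
qed simp

lemma ex_cell: "\<exists>i. w (i - 1) < u \<and> u \<le> w i"
proof -
  define k where "k = \<lfloor>u - w 0\<rfloor>"
  have k: "w (int N * k) \<le> u" "u < w (int N * k + int N)"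
    using w_shift [of 0 k] w_shift [of 0 "k + 1"] unfolding k_def by (auto simp: algebra_simps; linarith)+
  define n where "n = (LEAST n. u \<le> w (int N * k + int n))"
  have n: "u \<le> w (int N * k + int n)"
    unfolding n_def using k(2) by (intro LeastI [of "\<lambda>n. u \<le> w (int N * k + int n)" N]) simp
  have "w (int N * k + int n - 1) < u"
  proof (cases n)
    case 0
    then show ?thesis using k(1) w_less [of "int N * k - 1"] by simp
  next
    case (Suc n')
    then have "\<not> u \<le> w (int N * k + int n')"
      unfolding n_def using not_less_Least [of n'] by (metis lessI n_def)
    then show ?thesis using Suc by (simp add: algebra_simps)
  qed
  with n show ?thesis by blast
qed

definition cell :: "real \<Rightarrow> int"
  where "cell u = (SOME i. w (i - 1) < u \<and> u \<le> w i)"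

lemma cell: "w (cell u - 1) < u" "u \<le> w (cell u)"
  using someI_ex [OF ex_cell [of u]] unfolding cell_def by blast+

lemma cell_eq:
  assumes "w (i - 1) < u" "u \<le> w i"
  shows "cell u = i"
proof -
  have "\<not> cell u \<le> i - 1" using w_mono [of "cell u" "i - 1"] assms cell [of u] by linarith
  moreover have "\<not> i \<le> cell u - 1" using w_mono [of i "cell u - 1"] assms cell [of u] by linarith
  ultimately show ?thesis by simp
qed

lemma cell_mono:
  assumes "u \<le> v"
  shows "cell u \<le> cell v"
proof (rule ccontr)
  assume "\<not> ?thesis"
  then have "w (cell v) \<le> w (cell u - 1)" by (intro w_mono) simp
  with cell [of u] cell [of v] assms show False by linarith
qed

lemma cell_shift: "cell (u + of_int k) = cell u + int N * k"
proof (rule cell_eq)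
  show "w (cell u + int N * k - 1) < u + of_int k"
    using cell(1) [of u] w_shift [of "cell u - 1" k] by (simp add: algebra_simps)
  show "u + of_int k \<le> w (cell u + int N * k)"
    using cell(2) [of u] w_shift [of "cell u" k] by simp
qed

lemma continuous_on_cell: "continuous_on (- range w) (\<lambda>u. real_of_int (cell u))"
  unfolding continuous_on_def
proof
  fix u assume "u \<in> - range w"
  then have "u \<noteq> w (cell u)" by blast
  then have "u \<in> {w (cell u - 1)<..<w (cell u)}" using cell [of u] by simp
  then have "eventually (\<lambda>v. v \<in> {w (cell u - 1)<..<w (cell u)}) (at u within - range w)"
    unfolding eventually_at_topological by (intro exI [of _ "{w (cell u - 1)<..<w (cell u)}"]) auto
  then have "eventually (\<lambda>v. real_of_int (cell v) = real_of_int (cell u)) (at u within - range w)"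
  proof eventually_elim
    case (elim v)
    then have "cell v = cell u" by (intro cell_eq) auto
    then show ?case by simp
  qed
  then show "((\<lambda>u. real_of_int (cell u)) \<longlongrightarrow> real_of_int (cell u)) (at u within - range w)"
    by (rule tendsto_eventually)
qed

end

text \<open>All fibres have exactly \<open>N\<close> alternations between \<open>P\<close> and \<open>Q\<close>.\<close>

locale maximal_pair = periodic_pair +
  fixes N :: nat
  assumes N_pos: "N > 0" and ex_chain: "chain N t" and no_longer_chain: "\<not> chain (Suc N) t"
begin

text \<open>A chain with \<open>N\<close> alternations, continued periodically in both directions.\<close>

lemma ex_sequences:
  obtains x y where "\<And>i. (t, x i) \<in> P" "\<And>i. (t, y i) \<in> Q" "\<And>i. x i < y i" "\<And>i. y i < x (i + 1)"
    "\<And>i k. x (i + int N * k) = x i + of_int k" "\<And>i k. y (i + int N * k) = y i + of_int k"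
proof -
  obtain a b where ab: "alternates N t a b" using ex_chain [of t] unfolding chain_def by blast
  define x y where "x = (\<lambda>i. a (nat (i mod int N)) + of_int (i div int N))"
    and "y = (\<lambda>i. b (nat (i mod int N)) + of_int (i div int N))"
  have xy: "x (int N * c + int r) = a r + of_int c" "y (int N * c + int r) = b r + of_int c"
    if "r < N" for c r
    using that by (simp_all add: x_def y_def)
  have split: "\<exists>c r. r < N \<and> i = int N * c + int r" for i
    using N_pos by (intro exI [of _ "i div int N"] exI [of _ "nat (i mod int N)"]) (simp add: nat_less_iff)
  have a: "(t, a r) \<in> P" if "r < N" for r using ab that by (simp add: alternates_def)
  have b: "(t, b r) \<in> Q" if "r < N" for r using ab that by (simp add: alternates_def)
  show thesis
  proof (rule that [of x y])
    fix i k
    obtain c r where i: "r < N" "i = int N * c + int r" using split by blast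
    show "(t, x i) \<in> P" "(t, y i) \<in> Q" "x i < y i"
      unfolding i(2) xy [OF i(1)] P_shift_y Q_shift_y
      using a [OF i(1)] b [OF i(1)] alternates_less(1) [OF ab i(1)] by auto
    show "y i < x (i + 1)"
    proof (cases "Suc r < N")
      case True
      have "i + 1 = int N * c + int (Suc r)" using i(2) by simp
      then have "x (i + 1) = a (Suc r) + of_int c" using xy(1) [OF True, of c] by (simp only:)
      then show ?thesis
        using xy(2) [OF i(1), of c] alternates_less(2) [OF ab i(1)] i(2) by simp
    next
      case False
      then have r: "Suc r = N" using i(1) by simp
      then have "i + 1 = int N * (c + 1) + int 0" using i(2) by (simp add: algebra_simps)
      then have "x (i + 1) = a N + of_int c"
        using xy(1) [OF N_pos, of "c + 1"] ab by (simp add: alternates_def)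
      then show ?thesis
        using xy(2) [OF i(1), of c] alternates_less(2) [OF ab i(1)] i(2) r by simp
    qed
    have "i + int N * k = int N * (c + k) + int r" using i(2) by (simp add: algebra_simps)
    then have "x (i + int N * k) = a r + of_int (c + k)" "y (i + int N * k) = b r + of_int (c + k)"
      using xy [OF i(1), of "c + k"] by (simp_all only:)
    moreover have "x i = a r + of_int c" "y i = b r + of_int c"
      unfolding i(2) by (rule xy [OF i(1)])+
    ultimately show "x (i + int N * k) = x i + of_int k" "y (i + int N * k) = y i + of_int k"
      by simp_all
  qed
qed

text \<open>An index function over a set \<open>I\<close> of base points. Its continuity as a real-valued function says that it is
locally constant.\<close>

definition index_on :: "real set \<Rightarrow> (real \<times> real \<Rightarrow> int) \<Rightarrow> bool"
  where "index_on I \<kappa> \<longleftrightarrow>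
    (\<forall>t\<in>I. \<forall>u. ((t, u) \<in> P \<longrightarrow> even (\<kappa> (t, u))) \<and> ((t, u) \<in> Q \<longrightarrow> odd (\<kappa> (t, u)))) \<and>
    (\<forall>t\<in>I. \<forall>u v. (t, u) \<in> P \<union> Q \<longrightarrow> (t, v) \<in> P \<union> Q \<longrightarrow> u \<le> v \<longrightarrow> \<kappa> (t, u) \<le> \<kappa> (t, v)) \<and>
    (\<forall>t\<in>I. \<forall>u k. (t, u) \<in> P \<union> Q \<longrightarrow> \<kappa> (t, u + of_int k) = \<kappa> (t, u) + 2 * int N * k) \<and>
    continuous_on ((P \<union> Q) \<inter> I \<times> UNIV) (\<lambda>z. real_of_int (\<kappa> z))"

lemma index_on_even: "index_on I \<kappa> \<Longrightarrow> t \<in> I \<Longrightarrow> (t, u) \<in> P \<Longrightarrow> even (\<kappa> (t, u))"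
  and index_on_odd: "index_on I \<kappa> \<Longrightarrow> t \<in> I \<Longrightarrow> (t, u) \<in> Q \<Longrightarrow> odd (\<kappa> (t, u))"
  and index_on_mono: "index_on I \<kappa> \<Longrightarrow> t \<in> I \<Longrightarrow> (t, u) \<in> P \<union> Q \<Longrightarrow> (t, v) \<in> P \<union> Q \<Longrightarrow> u \<le> v \<Longrightarrow>
    \<kappa> (t, u) \<le> \<kappa> (t, v)"
  and index_on_shift: "index_on I \<kappa> \<Longrightarrow> t \<in> I \<Longrightarrow> (t, u) \<in> P \<union> Q \<Longrightarrow>
    \<kappa> (t, u + of_int k) = \<kappa> (t, u) + 2 * int N * k"
  and index_on_continuous: "index_on I \<kappa> \<Longrightarrow> continuous_on ((P \<union> Q) \<inter> I \<times> UNIV) (\<lambda>z. real_of_int (\<kappa> z))"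
  unfolding index_on_def by blast+

lemma index_on_subset: "index_on I \<kappa> \<Longrightarrow> J \<subseteq> I \<Longrightarrow> index_on J \<kappa>"
  unfolding index_on_def by (blast intro: continuous_on_subset)

text \<open>Fix an alternating chain in the fibre over \<open>t0\<close>. The index of a point of \<open>P\<close> counts the points \<open>y i\<close> of the chain
below it, that of a point of \<open>Q\<close> counts the points \<open>x i\<close>. This is locally constant as long as no point of \<open>P\<close> sits
at some \<open>y i\<close> and no point of \<open>Q\<close> at some \<open>x i\<close>. It is increasing along the fibre unless, in some interval from
\<open>y (i - 1)\<close> to \<open>x i\<close>, a point of \<open>P\<close> lies below a point of \<open>Q\<close>, or the analogous event occurs between \<open>x i\<close> and \<open>y i\<close>.
Over \<open>t0\<close> such an event would lengthen the chain, against maximality; and the absence of all these events,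
finitely many up to translation, is an open condition.\<close>

lemma ex_index_on_local: "\<exists>e>0. \<exists>\<kappa>. index_on {t. dist t t0 < e} \<kappa>"
proof -
  obtain x y where x: "\<And>i. (t0, x i) \<in> P" and y: "\<And>i. (t0, y i) \<in> Q"
    and xy: "\<And>i. x i < y i" and yx: "\<And>i. y i < x (i + 1)"
    and x_shift: "\<And>i k. x (i + int N * k) = x i + of_int k" and y_shift: "\<And>i k. y (i + int N * k) = y i + of_int k"
    by (rule ex_sequences [of t0]) blast
  interpret X: periodic_sequence x N
    by standard (use N_pos xy yx x_shift order_less_trans in blast)+
  interpret Y: periodic_sequence y N
    by standard (use N_pos xy yx y_shift order_less_trans in blast)+
  define good where "good = (\<lambda>i t. (t, y i) \<notin> P \<and> (t, x i) \<notin> Q \<and>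
    \<not> (\<exists>z\<in>{y (i - 1)..x i} \<times> {y (i - 1)..x i}. (t, z) \<in> {(t, (u, v)). (t, u) \<in> P \<and> (t, v) \<in> Q \<and> u \<le> v}) \<and>
    \<not> (\<exists>z\<in>{x i..y i} \<times> {x i..y i}. (t, z) \<in> {(t, (u, v)). (t, u) \<in> Q \<and> (t, v) \<in> P \<and> u \<le> v}))"
  have good_iff: "good i t \<longleftrightarrow> (t, y i) \<notin> P \<and> (t, x i) \<notin> Q \<and>
      (\<forall>u v. \<not> ((t, u) \<in> P \<and> (t, v) \<in> Q \<and> y (i - 1) \<le> u \<and> u \<le> v \<and> v \<le> x i)) \<and>
      (\<forall>u v. \<not> ((t, u) \<in> Q \<and> (t, v) \<in> P \<and> x i \<le> u \<and> u \<le> v \<and> v \<le> y i))" for i t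
  proof -
    have "(\<exists>z\<in>{a..b} \<times> {a..b}. (t, z) \<in> {(t, (u, v)). (t, u) \<in> A \<and> (t, v) \<in> B \<and> u \<le> v}) \<longleftrightarrow>
        (\<exists>u v. (t, u) \<in> A \<and> (t, v) \<in> B \<and> a \<le> u \<and> u \<le> v \<and> v \<le> b)" for a b :: real and A B
    proof
      assume "\<exists>u v. (t, u) \<in> A \<and> (t, v) \<in> B \<and> a \<le> u \<and> u \<le> v \<and> v \<le> b"
      then obtain u v where uv: "(t, u) \<in> A" "(t, v) \<in> B" "a \<le> u" "u \<le> v" "v \<le> b" by blast
      then show "\<exists>z\<in>{a..b} \<times> {a..b}. (t, z) \<in> {(t, (u, v)). (t, u) \<in> A \<and> (t, v) \<in> B \<and> u \<le> v}"
        by (intro bexI [of _ "(u, v)"]) auto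
    qed (clarsimp, blast)
    note bounded = this
    show ?thesis unfolding good_def bounded by blast
  qed
  have good_t0: "good i t0" for i
  proof -
    have "\<not> ((t0, u) \<in> P \<and> (t0, v) \<in> Q \<and> y (i - 1) \<le> u \<and> u \<le> v \<and> v \<le> x i)" for u v
    proof
      assume uv: "(t0, u) \<in> P \<and> (t0, v) \<in> Q \<and> y (i - 1) \<le> u \<and> u \<le> v \<and> v \<le> x i"
      \<comment> \<open>Insert \<open>u\<close> and \<open>v\<close> between \<open>y (i - 1)\<close> and \<open>x i\<close>, and start the longer chain at \<open>u\<close>.\<close>
      define a b where "a = (\<lambda>k. if k = 0 then u else if k \<le> N then x (i + int k - 1) else u + 1)"
        and "b = (\<lambda>k. if k = 0 then v else y (i + int k - 1))"
      have "(t0, u + 1) \<in> P" using uv P_shift_y [of t0 u 1] by simp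
      then have 1: "(t0, a k) \<in> P" "(t0, b k) \<in> Q" for k using uv x y by (auto simp: a_def b_def)
      have 2: "a k \<le> b k" "b k \<le> a (Suc k)" if "k < Suc N" for k
      proof -
        have "y (i + int N - 1) = y (i - 1) + 1" using y_shift [of "i - 1" 1] by (simp add: algebra_simps)
        then show "a k \<le> b k" "b k \<le> a (Suc k)"
          using uv that xy [of "i + int k - 1"] yx [of "i + int k - 1"] N_pos
          by (cases "k = 0"; cases "k = N"; force simp: a_def b_def)+
      qed
      have "a (Suc N) = a 0 + 1" by (simp add: a_def)
      with 1 2 have "alternates (Suc N) t0 a b" by (simp add: alternates_def)
      then have "chain (Suc N) t0" unfolding chain_def by blast
      then show False using no_longer_chain by blast
    qed
    moreover have "\<not> ((t0, u) \<in> Q \<and> (t0, v) \<in> P \<and> x i \<le> u \<and> u \<le> v \<and> v \<le> y i)" for u v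
    proof
      assume uv: "(t0, u) \<in> Q \<and> (t0, v) \<in> P \<and> x i \<le> u \<and> u \<le> v \<and> v \<le> y i"
      \<comment> \<open>Insert \<open>u\<close> and \<open>v\<close> between \<open>x i\<close> and \<open>y i\<close>; the longer chain starts at \<open>v\<close>, which lies in \<open>P\<close>.\<close>
      define a b where "a = (\<lambda>k. if k = 0 then v else if k \<le> N then x (i + int k) else v + 1)"
        and "b = (\<lambda>k. if k < N then y (i + int k) else u + 1)"
      have "(t0, v + 1) \<in> P" "(t0, u + 1) \<in> Q" using uv P_shift_y [of t0 v 1] Q_shift_y [of t0 u 1] by simp_all
      then have 1: "(t0, a k) \<in> P" "(t0, b k) \<in> Q" for k using uv x y by (auto simp: a_def b_def)
      have 2: "a k \<le> b k" "b k \<le> a (Suc k)" if "k < Suc N" for k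
      proof -
        have "x (i + int N) = x i + 1" using x_shift [of i 1] by simp
        moreover have "y (i + int k) < x (i + int (Suc k))" using yx [of "i + int k"] by (simp add: ac_simps)
        ultimately show "a k \<le> b k" "b k \<le> a (Suc k)"
          using uv that xy [of "i + int k"] N_pos
          by (cases "k = 0"; cases "k = N"; force simp: a_def b_def)+
      qed
      have "a (Suc N) = a 0 + 1" by (simp add: a_def)
      with 1 2 have "alternates (Suc N) t0 a b" by (simp add: alternates_def)
      then have "chain (Suc N) t0" unfolding chain_def by blast
      then show False using no_longer_chain by blast
    qed
    moreover have "(t0, y i) \<notin> P" "(t0, x i) \<notin> Q" using x y disjoint by blast+
    ultimately show ?thesis unfolding good_iff by blast
  qed
  have "open {t. good i t}" for i
  proof -
    have "closed {(t, (u, v)). (t, u) \<in> P \<and> (t, v) \<in> Q \<and> u \<le> v}"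
      "closed {(t, (u, v)). (t, u) \<in> Q \<and> (t, v) \<in> P \<and> u \<le> v}"
      unfolding case_prod_unfold
      by (intro closed_Collect_conj closed_vimage [unfolded vimage_def, OF closed_P]
          closed_vimage [unfolded vimage_def, OF closed_Q] closed_Collect_le continuous_intros)+
    note this [THEN closed_projection_along_compact [OF compact_Times [OF compact_Icc compact_Icc]]]
    moreover have "closed {t. (t, y i) \<in> P}" "closed {t. (t, x i) \<in> Q}"
      by (intro closed_vimage [unfolded vimage_def, OF closed_P]
          closed_vimage [unfolded vimage_def, OF closed_Q] continuous_intros)+
    ultimately show ?thesis
      unfolding good_def by (intro open_Collect_conj open_Collect_neg)
  qed
  then have "\<forall>i\<in>{0..<int N}. eventually (good i) (nhds t0)"
    using good_t0 by (auto simp: eventually_nhds)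
  then have "eventually (\<lambda>t. \<forall>i\<in>{0..<int N}. good i t) (nhds t0)"
    by (rule eventually_ball_finite [OF finite_atLeastLessThan_int])
  then obtain e where e: "e > 0" "\<And>t i. dist t t0 < e \<Longrightarrow> i \<in> {0..<int N} \<Longrightarrow> good i t"
    unfolding eventually_nhds_metric by blast
  have good_all: "good i t" if "dist t t0 < e" for i t
  proof -
    define c r where "c = i div int N" and "r = i mod int N"
    have i: "i = r + int N * c" and i1: "i - 1 = r - 1 + int N * c" by (simp_all add: c_def r_def)
    have shifted: "x i = x r + of_int c" "y i = y r + of_int c" "y (i - 1) = y (r - 1) + of_int c"
      by (simp_all only: i x_shift y_shift) (simp only: i1 [unfolded i] y_shift)
    have "good r t" using e(2) [OF that] N_pos by (simp add: r_def)
    have "\<not> ((t, u) \<in> P \<and> (t, v) \<in> Q \<and> y (i - 1) \<le> u \<and> u \<le> v \<and> v \<le> x i)" for u v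
    proof
      assume uv: "(t, u) \<in> P \<and> (t, v) \<in> Q \<and> y (i - 1) \<le> u \<and> u \<le> v \<and> v \<le> x i"
      then have "y (r - 1) \<le> u - of_int c" "u - of_int c \<le> v - of_int c" "v - of_int c \<le> x r"
        unfolding shifted by auto
      moreover have "(t, u - of_int c) \<in> P" "(t, v - of_int c) \<in> Q"
        using uv P_shift_y [of t u "- c"] Q_shift_y [of t v "- c"] by simp_all
      ultimately show False using \<open>good r t\<close> unfolding good_iff by blast
    qed
    moreover have "\<not> ((t, u) \<in> Q \<and> (t, v) \<in> P \<and> x i \<le> u \<and> u \<le> v \<and> v \<le> y i)" for u v
    proof
      assume uv: "(t, u) \<in> Q \<and> (t, v) \<in> P \<and> x i \<le> u \<and> u \<le> v \<and> v \<le> y i"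
      then have "x r \<le> u - of_int c" "u - of_int c \<le> v - of_int c" "v - of_int c \<le> y r"
        unfolding shifted by auto
      moreover have "(t, u - of_int c) \<in> Q" "(t, v - of_int c) \<in> P"
        using uv Q_shift_y [of t u "- c"] P_shift_y [of t v "- c"] by simp_all
      ultimately show False using \<open>good r t\<close> unfolding good_iff by blast
    qed
    moreover have "(t, y i) \<notin> P" "(t, x i) \<notin> Q"
      using \<open>good r t\<close> unfolding shifted P_shift_y Q_shift_y good_iff by blast+
    ultimately show ?thesis unfolding good_iff by blast
  qed
  define I where "I = {t. dist t t0 < e}"
  have PQ: "\<not> v \<le> x i" if "t \<in> I" "(t, u) \<in> P" "(t, v) \<in> Q" "y (i - 1) \<le> u" "u \<le> v" for t u v i
    using good_all [of t i] that unfolding I_def good_iff by blast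
  have QP: "\<not> v \<le> y i" if "t \<in> I" "(t, u) \<in> Q" "(t, v) \<in> P" "x i \<le> u" "u \<le> v" for t u v i
    using good_all [of t i] that unfolding I_def good_iff by blast
  define \<kappa> where "\<kappa> = (\<lambda>z. if z \<in> P then 2 * Y.cell (snd z) else 2 * X.cell (snd z) - 1)"
  have \<kappa>P: "\<kappa> (t, u) = 2 * Y.cell u" if "(t, u) \<in> P" for t u using that by (simp add: \<kappa>_def)
  have \<kappa>Q: "\<kappa> (t, u) = 2 * X.cell u - 1" if "(t, u) \<in> Q" for t u using that disjoint by (auto simp: \<kappa>_def)
  have "index_on I \<kappa>"
    unfolding index_on_def
  proof (intro conjI ballI allI impI)
    fix t u assume "t \<in> I"
    show "even (\<kappa> (t, u))" if "(t, u) \<in> P" using \<kappa>P [OF that] by simp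
    show "odd (\<kappa> (t, u))" if "(t, u) \<in> Q" using \<kappa>Q [OF that] by simp
    show "\<kappa> (t, u) \<le> \<kappa> (t, v)" if uv: "(t, u) \<in> P \<union> Q" "(t, v) \<in> P \<union> Q" "u \<le> v" for v
    proof -
      consider "(t, u) \<in> P" "(t, v) \<in> P" | "(t, u) \<in> Q" "(t, v) \<in> Q" | "(t, u) \<in> P" "(t, v) \<in> Q"
        | "(t, u) \<in> Q" "(t, v) \<in> P" using uv by blast
      then show ?thesis
      proof cases
        case 3
        have "\<not> v \<le> x (Y.cell u)" using PQ [OF \<open>t \<in> I\<close> 3] Y.cell(1) [of u] uv(3) by simp
        then have "\<not> X.cell v \<le> Y.cell u" using X.cell(2) [of v] X.w_mono by (meson order_trans)
        then show ?thesis using 3 by (simp add: \<kappa>P \<kappa>Q)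
      next
        case 4
        have "\<not> v \<le> y (X.cell u - 1)" using QP [OF \<open>t \<in> I\<close> 4] X.cell(1) [of u] uv(3) by simp
        then have "\<not> Y.cell v \<le> X.cell u - 1" using Y.cell(2) [of v] Y.w_mono by (meson order_trans)
        then show ?thesis using 4 by (simp add: \<kappa>P \<kappa>Q)
      qed (use X.cell_mono [OF uv(3)] Y.cell_mono [OF uv(3)] in \<open>simp_all add: \<kappa>P \<kappa>Q\<close>)
    qed
    show "\<kappa> (t, u + of_int k) = \<kappa> (t, u) + 2 * int N * k" if "(t, u) \<in> P \<union> Q" for k
      using that
    proof
      assume "(t, u) \<in> P"
      then show ?thesis using P_shift_y [of t u k] by (simp add: \<kappa>P Y.cell_shift)
    next
      assume "(t, u) \<in> Q"
      then show ?thesis using Q_shift_y [of t u k] by (simp add: \<kappa>Q X.cell_shift)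
    qed
  next
    have "continuous_on (P \<inter> I \<times> UNIV) (\<lambda>z. real_of_int (\<kappa> z))"
    proof -
      have "continuous_on (P \<inter> I \<times> UNIV) (\<lambda>z. 2 * real_of_int (Y.cell (snd z)))"
      proof (intro continuous_on_mult continuous_on_const continuous_on_compose2 [OF Y.continuous_on_cell]
          continuous_on_snd continuous_on_id)
        show "snd ` (P \<inter> I \<times> UNIV) \<subseteq> - range y"
          using good_all by (auto simp: good_iff I_def)
      qed
      then show ?thesis by (rule continuous_on_eq) (auto simp: \<kappa>P)
    qed
    moreover have "continuous_on (Q \<inter> I \<times> UNIV) (\<lambda>z. real_of_int (\<kappa> z))"
    proof -
      have "continuous_on (Q \<inter> I \<times> UNIV) (\<lambda>z. 2 * real_of_int (X.cell (snd z)) - 1)"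
      proof (intro continuous_on_diff continuous_on_mult continuous_on_const continuous_on_compose2 [OF X.continuous_on_cell]
          continuous_on_snd continuous_on_id)
        show "snd ` (Q \<inter> I \<times> UNIV) \<subseteq> - range x"
          using good_all by (auto simp: good_iff I_def)
      qed
      then show ?thesis by (rule continuous_on_eq) (auto simp: \<kappa>Q)
    qed
    ultimately have "continuous_on (P \<inter> I \<times> UNIV \<union> Q \<inter> I \<times> UNIV) (\<lambda>z. real_of_int (\<kappa> z))"
    proof (intro continuous_on_Un_local)
      show "closedin (top_of_set (P \<inter> I \<times> UNIV \<union> Q \<inter> I \<times> UNIV)) (P \<inter> I \<times> UNIV)"
        unfolding closedin_closed by (rule exI [of _ P]) (use closed_P disjoint in auto)
      show "closedin (top_of_set (P \<inter> I \<times> UNIV \<union> Q \<inter> I \<times> UNIV)) (Q \<inter> I \<times> UNIV)"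
        unfolding closedin_closed by (rule exI [of _ Q]) (use closed_Q disjoint in auto)
    qed
    then show "continuous_on ((P \<union> Q) \<inter> I \<times> UNIV) (\<lambda>z. real_of_int (\<kappa> z))"
      by (simp add: Int_Un_distrib2)
  qed
  then show ?thesis using e(1) unfolding I_def by blast
qed


text \<open>Along a chain the parity changes at each step, so the index rises by at least one in each of the \<open>2 N\<close> steps.
Altogether it rises by \<open>2 N\<close>, so each step is exactly one.\<close>

lemma index_on_alternates:
  assumes idx: "index_on I \<kappa>" "t \<in> I" and xy: "alternates N t x y" and "i < N"
  shows "\<kappa> (t, x i) = \<kappa> (t, x 0) + 2 * int i" "\<kappa> (t, y i) = \<kappa> (t, x 0) + 2 * int i + 1"
    "\<kappa> (t, x (Suc i)) = \<kappa> (t, x 0) + 2 * int i + 2"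
proof -
  have P: "(t, x i) \<in> P" if "i \<le> N" for i using xy that by (simp add: alternates_def)
  have Q: "(t, y i) \<in> Q" if "i < N" for i using xy that by (simp add: alternates_def)
  have step: "\<kappa> (t, x i) < \<kappa> (t, y i)" "\<kappa> (t, y i) < \<kappa> (t, x (Suc i))" if i: "i < N" for i
  proof -
    have "\<kappa> (t, x i) \<le> \<kappa> (t, y i)" "\<kappa> (t, y i) \<le> \<kappa> (t, x (Suc i))"
      using i P [of i] Q [of i] P [of "Suc i"] alternates_less [OF xy i]
      by (auto intro!: index_on_mono [OF idx])
    moreover have "even (\<kappa> (t, x i))" "odd (\<kappa> (t, y i))" "even (\<kappa> (t, x (Suc i)))"
      using i P [of i] Q [of i] P [of "Suc i"] index_on_even [OF idx] index_on_odd [OF idx] by auto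
    ultimately show "\<kappa> (t, x i) < \<kappa> (t, y i)" "\<kappa> (t, y i) < \<kappa> (t, x (Suc i))"
      by (metis order_le_less)+
  qed
  have mono: "\<kappa> (t, x i) + 2 * (int j - int i) \<le> \<kappa> (t, x j)" if "i \<le> j" "j \<le> N" for i j
    using that
  proof (induction j rule: dec_induct)
    case (step j)
    then show ?case using \<open>\<And>i. i < N \<Longrightarrow> \<kappa> (t, x i) < \<kappa> (t, y i)\<close> [of j]
        \<open>\<And>i. i < N \<Longrightarrow> \<kappa> (t, y i) < \<kappa> (t, x (Suc i))\<close> [of j] by simp
  qed simp
  have "x N = x 0 + of_int 1" using xy by (simp add: alternates_def)
  then have "\<kappa> (t, x N) = \<kappa> (t, x 0) + 2 * int N"
    using index_on_shift [OF idx, of "x 0" 1] P [of 0] by simp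
  then have eq: "\<kappa> (t, x i) = \<kappa> (t, x 0) + 2 * int i" if "i \<le> N" for i
    using mono [of 0 i] mono [of i N] that by simp
  show "\<kappa> (t, x i) = \<kappa> (t, x 0) + 2 * int i" "\<kappa> (t, y i) = \<kappa> (t, x 0) + 2 * int i + 1"
    "\<kappa> (t, x (Suc i)) = \<kappa> (t, x 0) + 2 * int i + 2"
    using eq [of i] eq [of "Suc i"] step [of i] \<open>i < N\<close> by simp_all
qed

lemma index_on_surj:
  assumes idx: "index_on I \<kappa>" "t \<in> I"
  shows "\<exists>u. (t, u) \<in> P \<union> Q \<and> \<kappa> (t, u) = j"
proof -
  obtain x y where xy: "alternates N t x y" using ex_chain [of t] unfolding chain_def by blast
  define c where "c = \<kappa> (t, x 0)"
  define k r where "k = (j - c) div (2 * int N)" and "r = (j - c) mod (2 * int N)"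
  have r: "0 \<le> r" "r < 2 * int N" using N_pos by (simp_all add: r_def)
  have j: "j = c + r + 2 * int N * k"
    using mult_div_mod_eq [of "2 * int N" "j - c"] unfolding k_def r_def by linarith
  define i where "i = nat (r div 2)"
  have i: "i < N" "int i = r div 2" using r by (simp_all add: i_def)
  have "\<exists>u. (t, u) \<in> P \<union> Q \<and> \<kappa> (t, u) = c + r"
  proof (cases "even r")
    case True
    then have "r = 2 * int i" using i(2) by simp
    moreover have "(t, x i) \<in> P" using xy i(1) by (simp add: alternates_def)
    ultimately show ?thesis using index_on_alternates(1) [OF idx xy i(1)] by (auto simp: c_def)
  next
    case False
    then have "r = 2 * int i + 1" using i(2) by presburger
    moreover have "(t, y i) \<in> Q" using xy i(1) by (simp add: alternates_def)
    ultimately show ?thesis using index_on_alternates(2) [OF idx xy i(1)] by (auto simp: c_def)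
  qed
  then obtain u where u: "(t, u) \<in> P \<union> Q" "\<kappa> (t, u) = c + r" by blast
  then have "(t, u + of_int k) \<in> P \<union> Q" using P_shift_y Q_shift_y by blast
  moreover have "\<kappa> (t, u + of_int k) = j" using index_on_shift [OF idx u(1)] u(2) j by simp
  ultimately show ?thesis by blast
qed

text \<open>The index of every point is determined by its parity, by its position relative to a fixed chain, and by the
index of the first point of that chain.\<close>

lemma index_on_unique:
  assumes idx: "index_on I \<kappa>" "t \<in> I" and idx': "index_on J \<kappa>'" "t \<in> J"
  shows "\<exists>D. \<forall>u. (t, u) \<in> P \<union> Q \<longrightarrow> \<kappa>' (t, u) = \<kappa> (t, u) + 2 * D"
proof -
  obtain x y where xy: "alternates N t x y" using ex_chain [of t] unfolding chain_def by blast
  have P: "(t, x i) \<in> P" if "i \<le> N" for i using xy that by (simp add: alternates_def)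
  have Q: "(t, y i) \<in> Q" if "i < N" for i using xy that by (simp add: alternates_def)
  have "even (\<kappa>' (t, x 0) - \<kappa> (t, x 0))"
    using index_on_even [OF idx P] index_on_even [OF idx' P] by simp
  then obtain D where D: "\<kappa>' (t, x 0) = \<kappa> (t, x 0) + 2 * D"
    by (metis add.commute diff_add_cancel dvdE)
  have val: "\<kappa> (t, u) = \<kappa> (t, x 0) + 2 * int i +
      (if (t, u) \<in> Q then 1 else if u \<le> y i then 0 else 2)"
    if idx: "index_on I \<kappa>" "t \<in> I" and u: "(t, u) \<in> P \<union> Q" and i: "i < N" "x i \<le> u" "u \<le> x (Suc i)"
    for u i \<kappa> I
  proof -
    note vals = index_on_alternates [OF idx xy i(1)]
    have PQ: "(t, x i) \<in> P \<union> Q" "(t, x (Suc i)) \<in> P \<union> Q" "(t, y i) \<in> P \<union> Q"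
      using P [of i] P [of "Suc i"] Q [of i] i(1) by auto
    have lo: "\<kappa> (t, x 0) + 2 * int i \<le> \<kappa> (t, u)" and hi: "\<kappa> (t, u) \<le> \<kappa> (t, x 0) + 2 * int i + 2"
      using index_on_mono [OF idx PQ(1) u i(2)] index_on_mono [OF idx u PQ(2) i(3)] vals by simp_all
    have even: "even (\<kappa> (t, x 0))" using index_on_even [OF idx P] by simp
    show ?thesis
    proof (cases "(t, u) \<in> Q")
      case True
      then have "odd (\<kappa> (t, u))" by (rule index_on_odd [OF idx])
      with even lo hi True show ?thesis by simp presburger
    next
      case False
      then have ev: "even (\<kappa> (t, u))" using u index_on_even [OF idx] by blast
      show ?thesis
      proof (cases "u \<le> y i")
        case True
        have "\<kappa> (t, u) \<le> \<kappa> (t, x 0) + 2 * int i + 1"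
          using index_on_mono [OF idx u PQ(3) True] vals by simp
        with even lo ev True False show ?thesis by simp presburger
      next
        case False
        then have "\<kappa> (t, x 0) + 2 * int i + 1 \<le> \<kappa> (t, u)"
          using index_on_mono [OF idx PQ(3) u] vals by simp
        with even hi ev False \<open>(t, u) \<notin> Q\<close> show ?thesis by simp presburger
      qed
    qed
  qed
  have "\<kappa>' (t, u) = \<kappa> (t, u) + 2 * D" if u: "(t, u) \<in> P \<union> Q" for u
  proof -
    define k where "k = - \<lfloor>u - x 0\<rfloor>"
    define v where "v = u + of_int k"
    have v: "(t, v) \<in> P \<union> Q" using u P_shift_y Q_shift_y by (auto simp: v_def)
    have "x 0 \<le> v" "v < x N"
      using xy unfolding v_def k_def alternates_def by (simp_all, linarith+)
    define i where "i = (LEAST i. v < x (Suc i))"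
    obtain n where n: "N = Suc n" using N_pos by (cases N) auto
    have vi: "v < x (Suc i)" and "i \<le> n"
      unfolding i_def using \<open>v < x N\<close> n by (auto intro: LeastI [of "\<lambda>i. v < x (Suc i)" n] Least_le)
    have "x i \<le> v"
    proof (cases i)
      case (Suc i')
      then have "\<not> v < x (Suc i')" unfolding i_def using not_less_Least by (metis i_def lessI)
      then show ?thesis using Suc by simp
    qed (use \<open>x 0 \<le> v\<close> in simp)
    have iN: "i < N" using \<open>i \<le> n\<close> n by simp
    have "\<kappa>' (t, v) = \<kappa> (t, v) + 2 * D"
      using val [OF idx v iN \<open>x i \<le> v\<close>] val [OF idx' v iN \<open>x i \<le> v\<close>] vi D by simp
    then show ?thesis
      using index_on_shift [OF idx u, of k] index_on_shift [OF idx' u, of k] by (simp add: v_def)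
  qed
  then show ?thesis by blast
qed

text \<open>The second index function is corrected by the constant by which it differs from the first one over \<open>b\<close>.\<close>

lemma index_on_glue:
  assumes "index_on {a..b} \<kappa>" "index_on {b..c} \<kappa>'" "a \<le> b" "b \<le> c"
  shows "\<exists>\<kappa>. index_on {a..c} \<kappa>"
proof -
  obtain D where D: "\<And>u. (b, u) \<in> P \<union> Q \<Longrightarrow> \<kappa>' (b, u) = \<kappa> (b, u) + 2 * D"
    using index_on_unique [OF assms(1) _ assms(2), of b] assms(3,4) by auto
  define K where "K = (\<lambda>z. if fst z \<le> b then \<kappa> z else \<kappa>' z - 2 * D)"
  have K1: "K (t, u) = \<kappa> (t, u)" if "t \<le> b" for t u using that by (simp add: K_def)
  have K2: "K (t, u) = \<kappa>' (t, u) - 2 * D" if "b \<le> t" "(t, u) \<in> P \<union> Q" for t u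
    using that D [of u] by (cases "t = b") (simp_all add: K_def)
  have shiftPQ: "(t, u + of_int k) \<in> P \<union> Q \<longleftrightarrow> (t, u) \<in> P \<union> Q" for t u k
    by (simp add: P_shift_y Q_shift_y)
  have "index_on {a..c} K"
    unfolding index_on_def
  proof (intro conjI ballI allI impI)
    fix t u assume t: "t \<in> {a..c}"
    show "even (K (t, u))" if "(t, u) \<in> P"
    proof (cases "t \<le> b")
      case True then show ?thesis using t that index_on_even [OF assms(1)] by (simp add: K1)
    next
      case False then show ?thesis using t that index_on_even [OF assms(2)] by (simp add: K2)
    qed
    show "odd (K (t, u))" if "(t, u) \<in> Q"
    proof (cases "t \<le> b")
      case True then show ?thesis using t that index_on_odd [OF assms(1)] by (simp add: K1)
    next
      case False then show ?thesis using t that index_on_odd [OF assms(2)] by (simp add: K2)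
    qed
    show "K (t, u) \<le> K (t, v)" if "(t, u) \<in> P \<union> Q" "(t, v) \<in> P \<union> Q" "u \<le> v" for v
    proof (cases "t \<le> b")
      case True then show ?thesis using t that index_on_mono [OF assms(1) _ that] by (simp add: K1)
    next
      case False then show ?thesis using t that index_on_mono [OF assms(2) _ that] by (simp add: K2)
    qed
    show "K (t, u + of_int k) = K (t, u) + 2 * int N * k" if "(t, u) \<in> P \<union> Q" for k
    proof (cases "t \<le> b")
      case True then show ?thesis using t index_on_shift [OF assms(1) _ that] by (simp add: K1)
    next
      case False
      then show ?thesis
        using t index_on_shift [OF assms(2) _ that] K2 [of t u] K2 [of t "u + of_int k"] that shiftPQ by simp
    qed
  next
    let ?A = "(P \<union> Q) \<inter> {a..b} \<times> UNIV" and ?B = "(P \<union> Q) \<inter> {b..c} \<times> UNIV"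
    have "continuous_on ?A (\<lambda>z. real_of_int (K z))"
      by (rule continuous_on_eq [OF index_on_continuous [OF assms(1)]]) (auto simp: K1)
    moreover have "continuous_on ?B (\<lambda>z. real_of_int (K z))"
    proof (rule continuous_on_eq)
      show "continuous_on ?B (\<lambda>z. real_of_int (\<kappa>' z) - of_int (2 * D))"
        by (intro continuous_on_diff continuous_on_const index_on_continuous [OF assms(2)])
      show "real_of_int (\<kappa>' z) - of_int (2 * D) = real_of_int (K z)" if "z \<in> ?B" for z
        using that K2 [of "fst z" "snd z"] by (cases z) auto
    qed
    ultimately have "continuous_on (?A \<union> ?B) (\<lambda>z. real_of_int (K z))"
    proof (intro continuous_on_Un_local)
      have "closed ({a..b} \<times> (UNIV :: real set))" "closed ({b..c} \<times> (UNIV :: real set))"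
        by (intro closed_Times closed_atLeastAtMost closed_UNIV)+
      moreover have "?A = (?A \<union> ?B) \<inter> {a..b} \<times> UNIV" "?B = (?A \<union> ?B) \<inter> {b..c} \<times> UNIV" by auto
      ultimately show "closedin (top_of_set (?A \<union> ?B)) ?A" "closedin (top_of_set (?A \<union> ?B)) ?B"
        unfolding closedin_closed by blast+
    qed
    moreover have "?A \<union> ?B = (P \<union> Q) \<inter> {a..c} \<times> UNIV" using assms(3,4) by auto
    ultimately show "continuous_on ((P \<union> Q) \<inter> {a..c} \<times> UNIV) (\<lambda>z. real_of_int (K z))" by simp
  qed
  then show ?thesis by blast
qed

lemma ex_index_on_Icc: "\<exists>\<kappa>. index_on {0..1} \<kappa>"
proof (rule Bolzano [of 0 1 "\<lambda>a b. \<exists>\<kappa>. index_on {a..b} \<kappa>"])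
  show "\<exists>\<kappa>. index_on {a..c} \<kappa>" if "\<exists>\<kappa>. index_on {a..b} \<kappa>" "\<exists>\<kappa>. index_on {b..c} \<kappa>" "a \<le> b" "b \<le> c" for a b c
    using that index_on_glue by blast
  show "\<exists>e>0. \<forall>a b. a \<le> t \<and> t \<le> b \<and> b - a < e \<longrightarrow> (\<exists>\<kappa>. index_on {a..b} \<kappa>)" for t
  proof -
    obtain e \<kappa> where e: "e > 0" "index_on {s. dist s t < e} \<kappa>" using ex_index_on_local by blast
    have "index_on {a..b} \<kappa>" if "a \<le> t" "t \<le> b" "b - a < e" for a b
      by (rule index_on_subset [OF e(2)]) (use that in \<open>auto simp: dist_real_def\<close>)
    with e(1) show ?thesis by blast
  qed
qed simp

text \<open>The index functions over \<open>0\<close> and over \<open>1\<close> belong to the same fibre of the torus and hence differ by a constant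
\<open>2 D\<close>. This monodromy is added once for each turn to extend an index function from \<open>[0, 1]\<close> to the line.\<close>

theorem ex_indexed_set:
  "\<exists>\<kappa> d. indexed_set (P \<union> Q) \<kappa> N d \<and> (\<forall>z\<in>P. even (\<kappa> z)) \<and> (\<forall>z\<in>Q. odd (\<kappa> z))"
proof -
  obtain \<kappa> where \<kappa>: "index_on {0..1} \<kappa>" using ex_index_on_Icc by blast
  have PQ_shift: "(t + of_int m, u + of_int k) \<in> P \<union> Q \<longleftrightarrow> (t, u) \<in> P \<union> Q" for t m u k
    by (simp add: P_shift Q_shift)
  have P_01: "(1, u) \<in> P \<longleftrightarrow> (0, u) \<in> P" and Q_01: "(1, u) \<in> Q \<longleftrightarrow> (0, u) \<in> Q" for u
    using P_shift [of 0 1 u 0] Q_shift [of 0 1 u 0] by simp_all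
  have "index_on {0} (\<lambda>z. \<kappa> (1, snd z))"
    unfolding index_on_def
  proof (intro conjI ballI allI impI)
    have "continuous_on ((P \<union> Q) \<inter> {0} \<times> UNIV) (\<lambda>z. real_of_int (\<kappa> (1, snd z)))"
      by (intro continuous_on_compose2 [OF index_on_continuous [OF \<kappa>]] continuous_intros)
        (auto simp: P_01 Q_01)
    then show "continuous_on ((P \<union> Q) \<inter> {0} \<times> UNIV) (\<lambda>z. real_of_int (\<kappa> (1, snd z)))" .
  qed (use \<kappa> in \<open>auto simp: P_01 [symmetric] Q_01 [symmetric] index_on_even index_on_odd index_on_shift
      intro: index_on_mono\<close>)
  then obtain D where D: "\<And>u. (0, u) \<in> P \<union> Q \<Longrightarrow> \<kappa> (1, u) = \<kappa> (0, u) + 2 * D"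
    using index_on_unique [OF \<kappa>, of 0 "{0}" "\<lambda>z. \<kappa> (1, snd z)"] by auto
  define K where "K = (\<lambda>z. \<kappa> (frac (fst z), snd z) + 2 * D * \<lfloor>fst z\<rfloor>)"
  have frac01: "frac t \<in> {0..1}" for t :: real using frac_lt_1 [of t] by simp
  have frac_PQ: "(frac t, u) \<in> P \<longleftrightarrow> (t, u) \<in> P" "(frac t, u) \<in> Q \<longleftrightarrow> (t, u) \<in> Q" for t u
    using P_shift [of "frac t" "\<lfloor>t\<rfloor>" u 0] Q_shift [of "frac t" "\<lfloor>t\<rfloor>" u 0] by (simp_all add: frac_def)
  have "indexed_set (P \<union> Q) K N D"
  proof
    show "N > 0" by (rule N_pos)
    show "closed (P \<union> Q)" by (intro closed_Un closed_P closed_Q)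
    show "(t + of_int m, u + of_int k) \<in> P \<union> Q \<longleftrightarrow> (t, u) \<in> P \<union> Q" for t m u k by (rule PQ_shift)
    show "K (t + of_int m, u + of_int k) = K (t, u) + 2 * (D * m + int N * k)"
      if "(t, u) \<in> P \<union> Q" for t u m k
    proof -
      have "(frac t, u) \<in> P \<union> Q" using that frac_PQ by blast
      then show ?thesis
        using index_on_shift [OF \<kappa> frac01, of t u k] by (simp add: K_def algebra_simps)
    qed
    show "K (t, u) \<le> K (t, v)" if "(t, u) \<in> P \<union> Q" "(t, v) \<in> P \<union> Q" "u \<le> v" for t u v
      using index_on_mono [OF \<kappa> frac01, of t u v] that frac_PQ by (simp add: K_def)
    show "\<exists>u. (t, u) \<in> P \<union> Q \<and> K (t, u) = j" for t j
      using index_on_surj [OF \<kappa> frac01, of t "j - 2 * D * \<lfloor>t\<rfloor>"] frac_PQ by (fastforce simp: K_def)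
    show "continuous_on (P \<union> Q) (\<lambda>z. real_of_int (K z))"
    proof (rule continuous_on_integer_strips [where p = fst])
      fix n :: int
      let ?S = "(P \<union> Q) \<inter> fst -` {of_int n..of_int n + 1}"
      have inPQ: "(t - of_int n, u) \<in> P \<union> Q" if "(t, u) \<in> P \<union> Q" for t u
        using that PQ_shift [of t "- n" u 0] by simp
      have "(\<lambda>z. (fst z - of_int n, snd z)) ` ?S \<subseteq> (P \<union> Q) \<inter> {0..1} \<times> UNIV"
      proof (rule image_subsetI)
        fix z assume "z \<in> ?S"
        then show "(fst z - of_int n, snd z) \<in> (P \<union> Q) \<inter> {0..1} \<times> UNIV"
          using inPQ [of "fst z" "snd z"] by (simp add: algebra_simps)
      qed
      then have "continuous_on ?S (\<lambda>z. real_of_int (\<kappa> (fst z - of_int n, snd z)) + of_int (2 * D * n))"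
        by (intro continuous_on_add continuous_on_const continuous_on_compose2 [OF index_on_continuous [OF \<kappa>]]
            continuous_on_Pair continuous_on_diff continuous_on_fst continuous_on_snd continuous_on_id)
      then show "continuous_on ?S (\<lambda>z. real_of_int (K z))"
      proof (rule continuous_on_eq)
        fix z assume z: "z \<in> ?S"
        obtain t u where tu: "z = (t, u)" by (cases z)
        have "K (t, u) = \<kappa> (t - of_int n, u) + 2 * D * n"
        \<comment> \<open>At the right end of the strip the floor jumps, and the monodromy compensates for this.\<close>
        proof (cases "t = of_int n + 1")
          case True
          then have "\<lfloor>t\<rfloor> = n + 1" "frac t = 0" "t - of_int n = 1" by simp_all
          moreover have "(0, u) \<in> P \<union> Q"
            using z tu frac_PQ [of t u] unfolding \<open>frac t = 0\<close> by blast
          ultimately show ?thesis using D [of u] by (simp add: K_def algebra_simps)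
        next
          case False
          then have "\<lfloor>t\<rfloor> = n" using z tu by (auto simp: floor_eq_iff)
          then show ?thesis by (simp add: K_def frac_def)
        qed
        then show "real_of_int (\<kappa> (fst z - of_int n, snd z)) + of_int (2 * D * n) = real_of_int (K z)"
          using tu by simp
      qed
    qed (intro continuous_intros)
  qed
  moreover have "even (K z)" if "z \<in> P" for z
    using that index_on_even [OF \<kappa> frac01] frac_PQ by (cases z) (simp add: K_def)
  moreover have "odd (K z)" if "z \<in> Q" for z
    using that index_on_odd [OF \<kappa> frac01] frac_PQ by (cases z) (simp add: K_def)
  ultimately show ?thesis by blast
qed

end

section \<open>Alternation numbers of disjoint invariant sets\<close>

locale forced_homeo =
  fixes f g :: "circle \<times> circle \<Rightarrow> circle \<times> circle" and \<omega> :: real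
  assumes f_cont: "continuous_on UNIV f" and g_cont: "continuous_on UNIV g"
    and gf: "g (f z) = z" and fg: "f (g z) = z"
    and irrational: "\<omega> \<notin> \<rat>" and fst_f: "fst (f z) = fst z + to_circle \<omega>"
begin

lemma fst_g: "fst (g z) = fst z - to_circle \<omega>"
  using fst_f [of "g z"] by (simp add: fg)

lemma bij_f: "bij f"
  by (rule o_bij [of g]) (simp_all add: fun_eq_iff gf fg)

lemma inj_f: "inj f"
  by (rule bij_is_inj [OF bij_f])

lemma connected_images: "connected S \<Longrightarrow> connected (f ` S)" "connected S \<Longrightarrow> connected (g ` S)"
  using connected_continuous_image [OF continuous_on_subset [OF f_cont subset_UNIV]]
    connected_continuous_image [OF continuous_on_subset [OF g_cont subset_UNIV]] by simp_all

lemma g_image: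
  assumes "f ` M = M"
  shows "g ` M = M"
proof -
  have "g ` f ` M = M" by (simp add: image_image gf)
  then show ?thesis using assms by simp
qed

lemma invariant_projection:
  assumes "compact_invariant f M"
  shows "\<exists>x. (\<theta>, x) \<in> M"
proof -
  have M: "M \<noteq> {}" "compact M" "f ` M = M" using assms by (auto simp: compact_invariant_def)
  have "fst ` M = UNIV"
  proof (rule rotation_invariant_closed_eq_UNIV [OF irrational])
    have "continuous_on M fst" by (intro continuous_intros)
    then show "closed (fst ` M)" using M(2) compact_continuous_image compact_imp_closed by blast
    show "\<theta> + to_circle \<omega> \<in> fst ` M" if "\<theta> \<in> fst ` M" for \<theta>
    proof -
      obtain z where z: "z \<in> M" "\<theta> = fst z" using \<open>\<theta> \<in> fst ` M\<close> by blast
      then have "f z \<in> M" "\<theta> + to_circle \<omega> = fst (f z)" using M(3) by (auto simp: fst_f)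
      then show ?thesis by blast
    qed
  qed (use M in simp)
  then have "\<theta> \<in> fst ` M" by simp
  then show ?thesis by force
qed


text \<open>Chains are defined by the order of the fibre. This relation between points of a fibre replaces them where the
dynamics comes in, because it is visibly preserved by fibred homeomorphisms.\<close>

definition joined :: "(circle \<times> circle) set \<Rightarrow> circle \<Rightarrow> circle \<times> circle \<Rightarrow> circle \<times> circle \<Rightarrow> bool"
  where "joined M \<theta> z z' \<longleftrightarrow> (\<exists>I. connected I \<and> fst ` I \<subseteq> {\<theta>} \<and> z \<in> I \<and> z' \<in> I \<and> I \<inter> M = {})"

text \<open>For \<open>m > 0\<close> this turns out to be equivalent to the existence of a chain with \<open>m\<close> alternations over each lift of \<open>\<theta>\<close>.\<close>

definition separable :: "(circle \<times> circle) set \<Rightarrow> (circle \<times> circle) set \<Rightarrow> nat \<Rightarrow> circle \<Rightarrow> bool"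
  where "separable M M' m \<theta> \<longleftrightarrow> (\<exists>Z. Z \<subseteq> M' \<and> finite Z \<and> card Z = m \<and> fst ` Z \<subseteq> {\<theta>} \<and>
    (\<forall>z\<in>Z. \<forall>z'\<in>Z. z \<noteq> z' \<longrightarrow> \<not> joined M \<theta> z z'))"

lemma joined_f:
  assumes "f ` M = M" "joined M \<theta> z z'"
  shows "joined M (\<theta> + to_circle \<omega>) (f z) (f z')"
proof -
  obtain I where I: "connected I" "fst ` I \<subseteq> {\<theta>}" "z \<in> I" "z' \<in> I" "I \<inter> M = {}"
    using assms(2) unfolding joined_def by blast
  have "fst ` f ` I \<subseteq> {\<theta> + to_circle \<omega>}" using I(2) by (auto simp: fst_f)
  moreover have "f ` I \<inter> M = {}" using image_Int [OF inj_f, of I M] I(5) assms(1) by simp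
  ultimately show ?thesis
    unfolding joined_def using connected_images(1) [OF I(1)] I(3,4) by blast
qed

lemma joined_g:
  assumes "f ` M = M" "joined M \<theta> z z'"
  shows "joined M (\<theta> - to_circle \<omega>) (g z) (g z')"
proof -
  obtain I where I: "connected I" "fst ` I \<subseteq> {\<theta>}" "z \<in> I" "z' \<in> I" "I \<inter> M = {}"
    using assms(2) unfolding joined_def by blast
  have "fst ` g ` I \<subseteq> {\<theta> - to_circle \<omega>}" using I(2) by (auto simp: fst_g)
  moreover have "inj g" using fg by (metis injI)
  then have "g ` I \<inter> M = {}" using image_Int [of g I M] I(5) g_image [OF assms(1)] by simp
  ultimately show ?thesis
    unfolding joined_def using connected_images(2) [OF I(1)] I(3,4) by blast
qed

lemma separable_rotate:
  assumes M: "f ` M = M" "f ` M' = M'" and "separable M M' m \<theta>"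
  shows "separable M M' m (\<theta> + to_circle \<omega>)"
proof -
  obtain Z where Z: "Z \<subseteq> M'" "finite Z" "card Z = m" "fst ` Z \<subseteq> {\<theta>}"
    and sep: "\<forall>z\<in>Z. \<forall>z'\<in>Z. z \<noteq> z' \<longrightarrow> \<not> joined M \<theta> z z'"
    using assms(3) unfolding separable_def by (elim exE conjE) (rule that; assumption)
  show ?thesis
    unfolding separable_def
  proof (intro exI [of _ "f ` Z"] conjI ballI impI notI)
    show "f ` Z \<subseteq> M'" using Z(1) M(2) by blast
    show "card (f ` Z) = m" using Z(3) inj_f by (simp add: card_image inj_on_subset)
    show "fst ` f ` Z \<subseteq> {\<theta> + to_circle \<omega>}" using Z(4) by (auto simp: fst_f)
    fix w w' assume w: "w \<in> f ` Z" "w' \<in> f ` Z" "w \<noteq> w'" "joined M (\<theta> + to_circle \<omega>) w w'"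
    obtain z z' where z: "z \<in> Z" "z' \<in> Z" "w = f z" "w' = f z'" using w(1,2) by blast
    then have "joined M \<theta> z z'" using joined_g [OF M(1) w(4)] by (simp add: gf)
    moreover have "z \<noteq> z'" using z(3,4) w(3) by auto
    ultimately show False using sep [rule_format, OF z(1,2)] by simp
  qed (use Z in simp)
qed

end

locale disjoint_invariant_sets = forced_homeo +
  fixes M M' :: "(circle \<times> circle) set"
  assumes M: "compact_invariant f M" and M': "compact_invariant f M'" and M_disjoint: "M \<inter> M' = {}"
begin

abbreviation P :: "(real \<times> real) set" where "P \<equiv> to_torus -` M"

abbreviation Q :: "(real \<times> real) set" where "Q \<equiv> to_torus -` M'"

lemma f_M: "f ` M = M" "f ` M' = M'"
  using M M' by (simp_all add: compact_invariant_def)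

sublocale periodic_pair P Q
proof
  show "closed P" "closed Q"
    using M M' by (auto simp: compact_invariant_def
        intro!: closed_vimage [OF compact_imp_closed continuous_on_to_torus])
  show "P \<inter> Q = {}" using M_disjoint by blast
qed auto

lemma ex_P: "\<exists>u. (t, u) \<in> P" and ex_Q: "\<exists>u. (t, u) \<in> Q"
proof -
  obtain c c' where "(to_circle t, c) \<in> M" "(to_circle t, c') \<in> M'"
    using invariant_projection [OF M] invariant_projection [OF M'] by blast
  moreover obtain u where "c = to_circle u" by (rule ex_to_circle)
  moreover obtain u' where "c' = to_circle u'" by (rule ex_to_circle)
  ultimately show "\<exists>u. (t, u) \<in> P" "\<exists>u. (t, u) \<in> Q" by auto
qed

lemma ex_lift:
  assumes x0: "(t, x0) \<in> P" and z: "z \<notin> M" "fst z = to_circle t"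
  shows "\<exists>u. x0 < u \<and> u < x0 + 1 \<and> z = to_torus (t, u)"
proof -
  obtain u where u: "x0 \<le> u" "u < x0 + 1" "snd z = to_circle u" by (rule ex_to_circle_in_period)
  have zu: "z = to_torus (t, u)" using z(2) u(3) by (cases z) simp
  then have "u \<noteq> x0" using x0 z(1) by auto
  with u zu show ?thesis by (intro exI [of _ u]) simp
qed

text \<open>In the fibre cut open at a point of \<open>M\<close>, a connected set avoiding \<open>M\<close> contains the segment between its points.\<close>

lemma vertical_connected_avoids:
  assumes I: "connected I" "fst ` I \<subseteq> {to_circle t}" "I \<inter> M = {}"
    and x0: "(t, x0) \<in> P" and uv: "to_torus (t, u) \<in> I" "to_torus (t, v) \<in> I" "x0 < u" "u \<le> v" "v < x0 + 1"
    and w: "u \<le> w" "w \<le> v"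
  shows "(t, w) \<notin> P"
proof -
  have eq: "I = {to_circle t} \<times> snd ` I" using I(2) by force
  have "connected (snd ` I)" by (intro connected_continuous_image I(1) continuous_intros)
  moreover have "to_circle x0 \<notin> snd ` I" using x0 I(3) eq by auto
  moreover have "to_circle u \<in> snd ` I" "to_circle v \<in> snd ` I" using uv(1,2) by force+
  ultimately have "to_circle ` {u..v} \<subseteq> snd ` I"
    using uv(3-5) by (intro connected_contains_arc)
  then have "to_circle w \<in> snd ` I" using w by auto
  then have "to_torus (t, w) \<in> I" using eq by auto
  then show ?thesis using I(3) by auto
qed

text \<open>Between any two of the points \<open>y i\<close>, on both sides, the chain contains a point of \<open>M\<close>.\<close>

lemma chain_imp_separable:
  assumes "chain m t"
  shows "separable M M' m (to_circle t)"
proof -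
  obtain x y where xy: "alternates m t x y" using assms by (auto simp: chain_def)
  define z where "z = (\<lambda>i. to_torus (t, y i))"
  have P: "(t, x i) \<in> P" if "i \<le> m" for i using xy that by (simp add: alternates_def)
  have Q: "(t, y i) \<in> Q" if "i < m" for i using xy that by (simp add: alternates_def)
  have sep: False if ij: "i < j" "j < m" and I: "connected I" "fst ` I \<subseteq> {to_circle t}" "I \<inter> M = {}" "z i \<in> I" "z j \<in> I"
    for i j I
  proof -
    have mono: "x (Suc i) \<le> x k" if "Suc i \<le> k" "k \<le> m" for k
      using that
    proof (induction k rule: dec_induct)
      case (step k)
      then show ?case using alternates_less [OF xy, of k] by simp
    qed simp
    have "x 0 < y i" "y i \<le> x j" "x j \<le> y j" "y j < x 0 + 1"
    proof -
      show "x 0 < y i" using alternates_bounds(1) [OF xy, of i] alternates_less [OF xy, of i] ij by simp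
      show "y i \<le> x j" using alternates_less(2) [OF xy, of i] mono [of j] ij by simp
      show "x j \<le> y j" using alternates_less(1) [OF xy, of j] ij by simp
      show "y j < x 0 + 1" using alternates_bounds(1) [OF xy, of "Suc j"] alternates_less(2) [OF xy, of j] ij by simp
    qed
    then have "(t, x j) \<notin> P"
      using vertical_connected_avoids [OF I(1-3) P [of 0], of "y i" "y j" "x j"] I(4,5) by (simp add: z_def)
    then show False using P [of j] ij by simp
  qed
  have inj: "inj_on z {..<m}"
  proof -
    have "False" if "i < j" "j < m" "z i = z j" for i j
      by (rule sep [OF that(1,2), of "{z i}"]) (use that Q [of i] M_disjoint in \<open>auto simp: z_def\<close>)
    then show ?thesis unfolding inj_on_def by (metis lessThan_iff linorder_neqE_nat)
  qed
  show ?thesis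
    unfolding separable_def
  proof (intro exI [of _ "z ` {..<m}"] conjI ballI impI notI)
    show "z ` {..<m} \<subseteq> M'" using Q by (auto simp: z_def)
    show "card (z ` {..<m}) = m" using inj by (simp add: card_image)
    show "fst ` z ` {..<m} \<subseteq> {to_circle t}" by (auto simp: z_def)
    fix w w' assume w: "w \<in> z ` {..<m}" "w' \<in> z ` {..<m}" "w \<noteq> w'"
      and "joined M (to_circle t) w w'"
    then obtain I where I: "connected I" "fst ` I \<subseteq> {to_circle t}" "w \<in> I" "w' \<in> I" "I \<inter> M = {}"
      unfolding joined_def by blast
    obtain i j where ij: "i < m" "j < m" "w = z i" "w' = z j" using w by blast
    then consider "i < j" | "j < i" using w(3) by (metis linorder_neqE_nat)
    then show False
    proof cases
      case 1 then show ?thesis using sep [OF 1 ij(2) I(1,2,5)] I(3,4) ij(3,4) by simp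
    next
      case 2 then show ?thesis using sep [OF 2 ij(1) I(1,2,5)] I(3,4) ij(3,4) by simp
    qed
  qed simp
qed

text \<open>Cut the fibre open at a point of \<open>M\<close> and sort the given points of \<open>M'\<close>. Two neighbours are not joined, so the
segment between them contains a point of \<open>M\<close>.\<close>

lemma separable_imp_chain:
  assumes "separable M M' m (to_circle t)" "m > 0"
  shows "chain m t"
proof -
  obtain Z where Z: "Z \<subseteq> M'" "finite Z" "card Z = m" "fst ` Z \<subseteq> {to_circle t}"
    and sep: "\<forall>z\<in>Z. \<forall>z'\<in>Z. z \<noteq> z' \<longrightarrow> \<not> joined M (to_circle t) z z'"
    using assms(1) unfolding separable_def by (elim exE conjE) (rule that; assumption)
  obtain x0 where x0: "(t, x0) \<in> P" using ex_P by blast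
  have "\<exists>u. x0 < u \<and> u < x0 + 1 \<and> z = to_torus (t, u)" if "z \<in> Z" for z
    using ex_lift [OF x0, of z] Z(1,4) that M_disjoint by auto
  then obtain h where h: "\<And>z. z \<in> Z \<Longrightarrow> x0 < h z \<and> h z < x0 + 1 \<and> z = to_torus (t, h z)" by metis
  have "inj_on h Z" using h by (metis inj_onI)
  define l where "l = sorted_list_of_set (h ` Z)"
  have l: "length l = m" "set l = h ` Z" "sorted_wrt (<) l"
    using Z(2,3) card_image [OF \<open>inj_on h Z\<close>] by (simp_all add: l_def)
  have lQ: "x0 < l ! i" "l ! i < x0 + 1" "(t, l ! i) \<in> Q" "to_torus (t, l ! i) \<in> Z" if "i < m" for i
  proof -
    obtain z where "z \<in> Z" "l ! i = h z" using l(1,2) \<open>i < m\<close> by (metis imageE nth_mem)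
    then show "x0 < l ! i" "l ! i < x0 + 1" "(t, l ! i) \<in> Q" "to_torus (t, l ! i) \<in> Z"
      using h [of z] Z(1) by auto
  qed
  have "\<exists>w. (t, w) \<in> P \<and> l ! i \<le> w \<and> w \<le> l ! Suc i" if i: "Suc i < m" for i
  proof (rule ccontr)
    assume none: "\<not> ?thesis"
    have less: "l ! i < l ! Suc i" using l(1,3) i by (simp add: sorted_wrt_nth_less)
    let ?I = "to_torus ` ({t} \<times> {l ! i..l ! Suc i})"
    have "to_torus (t, l ! i) \<noteq> to_torus (t, l ! Suc i)"
    proof
      assume "to_torus (t, l ! i) = to_torus (t, l ! Suc i)"
      then obtain k where k: "l ! Suc i = l ! i + of_int k" by (auto elim: to_circle_eqE [OF sym])
      then have "of_int k > (0::real)" "of_int k < (1::real)" using less lQ(1) [of i] lQ(2) [OF i] i by simp_all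
      then have "0 < k" "k < 1" by simp_all
      then show False by simp
    qed
    moreover have "joined M (to_circle t) (to_torus (t, l ! i)) (to_torus (t, l ! Suc i))"
      unfolding joined_def
    proof (intro exI [of _ ?I] conjI)
      show "connected ?I"
        by (intro connected_continuous_image continuous_on_to_torus connected_Times connected_Icc) simp
      show "?I \<inter> M = {}" using none by auto
      show "to_torus (t, l ! i) \<in> ?I" "to_torus (t, l ! Suc i) \<in> ?I" using less by (intro imageI; simp)+
    qed auto
    ultimately show False using sep lQ(4) [of i] lQ(4) [OF i] i by simp
  qed
  then obtain a where a: "\<And>i. Suc i < m \<Longrightarrow> (t, a i) \<in> P \<and> l ! i \<le> a i \<and> a i \<le> l ! Suc i" by metis
  \<comment> \<open>The chain starts and ends at \<open>x0\<close>, where the fibre was cut open.\<close>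
  define x where "x = (\<lambda>i. if i = 0 then x0 else if i < m then a (i - 1) else x0 + 1)"
  have "(t, x0 + 1) \<in> P" using x0 P_shift_y [of t x0 1] by simp
  then have "(t, x i) \<in> P" for i using x0 a [of "i - 1"] by (simp add: x_def)
  moreover have "x i \<le> l ! i" "l ! i \<le> x (Suc i)" if "i < m" for i
    using lQ(1,2) [OF that] a [of "i - 1"] a [of i] that by (auto simp: x_def)
  moreover have "x m = x 0 + 1" using \<open>m > 0\<close> by (simp add: x_def)
  ultimately have "alternates m t x ((!) l)" using lQ(3) by (simp add: alternates_def)
  then show ?thesis by (auto simp: chain_def)
qed

text \<open>The base points with at least \<open>m\<close> alternations form a closed set invariant under the rotation.\<close>

lemma chain_everywhere:
  assumes "chain m t" "m > 0"
  shows "chain m t'"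
proof -
  have eq: "to_circle -` {\<theta>. separable M M' m \<theta>} = {t. chain m t}"
    using chain_imp_separable separable_imp_chain \<open>m > 0\<close> by blast
  have "{\<theta>. separable M M' m \<theta>} = UNIV"
  proof (rule rotation_invariant_closed_eq_UNIV [OF irrational])
    show "closed {\<theta>. separable M M' m \<theta>}"
      unfolding closed_circle_iff eq by (rule closed_chain)
    show "{\<theta>. separable M M' m \<theta>} \<noteq> {}" using chain_imp_separable assms(1) by blast
    show "\<theta> + to_circle \<omega> \<in> {\<theta>. separable M M' m \<theta>}" if "\<theta> \<in> {\<theta>. separable M M' m \<theta>}" for \<theta>
      using that separable_rotate [OF f_M] by simp
  qed
  then show ?thesis using eq by blast
qed

lemma ex_maximal_pair: "\<exists>N. maximal_pair P Q N"
proof -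
  obtain B where "\<forall>m. chain m 0 \<longrightarrow> m \<le> B" using chain_bounded [of 0] by blast
  then have B: "chain m 0 \<Longrightarrow> m \<le> B" for m by blast
  define N where "N = (GREATEST m. chain m 0)"
  have chain1: "chain 1 0" using ex_P [of 0] ex_Q [of 0] chain_1 [of 0] by blast
  have "chain N 0" unfolding N_def using chain1 B by (rule GreatestI_nat)
  have "1 \<le> N" unfolding N_def using chain1 B by (rule Greatest_le_nat)
  have "\<not> chain (Suc N) 0"
  proof
    assume "chain (Suc N) 0"
    then have "Suc N \<le> N" unfolding N_def using B by (rule Greatest_le_nat)
    then show False by simp
  qed
  have "maximal_pair P Q N"
  proof
    show "N > 0" using \<open>1 \<le> N\<close> by simp
    show "chain N t" for t using chain_everywhere [OF \<open>chain N 0\<close>] \<open>1 \<le> N\<close> by simp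
    show "\<not> chain (Suc N) t" for t using chain_everywhere [of "Suc N" t 0] \<open>\<not> chain (Suc N) 0\<close> by blast
  qed
  then show ?thesis by blast
qed

text \<open>The complement of the strip, described without an index function and in terms preserved by \<open>f\<close>: what remains are
the points of \<open>M\<close> together with the intervals between neighbouring points of \<open>M\<close>, as far as these avoid \<open>M'\<close>.\<close>

definition filled_complement :: "(circle \<times> circle) set"
  where "filled_complement = {z. \<exists>w\<in>M'. joined M (fst z) z w}"

lemma filled_complement_invariant: "f ` filled_complement = filled_complement"
proof (intro subset_antisym subsetI)
  fix z assume "z \<in> f ` filled_complement"
  then obtain v w where "z = f v" "w \<in> M'" "joined M (fst v) v w"
    unfolding filled_complement_def by blast
  then have "f w \<in> M'" "joined M (fst z) z (f w)"
    using joined_f [OF f_M(1)] f_M(2) by (auto simp: fst_f)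
  then show "z \<in> filled_complement" unfolding filled_complement_def by blast
next
  fix z assume "z \<in> filled_complement"
  then obtain w where "w \<in> M'" "joined M (fst z) z w"
    unfolding filled_complement_def by blast
  then have "g w \<in> M'" "joined M (fst (g z)) (g z) (g w)"
    using joined_g [OF f_M(1)] g_image [OF f_M(2)] by (auto simp: fst_g)
  then have "g z \<in> filled_complement" unfolding filled_complement_def by blast
  then show "z \<in> f ` filled_complement" using fg by (metis imageI)
qed

end

section \<open>From two minimal sets to an invariant strip\<close>

text \<open>The preimage of the two invariant sets, indexed so that the even blocks belong to \<open>M\<close> and the odd ones to \<open>M'\<close>.\<close>

locale indexed_invariant_sets = disjoint_invariant_sets f g \<omega> M M' +
  indexed_set_sections "P \<union> Q" \<kappa> N d s
  for f g \<omega> M M' \<kappa> N d s +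
  assumes even_P: "z \<in> P \<Longrightarrow> even (\<kappa> z)" and odd_Q: "z \<in> Q \<Longrightarrow> odd (\<kappa> z)"
begin

lemma Q_in_gap:
  assumes "(t, u) \<in> Q"
  obtains i where "(t, u) \<in> gap (2 * i + 1)"
proof -
  obtain i where "\<kappa> (t, u) = 2 * i + 1" using odd_Q [OF assms] by (rule oddE)
  then show thesis using that in_gap_if [of t u] assms by simp
qed

lemma gap_meets_Q: "\<exists>u. (t, u) \<in> Q \<and> (t, u) \<in> gap (2 * i + 1)"
proof -
  obtain u where u: "(t, u) \<in> P \<union> Q" "\<kappa> (t, u) = 2 * i + 1" using \<kappa>_surj by blast
  then have "(t, u) \<notin> P" using even_P [of "(t, u)"] by auto
  with u show ?thesis using in_gap_if [of t u] by auto
qed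

lemma gap_avoids_P: "(t, u) \<in> gap (2 * i + 1) \<Longrightarrow> (t, u) \<notin> P"
proof
  assume gap: "(t, u) \<in> gap (2 * i + 1)" and P: "(t, u) \<in> P"
  obtain k where k: "\<kappa> (t, u) = 2 * k" using even_P [OF P] by (rule evenE)
  then have "(t, u) \<in> block (2 * k)" using P by (auto simp: block_def)
  then have "2 * k = 2 * i + 1" using gap by (rule block_gap_disjoint)
  then show False by presburger
qed

text \<open>A point of \<open>M\<close> of smaller index than \<open>x\<close> lies below \<open>x\<close>, hence below the segment from \<open>x\<close> to \<open>y\<close>. A point of \<open>M'\<close> of
smaller index is below such a point of \<open>M\<close>, because every intermediate index occurs. The same holds above.\<close>

lemma gap_if_segment_avoids_P:
  assumes x: "(t, x) \<in> Q" and avoid: "\<And>u. min x y \<le> u \<Longrightarrow> u \<le> max x y \<Longrightarrow> (t, u) \<notin> P"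
  shows "\<exists>i. (t, y) \<in> gap (2 * i + 1)"
proof -
  obtain i where i: "\<kappa> (t, x) = 2 * i + 1" using odd_Q [OF x] by (rule oddE)
  have P_less: "u < y" if "(t, u) \<in> P" "\<kappa> (t, u) < 2 * i + 1" for u
  proof -
    have "u < x" using \<kappa>_less [of t u x] that x i by simp
    then show ?thesis using avoid [of u] that(1) by fastforce
  qed
  have P_greater: "y < u" if "(t, u) \<in> P" "2 * i + 1 < \<kappa> (t, u)" for u
  proof -
    have "x < u" using \<kappa>_less [of t x u] that x i by simp
    then show ?thesis using avoid [of u] that(1) by fastforce
  qed
  have "u < y" if u: "(t, u) \<in> P \<union> Q" "\<kappa> (t, u) < 2 * i + 1" for u
  proof (cases "(t, u) \<in> P")
    case False
    then have "odd (\<kappa> (t, u))" using u odd_Q by blast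
    then have "\<kappa> (t, u) < 2 * i" using u(2) by presburger
    obtain v where v: "(t, v) \<in> P \<union> Q" "\<kappa> (t, v) = 2 * i" using \<kappa>_surj by blast
    then have "(t, v) \<in> P" using odd_Q [of "(t, v)"] by auto
    then have "v < y" using P_less v(2) by simp
    moreover have "u < v" using \<kappa>_less u(1) v \<open>\<kappa> (t, u) < 2 * i\<close> by simp
    ultimately show ?thesis by simp
  qed (use P_less u in blast)
  moreover have "y < u" if u: "(t, u) \<in> P \<union> Q" "2 * i + 1 < \<kappa> (t, u)" for u
  proof (cases "(t, u) \<in> P")
    case False
    then have "odd (\<kappa> (t, u))" using u odd_Q by blast
    then have "2 * i + 2 < \<kappa> (t, u)" using u(2) by presburger
    obtain v where v: "(t, v) \<in> P \<union> Q" "\<kappa> (t, v) = 2 * i + 2" using \<kappa>_surj by blast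
    then have "(t, v) \<in> P" using odd_Q [of "(t, v)"] by auto
    then have "y < v" using P_greater v(2) by simp
    moreover have "v < u" using \<kappa>_less u(1) v \<open>2 * i + 2 < \<kappa> (t, u)\<close> by simp
    ultimately show ?thesis by simp
  qed (use P_greater u in blast)
  ultimately have "(t, y) \<in> gap (2 * i + 1)" unfolding gap_def by blast
  then show ?thesis ..
qed

text \<open>A gap of odd index avoids \<open>M\<close> and joins each of its points to the block of \<open>M'\<close> inside it. Conversely, in the fibre
cut open at a point of \<open>M\<close>, a connected set avoiding \<open>M\<close> contains the segment from a point to \<open>M'\<close>.\<close>

lemma Union_comp_eq: "(\<Union>i. comp i) = filled_complement"
proof (intro subset_antisym subsetI)
  fix z assume "z \<in> (\<Union>i. comp i)"
  then obtain i t y where z: "z = to_torus (t, y)" "(t, y) \<in> gap (2 * i + 1)"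
    unfolding comp_def by auto
  define I where "I = to_torus ` ({t} \<times> {y. (t, y) \<in> gap (2 * i + 1)})"
  have "connected I"
    unfolding I_def
    by (intro connected_continuous_image continuous_on_to_torus connected_Times connected_gap_slice connected_sing)
  moreover have "fst ` I \<subseteq> {fst z}" using z by (auto simp: I_def)
  moreover have "z \<in> I" using z by (auto simp: I_def)
  moreover have "I \<inter> M = {}" using gap_avoids_P by (auto simp: I_def)
  moreover have "I \<inter> M' \<noteq> {}"
  proof -
    obtain u where "(t, u) \<in> Q" "(t, u) \<in> gap (2 * i + 1)" using gap_meets_Q by blast
    then have "to_torus (t, u) \<in> I \<inter> M'" by (auto simp: I_def)
    then show ?thesis by blast
  qed
  ultimately show "z \<in> filled_complement" unfolding filled_complement_def joined_def by blast
next
  fix z assume "z \<in> filled_complement"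
  then obtain I w where I: "connected I" "fst ` I \<subseteq> {fst z}" "z \<in> I" "I \<inter> M = {}" "w \<in> I" "w \<in> M'"
    unfolding filled_complement_def joined_def by blast
  obtain t where t: "fst z = to_circle t" by (rule ex_to_circle)
  obtain x0 where x0: "(t, x0) \<in> P" using ex_P by blast
  have lift: "\<exists>u. x0 < u \<and> u < x0 + 1 \<and> v = to_torus (t, u)" if "v \<in> I" for v
    using ex_lift [OF x0, of v] I(2,4) t that by auto
  obtain y where y: "x0 < y" "y < x0 + 1" "z = to_torus (t, y)" using lift [OF I(3)] by blast
  obtain x where x: "x0 < x" "x < x0 + 1" "w = to_torus (t, x)" using lift [OF I(5)] by blast
  have "(t, u) \<notin> P" if "min x y \<le> u" "u \<le> max x y" for u
  proof (rule vertical_connected_avoids [OF I(1) _ I(4) x0 _ _ _ _ _ that])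
    show "fst ` I \<subseteq> {to_circle t}" using I(2) t by simp
    show "to_torus (t, min x y) \<in> I" "to_torus (t, max x y) \<in> I"
      using I(3,5) x(3) y(3) by (simp_all add: min_def max_def)
  qed (use x y in auto)
  then obtain i where "(t, y) \<in> gap (2 * i + 1)" using gap_if_segment_avoids_P [of t x y] I(6) x(3) by auto
  then show "z \<in> (\<Union>i. comp i)" using y(3) by (auto simp: comp_def)
qed

lemma M'_subset: "M' \<subseteq> (\<Union>i. comp i)"
proof
  fix z assume z: "z \<in> M'"
  obtain t where t: "fst z = to_circle t" by (rule ex_to_circle)
  obtain u where u: "snd z = to_circle u" by (rule ex_to_circle)
  have zz: "z = to_torus (t, u)" using t u by (cases z) auto
  then have "(t, u) \<in> Q" using z by simp
  then obtain i where "(t, u) \<in> gap (2 * i + 1)" by (rule Q_in_gap)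
  then show "z \<in> (\<Union>i. comp i)" using zz by (auto simp: comp_def)
qed

lemma comp_meets_M': "comp i \<inter> M' \<noteq> {}"
proof -
  obtain u where "(0, u) \<in> Q" "(0, u) \<in> gap (2 * i + 1)" using gap_meets_Q by blast
  then have "to_torus (0, u) \<in> comp i \<inter> M'" by (auto simp: comp_def)
  then show ?thesis by blast
qed

text \<open>If a set \<open>\<O>\<close> of components is mapped into itself, then \<open>f\<close> permutes \<open>\<O>\<close>, and the part of \<open>M'\<close> in \<open>\<O>\<close> is invariant. This
part is closed, since the other components are open and cover the rest of \<open>M'\<close>. By minimality it is all of
\<open>M'\<close>, so \<open>\<O>\<close> contains every component.\<close>

lemma comps_cyclically_permuted:
  assumes minimal: "minimal_set f M'"
  shows "cyclically_permuted f p (range comp)"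
proof -
  have inv: "f ` (\<Union>i. comp i) = (\<Union>i. comp i)"
    unfolding Union_comp_eq by (rule filled_complement_invariant)
  have fin: "finite (range comp)" unfolding range_comp by simp
  have "cyclically_permuted f (card (range comp)) (range comp)"
  proof (rule cyclically_permuted_if_transitive [OF fin _ inj_f])
    show "f ` U \<in> range comp" if "U \<in> range comp" for U
      using image_component [OF f_cont g_cont gf fg inv] that unfolding components_comp by blast
    show "\<O> = range comp"
      if sub: "\<O> \<subseteq> range comp" and ne: "\<O> \<noteq> {}" and maps: "\<And>U. U \<in> \<O> \<Longrightarrow> f ` U \<in> \<O>" for \<O>
    proof -
      have "(`) f ` \<O> = \<O>"
      proof (rule card_subset_eq)
        show "finite \<O>" using sub fin finite_subset by blast
        show "(`) f ` \<O> \<subseteq> \<O>" using maps by blast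
        show "card ((`) f ` \<O>) = card \<O>"
          by (rule card_image) (use inj_image_eq_iff [OF inj_f] in \<open>auto simp: inj_on_def\<close>)
      qed
      then have "f ` \<Union>\<O> = \<Union>\<O>" by blast
      define K where "K = M' \<inter> \<Union>\<O>"
      have "f ` K = K"
        unfolding K_def using image_Int [OF inj_f, of M' "\<Union>\<O>"] \<open>f ` \<Union>\<O> = \<Union>\<O>\<close> f_M by simp
      have others: "K = M' \<inter> - \<Union>(range comp - \<O>)"
      proof (intro subset_antisym subsetI)
        fix z assume "z \<in> K"
        then obtain U where U: "z \<in> M'" "z \<in> U" "U \<in> \<O>" by (auto simp: K_def)
        have "z \<notin> V" if V: "V \<in> range comp - \<O>" for V
        proof
          assume "z \<in> V"
          obtain i where i: "U = comp i" using U(3) sub by blast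
          obtain j where j: "V = comp j" using V by blast
          note ij = i j
          then obtain n where "j = i + int p * n" using comp_meet [of z i j] U(2) \<open>z \<in> V\<close> by blast
          then have "V = U" using ij comp_periodic by simp
          then show False using U(3) V by blast
        qed
        then show "z \<in> M' \<inter> - \<Union>(range comp - \<O>)" using U(1) by blast
      next
        fix z assume "z \<in> M' \<inter> - \<Union>(range comp - \<O>)"
        then show "z \<in> K" using M'_subset unfolding K_def by blast
      qed
      have "open (\<Union>(range comp - \<O>))" using open_comp by blast
      then have "compact K"
        unfolding others using M' by (intro compact_Int_closed closed_Compl) (simp_all add: compact_invariant_def)
      moreover have "K \<noteq> {}"
        using ne sub comp_meets_M' unfolding K_def by blast
      ultimately have "compact_invariant f K" using \<open>f ` K = K\<close> by (simp add: compact_invariant_def)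
      then have "K = M'" using minimal unfolding minimal_set_def K_def by blast
      have "U \<in> \<O>" if "U \<in> range comp" for U
      proof (rule ccontr)
        assume "U \<notin> \<O>"
        then have "U \<inter> M' = {}" using \<open>K = M'\<close> others that by blast
        then show False using that comp_meets_M' by blast
      qed
      with sub show ?thesis by blast
    qed
  qed simp
  moreover have "card (range comp) = p" using card_components_comp unfolding components_comp .
  ultimately show ?thesis by simp
qed

end

lemma (in disjoint_invariant_sets) ex_invariant_strip:
  assumes "minimal_set f M'"
  shows "\<exists>p q A. 1 \<le> p \<and> 1 \<le> q \<and> invariant_strip f p q A"
proof -
  obtain N where "maximal_pair P Q N" using ex_maximal_pair by blast
  then obtain \<kappa> d where idx: "indexed_set (P \<union> Q) \<kappa> N d" and parity: "\<forall>z\<in>P. even (\<kappa> z)" "\<forall>z\<in>Q. odd (\<kappa> z)"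
    using maximal_pair.ex_indexed_set by blast
  obtain s where s: "\<And>j. continuous_on UNIV (s j)" "\<And>j t. (t, s j t) \<in> indexed_set.gap (P \<union> Q) \<kappa> j"
    "\<And>j t m k. s (j + 2 * (d * m + int N * k)) (t + of_int m) = s j t + of_int k"
    using indexed_set.ex_sections [OF idx] by blast
  interpret indexed_set "P \<union> Q" \<kappa> N d by (rule idx)
  interpret indexed_invariant_sets f g \<omega> M M' \<kappa> N d s
    by unfold_locales (use s parity in auto)
  have "invariant_strip f p q (- (\<Union>i. comp i))"
  proof (rule complement_is_strip [OF _ comps_cyclically_permuted [OF assms]])
    show "f ` (- (\<Union>i. comp i)) = - (\<Union>i. comp i)"
      unfolding Union_comp_eq bij_image_Compl_eq [OF bij_f] filled_complement_invariant ..
  qed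
  moreover have "1 \<le> p" "1 \<le> q" using p_pos q_pos by simp_all
  ultimately show ?thesis by blast
qed

theorem proposition1p5:
  fixes f :: "circle \<times> circle \<Rightarrow> circle \<times> circle"
  assumes "qpf_circle_homeo f"
    and "\<not> (\<exists>p q A. 1 \<le> p \<and> 1 \<le> q \<and> invariant_strip f p q A)"
  shows "\<exists>!M. minimal_set f M"
proof -
  obtain \<omega> where \<omega>: "\<omega> \<notin> \<rat>" "\<And>\<theta> x. fst (f (\<theta>, x)) = \<theta> + to_circle \<omega>"
    and "homeomorphic_map euclidean euclidean f"
    using assms(1) by (auto simp: qpf_circle_homeo_def)
  then obtain g where g: "homeomorphic_maps euclidean euclidean f g"
    by (auto simp: homeomorphic_map_maps)
  interpret forced_homeo f g \<omega>
  proof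
    show "continuous_on UNIV f" "continuous_on UNIV g" "g (f z) = z" "f (g z) = z" for z
      using g by (cases z; simp add: homeomorphic_maps_def)+
    show "fst (f z) = fst z + to_circle \<omega>" for z using \<omega>(2) by (cases z) simp
  qed (rule \<omega>(1))
  obtain M where M: "minimal_set f M" using ex_minimal_set [OF bij_f compact_UNIV_torus] by blast
  have "M' = M" if min': "minimal_set f M'" for M'
  proof (rule ccontr)
    assume "M' \<noteq> M"
    then have "M \<inter> M' = {}" using minimal_sets_disjoint [OF inj_f M min'] by blast
    then interpret disjoint_invariant_sets f g \<omega> M M'
      using M min' by unfold_locales (simp_all add: minimal_set_def)
    show False using ex_invariant_strip [OF min'] assms(2) by blast
  qed
  with M show ?thesis by blast
qed

end
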